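(* Let $C$ be a $C_{3,4}$ curve over $K$, let $D, D'$ be typical divisors of degree $3$ on $C$ (with $D \neq D'$ for addition and $D' = D$ for doubling), each represented by the coefficients of its elements $F,G$ as in the context together with $a^{-1}$. Consider the addition algorithm and the doubling algorithm described in the context, which compute in the Jacobian $\mathrm{Pic}^0(C)$ the class $[D-3P_\infty]+[D'-3P_\infty]$, each of which contains exactly two $K$-inversions (Inversion 1 and Inversion 2). Each algorithm works correctly on the typical input (that is, it returns the representing elements of a divisor $D'''$ of degree $3$ with $[D'''-3P_\infty]=[D-3P_\infty]+[D'-3P_\infty]$) and yields a typical divisor $D'''$ as output if and only if the two $K$-inversions in the algorithm can be carried out.
   Context: General notation. $K$ is a field and $C$ is a smooth projective (geometrically irreducible) curve of genus $g$ over $K$ with a $K$-rational point $P_\infty$; $R$ is the coordinate ring of the affine curve $C-\{P_\infty\}$; for nonzero $f\in R$, $\deg f$ is the order of the pole of $f$ at $P_\infty$ ($\deg 0=-\infty$). $W^N=\{f\in R:\deg f\le N\}$. A good divisor is an effective $K$-rational divisor whose support does not contain $P_\infty$. For $f\in R$ nonzero, $\operatorname{div} f$ denotes only the affine part of the divisor of $f$ (the component at $P_\infty$ is ignored), so $\operatorname{div} f$ is a good divisor of degree $\deg f$. For a good divisor $D$, $I_D=\{f\in R: f=0 \text{ or } \operatorname{div} f\ge D\}$ and $W^N_D=W^N\cap I_D$. A divisor $D$ is typical if it is good of degree $d\ge g$ and there exist $s\in W^{d+g}_D$, $t\in W^{d+g+1}_D$ with $sW^{2g}+tW^{2g-1}+W^{d+g-1}=W^{d+3g}$.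 $C_{3,4}$ curves. A $C_{3,4}$ curve is a smooth projective curve of genus $g=3$ whose affine part $C-\{P_\infty\}$ has an equation $f(x,y)=y^3-x^4+\sum_{3i+4j<12}c_{ij}x^iy^j=0$; so $R=K[x,y]/\langle f\rangle$, $\deg x=3$, $\deg y=4$. A typical divisor $D$ of degree $3$ is represented by elements $F=x^2+ay+bx+c\in W^6_D$ and $G=xy+dy+ex+f\in W^7_D$ (with $a\neq 0$), by storing $a,\dots,f$ and $a^{-1}$; put $H=a^{-1}(yF-xG)$. The primed analogues for $D'$ are $F',G',H'$. The algorithms. Step 1, addition. The space $W^{10}_{D'}$ has basis $F',G',H',xF',xG'$. Let $M$ be the $3\times 5$ matrix whose columns represent the images of these elements in $W^{10}/W^{10}_D\cong W^5=\operatorname{span}(1,x,y)$. Step 1, doubling. Write $\operatorname{div}F=D+A$, and find $G_1\in W^7_A$ of degree $7$ and $H_1\in W^8$ with $GG_1+FH_1=0$. Let $M$ be the $3\times5$ matrix whose columns represent the images in the $3$-dimensional space $W^{11}/W^{11}_D$ of $G_1,\,-H_1,\,yG_1+xH_1,\,xG_1,\,-xH_1$; these correspond respectively to the elements $F,\,G,\,yF-xG,\,xF,\,xG$ of $W^{10}_D$. Step 2 (Inversion 1). Find $\ker M$ by Gaussian elimination (row exchanges being allowed), expressing the fourth and fifth columns as linear combinations of the first three. This requires inverting the determinant $U$ of the leftmost $3\times 3$ submatrix of $M$; the inversion can be carried out iff $U\ne0$. The corresponding linear combinations of the basis elements give $s\in W^9$ and $t\in W^{10}$ with leading monomials $x^3$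 and $x^2y$ (degrees $9$ and $10$). Step 3 (Inversion 2). Let $V=W^{17}/(sW^8+W^8)$, a $3$-dimensional space, and let $M''$ be the $3\times 5$ matrix of the images in $V$ of $t,xt,yt,x^2t,xyt$. The inversion performed here is that of a product $\beta_2\gamma_4$, where $\beta_2\neq 0$ iff the first three columns of $M''$ are linearly independent; when this holds, expressing the fourth and fifth columns in terms of the first three, the kernel of $M''$ gives elements $F''=x^2+a''y+b''x+c''$ and $G''=xy+d''y+e''x+f''$, and $a''=-\gamma_4$. So the inversion can be carried out iff $\beta_2\ne0$ and $a''\neq0$. Step 4. Compute $G'''\in W^7$ with leading monomial $xy$ and no $x^2$ term, and $H''\in W^8$, such that $G'''G''+F''H''\in W^5$. Return $(F'',G''')$ and $(a'')^{-1}$, as representing a divisor $D'''$. *)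

theory Defs
  imports
    "HOL-Computational_Algebra.Polynomial"
    "HOL-Algebra.QuotRing"
    "HOL-Algebra.Ideal_Product"
    "HOL-Algebra.Embedded_Algebras"
    "HOL-Algebra.Free_Abelian_Groups"
    "Jordan_Normal_Form.Determinant"
    "Jordan_Normal_Form.Matrix_Kernel"
begin

section \<open>The affine curve and its coordinate ring\<close>

text \<open>\<open>K[x,y]\<close> is the type \<open>'k poly poly\<close>: the outer variable is \<open>y\<close>, the inner one \<open>x\<close>, so
  the coefficient of \<open>x^i y^j\<close> in \<open>p\<close> is \<open>coeff (coeff p j) i\<close>.\<close>

abbreviation cst :: "'k::field \<Rightarrow> 'k poly poly" where "cst k \<equiv> [:[:k:]:]"
abbreviation XX :: "'k::field poly poly" where "XX \<equiv> [:[:0, 1:]:]"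
abbreviation YY :: "'k::field poly poly" where "YY \<equiv> [:0, 1:]"

definition KXY :: "'k::field poly poly ring" where
  "KXY = \<lparr>carrier = UNIV, monoid.mult = (*), monoid.one = 1, ring.zero = 0, ring.add = (+)\<rparr>"

text \<open>Only the coefficients \<open>c i j\<close> with \<open>3 i + 4 j < 12\<close> matter.\<close>

definition curve_eq :: "(nat \<Rightarrow> nat \<Rightarrow> 'k::field) \<Rightarrow> 'k poly poly" where
  "curve_eq c = YY ^ 3 - XX ^ 4 + (\<Sum>(i, j) \<in> {(i, j). 3 * i + 4 * j < 12}. cst (c i j) * XX ^ i * YY ^ j)"

definition coord_ring :: "(nat \<Rightarrow> nat \<Rightarrow> 'k::field) \<Rightarrow> 'k poly poly set ring" where
  "coord_ring c = KXY Quot (PIdl\<^bsub>KXY\<^esub> (curve_eq c))"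

definition cls :: "(nat \<Rightarrow> nat \<Rightarrow> 'k::field) \<Rightarrow> 'k poly poly \<Rightarrow> 'k poly poly set" where
  "cls c p = (PIdl\<^bsub>KXY\<^esub> (curve_eq c)) +>\<^bsub>KXY\<^esub> p"

text \<open>The projective closure of the affine curve in the plane has the single point
  \<open>(0:1:0)\<close> at infinity, is smooth there, and is geometrically irreducible. Hence the smooth
  projective model is this plane quartic (of genus 3) exactly when the affine part is smooth,
  which is the Jacobian criterion at every closed point.\<close>

definition C34_curve :: "(nat \<Rightarrow> nat \<Rightarrow> 'k::field) \<Rightarrow> bool" where
  "C34_curve c \<longleftrightarrow> (\<forall>P. maximalideal P (coord_ring c) \<longrightarrow>
     \<not> (cls c (map_poly pderiv (curve_eq c)) \<in> P \<and> cls c (pderiv (curve_eq c)) \<in> P))"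

section \<open>Pole order at infinity\<close>

text \<open>In the coordinates \<open>u = x/y\<close>, \<open>w = 1/y\<close> the point at infinity is the origin. Its local ring
  consists of the fractions \<open>A/B\<close> where \<open>A\<close>, \<open>B\<close> are polynomials of total degree at most a common \<open>N\<close>
  and the coefficient of \<open>y^N\<close> in \<open>B\<close> is nonzero; the fraction is a unit iff the same holds for
  \<open>A\<close>. The equation of the curve becomes \<open>w = u^4 + ...\<close> with the remaining terms in the square of the
  maximal ideal, so \<open>u = x/y\<close> is a uniformizer. Thus \<open>r\<close> has a pole of order \<open>n\<close> iff
  \<open>r = (y/x)^n * (B/A)\<close> for a unit \<open>B/A\<close>.\<close>

definition unit_at_infinity :: "nat \<Rightarrow> 'k::field poly poly \<Rightarrow> bool" where
  "unit_at_infinity N A \<longleftrightarrow>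
     (\<forall>i j. coeff (coeff A j) i \<noteq> 0 \<longrightarrow> i + j \<le> N) \<and> coeff (coeff A N) 0 \<noteq> 0"

definition has_pole_order :: "(nat \<Rightarrow> nat \<Rightarrow> 'k::field) \<Rightarrow> 'k poly poly set \<Rightarrow> nat \<Rightarrow> bool" where
  "has_pole_order c r n \<longleftrightarrow> (\<exists>N A B. unit_at_infinity N A \<and> unit_at_infinity N B \<and>
     cls c (XX ^ n * A) \<otimes>\<^bsub>coord_ring c\<^esub> r = cls c (YY ^ n * B))"

text \<open>Meaningful for nonzero \<open>r\<close> only.\<close>

definition fdeg :: "(nat \<Rightarrow> nat \<Rightarrow> 'k::field) \<Rightarrow> 'k poly poly set \<Rightarrow> nat" where
  "fdeg c r = (THE n. has_pole_order c r n)"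

definition W :: "(nat \<Rightarrow> nat \<Rightarrow> 'k::field) \<Rightarrow> nat \<Rightarrow> 'k poly poly set set" where
  "W c N = {r \<in> carrier (coord_ring c). r = \<zero>\<^bsub>coord_ring c\<^esub> \<or> fdeg c r \<le> N}"

section \<open>Divisors\<close>

text \<open>Closed points of the projective curve: \<open>None\<close> is the point at infinity, \<open>Some P\<close> is the affine
  closed point given by the maximal ideal \<open>P\<close>. Divisors, i.e. the \<open>K\<close>-rational ones, are elements of the
  free abelian group on the closed points.\<close>

type_synonym 'k point = "'k poly poly set set option"
type_synonym 'k divisor = "'k point \<Rightarrow>\<^sub>0 int"

definition points :: "(nat \<Rightarrow> nat \<Rightarrow> 'k::field) \<Rightarrow> 'k point set" where
  "points c = insert None (Some ` {P. maximalideal P (coord_ring c)})"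

definition residue_degree :: "(nat \<Rightarrow> nat \<Rightarrow> 'k::field) \<Rightarrow> 'k poly poly set set \<Rightarrow> nat" where
  "residue_degree c P = (THE n. ring.dimension (coord_ring c Quot P) n
     (range (\<lambda>k. P +>\<^bsub>coord_ring c\<^esub> cls c (cst k))) (carrier (coord_ring c Quot P)))"

definition point_degree :: "(nat \<Rightarrow> nat \<Rightarrow> 'k::field) \<Rightarrow> 'k point \<Rightarrow> nat" where
  "point_degree c q = (case q of None \<Rightarrow> 1 | Some P \<Rightarrow> residue_degree c P)"

definition divdeg :: "(nat \<Rightarrow> nat \<Rightarrow> 'k::field) \<Rightarrow> 'k divisor \<Rightarrow> int" where
  "divdeg c D = (\<Sum>q \<in> Poly_Mapping.keys D. Poly_Mapping.lookup D q * int (point_degree c q))"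

definition good :: "(nat \<Rightarrow> nat \<Rightarrow> 'k::field) \<Rightarrow> 'k divisor \<Rightarrow> bool" where
  "good c D \<longleftrightarrow> Poly_Mapping.keys D \<subseteq> points c \<and> (\<forall>q. 0 \<le> Poly_Mapping.lookup D q) \<and>
     Poly_Mapping.lookup D None = 0"

text \<open>As \<open>P\<close> is maximal, its power \<open>P^n\<close> is primary; it is the contraction of the \<open>n\<close>-th power of the maximal
  ideal of the local ring, so \<open>r\<close> lies in it iff \<open>r\<close> vanishes to order at least \<open>n\<close>.\<close>

definition vanishing_order :: "(nat \<Rightarrow> nat \<Rightarrow> 'k::field) \<Rightarrow> 'k poly poly set set \<Rightarrow> 'k poly poly set \<Rightarrow> nat" where
  "vanishing_order c P r = (GREATEST n. r \<in> P [^]\<^bsub>ideals_set (coord_ring c)\<^esub> n)"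

text \<open>For nonzero \<open>r\<close> the functions below have finite support, so that \<open>Abs_poly_mapping\<close> is applied
  within its range.\<close>

definition affine_div :: "(nat \<Rightarrow> nat \<Rightarrow> 'k::field) \<Rightarrow> 'k poly poly set \<Rightarrow> 'k divisor" where
  "affine_div c r = Abs_poly_mapping (\<lambda>q. case q of None \<Rightarrow> 0
     | Some P \<Rightarrow> if maximalideal P (coord_ring c) then int (vanishing_order c P r) else 0)"

definition I_div :: "(nat \<Rightarrow> nat \<Rightarrow> 'k::field) \<Rightarrow> 'k divisor \<Rightarrow> 'k poly poly set set" where
  "I_div c D = {r \<in> carrier (coord_ring c). r = \<zero>\<^bsub>coord_ring c\<^esub> \<or>
     (\<forall>q. Poly_Mapping.lookup D q \<le> Poly_Mapping.lookup (affine_div c r) q)}"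

definition WD :: "(nat \<Rightarrow> nat \<Rightarrow> 'k::field) \<Rightarrow> nat \<Rightarrow> 'k divisor \<Rightarrow> 'k poly poly set set" where
  "WD c N D = W c N \<inter> I_div c D"

abbreviation genus :: nat where "genus \<equiv> 3"

definition typical :: "(nat \<Rightarrow> nat \<Rightarrow> 'k::field) \<Rightarrow> 'k divisor \<Rightarrow> bool" where
  "typical c D \<longleftrightarrow> good c D \<and> int genus \<le> divdeg c D \<and>
     (let d = nat (divdeg c D); R = coord_ring c in
      \<exists>s \<in> WD c (d + genus) D. \<exists>t \<in> WD c (d + genus + 1) D.
        ((s <#\<^bsub>R\<^esub> W c (2 * genus)) <+>\<^bsub>R\<^esub> (t <#\<^bsub>R\<^esub> W c (2 * genus - 1))) <+>\<^bsub>R\<^esub> W c (d + genus - 1)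
          = W c (d + 3 * genus))"

section \<open>The Jacobian\<close>

definition full_div :: "(nat \<Rightarrow> nat \<Rightarrow> 'k::field) \<Rightarrow> 'k poly poly set \<Rightarrow> 'k divisor" where
  "full_div c r = affine_div c r - frag_cmul (int (fdeg c r)) (frag_of None)"

text \<open>The function field is the fraction field of the coordinate ring.\<close>

definition principal_divisors :: "(nat \<Rightarrow> nat \<Rightarrow> 'k::field) \<Rightarrow> 'k divisor set" where
  "principal_divisors c = {full_div c r - full_div c r' | r r'.
     r \<in> carrier (coord_ring c) - {\<zero>\<^bsub>coord_ring c\<^esub>} \<and> r' \<in> carrier (coord_ring c) - {\<zero>\<^bsub>coord_ring c\<^esub>}}"

definition Div0 :: "(nat \<Rightarrow> nat \<Rightarrow> 'k::field) \<Rightarrow> 'k divisor monoid" where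
  "Div0 c = (free_Abelian_group (points c))
     \<lparr>carrier := {E \<in> carrier (free_Abelian_group (points c)). divdeg c E = 0}\<rparr>"

definition Pic0 :: "(nat \<Rightarrow> nat \<Rightarrow> 'k::field) \<Rightarrow> 'k divisor set monoid" where
  "Pic0 c = Div0 c Mod principal_divisors c"

text \<open>The class of \<open>D - 3 P_infinity\<close>.\<close>

definition jac_class :: "(nat \<Rightarrow> nat \<Rightarrow> 'k::field) \<Rightarrow> 'k divisor \<Rightarrow> 'k divisor set" where
  "jac_class c D = principal_divisors c #>\<^bsub>Div0 c\<^esub> (D - frag_cmul 3 (frag_of None))"

section \<open>The representation of typical divisors of degree 3\<close>

datatype 'k rep = Rep (ra: 'k) (rb: 'k) (rc: 'k) (rd: 'k) (re: 'k) (rf: 'k) (r_ainv: 'k)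

definition monic_F :: "(nat \<Rightarrow> nat \<Rightarrow> 'k::field) \<Rightarrow> 'k \<Rightarrow> 'k \<Rightarrow> 'k \<Rightarrow> 'k poly poly set" where
  "monic_F c a b e = cls c (XX ^ 2 + cst a * YY + cst b * XX + cst e)"

definition monic_G :: "(nat \<Rightarrow> nat \<Rightarrow> 'k::field) \<Rightarrow> 'k \<Rightarrow> 'k \<Rightarrow> 'k \<Rightarrow> 'k poly poly set" where
  "monic_G c a b e = cls c (XX * YY + cst a * YY + cst b * XX + cst e)"

definition F_of :: "(nat \<Rightarrow> nat \<Rightarrow> 'k::field) \<Rightarrow> 'k rep \<Rightarrow> 'k poly poly set" where
  "F_of c r = monic_F c (ra r) (rb r) (rc r)"

definition G_of :: "(nat \<Rightarrow> nat \<Rightarrow> 'k::field) \<Rightarrow> 'k rep \<Rightarrow> 'k poly poly set" where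
  "G_of c r = monic_G c (rd r) (re r) (rf r)"

definition yF_xG :: "(nat \<Rightarrow> nat \<Rightarrow> 'k::field) \<Rightarrow> 'k rep \<Rightarrow> 'k poly poly set" where
  "yF_xG c r = cls c YY \<otimes>\<^bsub>coord_ring c\<^esub> F_of c r \<ominus>\<^bsub>coord_ring c\<^esub> cls c XX \<otimes>\<^bsub>coord_ring c\<^esub> G_of c r"

definition H_of :: "(nat \<Rightarrow> nat \<Rightarrow> 'k::field) \<Rightarrow> 'k rep \<Rightarrow> 'k poly poly set" where
  "H_of c r = cls c (cst (r_ainv r)) \<otimes>\<^bsub>coord_ring c\<^esub> yF_xG c r"

definition represents :: "(nat \<Rightarrow> nat \<Rightarrow> 'k::field) \<Rightarrow> 'k rep \<Rightarrow> 'k divisor \<Rightarrow> bool" where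
  "represents c r D \<longleftrightarrow> F_of c r \<in> WD c 6 D \<and> G_of c r \<in> WD c 7 D \<and>
     ra r \<noteq> 0 \<and> r_ainv r = inverse (ra r)"

section \<open>Step 1\<close>

text \<open>Coordinates, with respect to the basis \<open>1, x, y\<close>, of the image of \<open>p\<close> in \<open>W^N / W^N_D\<close>. For
  typical \<open>D\<close> of degree 3 the space \<open>W^5 = span(1, x, y)\<close> is a complement of \<open>W^N_D\<close> for both
  \<open>N = 10\<close> and \<open>N = 11\<close>.\<close>

definition image_mod_D :: "(nat \<Rightarrow> nat \<Rightarrow> 'k::field) \<Rightarrow> nat \<Rightarrow> 'k divisor \<Rightarrow> 'k poly poly set \<Rightarrow> 'k vec" where
  "image_mod_D c N D p = (THE v. v \<in> carrier_vec 3 \<and>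
     p \<ominus>\<^bsub>coord_ring c\<^esub> cls c (cst (v $ 0) + cst (v $ 1) * XX + cst (v $ 2) * YY) \<in> WD c N D)"

definition add_basis :: "(nat \<Rightarrow> nat \<Rightarrow> 'k::field) \<Rightarrow> 'k rep \<Rightarrow> 'k poly poly set list" where
  "add_basis c r' = [F_of c r', G_of c r', H_of c r',
     cls c XX \<otimes>\<^bsub>coord_ring c\<^esub> F_of c r', cls c XX \<otimes>\<^bsub>coord_ring c\<^esub> G_of c r']"

definition add_matrix :: "(nat \<Rightarrow> nat \<Rightarrow> 'k::field) \<Rightarrow> 'k divisor \<Rightarrow> 'k rep \<Rightarrow> 'k mat" where
  "add_matrix c D r' = mat_of_cols 3 (map (image_mod_D c 10 D) (add_basis c r'))"

text \<open>The choice of \<open>G\<^sub>1\<close> and \<open>H\<^sub>1\<close>; here \<open>A = div F - D\<close>.\<close>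

definition dbl_aux :: "(nat \<Rightarrow> nat \<Rightarrow> 'k::field) \<Rightarrow> 'k divisor \<Rightarrow> 'k rep \<Rightarrow>
    'k poly poly set \<Rightarrow> 'k poly poly set \<Rightarrow> bool" where
  "dbl_aux c D r G1 H1 \<longleftrightarrow>
     G1 \<in> WD c 7 (affine_div c (F_of c r) - D) \<and>
     G1 \<noteq> \<zero>\<^bsub>coord_ring c\<^esub> \<and> fdeg c G1 = 7 \<and> H1 \<in> W c 8 \<and>
     G_of c r \<otimes>\<^bsub>coord_ring c\<^esub> G1 \<oplus>\<^bsub>coord_ring c\<^esub> F_of c r \<otimes>\<^bsub>coord_ring c\<^esub> H1 = \<zero>\<^bsub>coord_ring c\<^esub>"

definition dbl_basis :: "(nat \<Rightarrow> nat \<Rightarrow> 'k::field) \<Rightarrow> 'k rep \<Rightarrow> 'k poly poly set list" where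
  "dbl_basis c r = [F_of c r, G_of c r, yF_xG c r,
     cls c XX \<otimes>\<^bsub>coord_ring c\<^esub> F_of c r, cls c XX \<otimes>\<^bsub>coord_ring c\<^esub> G_of c r]"

definition dbl_matrix :: "(nat \<Rightarrow> nat \<Rightarrow> 'k::field) \<Rightarrow> 'k divisor \<Rightarrow>
    'k poly poly set \<Rightarrow> 'k poly poly set \<Rightarrow> 'k mat" where
  "dbl_matrix c D G1 H1 = (let R = coord_ring c; x = cls c XX; y = cls c YY in
     mat_of_cols 3 (map (image_mod_D c 11 D)
       [G1, \<ominus>\<^bsub>R\<^esub> H1, y \<otimes>\<^bsub>R\<^esub> G1 \<oplus>\<^bsub>R\<^esub> x \<otimes>\<^bsub>R\<^esub> H1, x \<otimes>\<^bsub>R\<^esub> G1, \<ominus>\<^bsub>R\<^esub> (x \<otimes>\<^bsub>R\<^esub> H1)]))"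

section \<open>Steps 2 to 4\<close>

text \<open>These are common to both algorithms; the parameters are the matrix \<open>M\<close> and the list \<open>B\<close> of five
  elements whose images are its columns.\<close>

definition U_det :: "'k::field mat \<Rightarrow> 'k" where
  "U_det M = det (mat_of_cols 3 (take 3 (cols M)))"

definition lin_comb :: "(nat \<Rightarrow> nat \<Rightarrow> 'k::field) \<Rightarrow> 'k vec \<Rightarrow> 'k poly poly set list \<Rightarrow> 'k poly poly set" where
  "lin_comb c v B = finsum (coord_ring c) (\<lambda>i. cls c (cst (v $ i)) \<otimes>\<^bsub>coord_ring c\<^esub> B ! i) {..<length B}"

text \<open>Without Inversion 1, that is if \<open>U = 0\<close>, this step returns nothing.\<close>

definition step2 :: "(nat \<Rightarrow> nat \<Rightarrow> 'k::field) \<Rightarrow> 'k mat \<Rightarrow> 'k poly poly set list \<Rightarrow>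
    'k poly poly set \<Rightarrow> 'k poly poly set \<Rightarrow> bool" where
  "step2 c M B s t \<longleftrightarrow> U_det M \<noteq> 0 \<and>
     (\<exists>v \<in> mat_kernel M. v $ 3 = 1 \<and> v $ 4 = 0 \<and> s = lin_comb c v B) \<and>
     (\<exists>v \<in> mat_kernel M. v $ 3 = 0 \<and> v $ 4 = 1 \<and> t = lin_comb c v B)"

text \<open>Coordinates of the image of \<open>p\<close> in \<open>V = W^17 / (s W^8 + W^8)\<close> with respect to the basis
  \<open>x^2 y, x y^2, x^2 y^2\<close>: the pole orders 10, 11, 14 of these are the ones up to 17 that occur
  neither in \<open>W^8\<close> nor in \<open>s W^8\<close>.\<close>

definition image_in_V :: "(nat \<Rightarrow> nat \<Rightarrow> 'k::field) \<Rightarrow> 'k poly poly set \<Rightarrow> 'k poly poly set \<Rightarrow> 'k vec" where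
  "image_in_V c s p = (let R = coord_ring c in THE v. v \<in> carrier_vec 3 \<and>
     p \<ominus>\<^bsub>R\<^esub> cls c (cst (v $ 0) * XX ^ 2 * YY + cst (v $ 1) * XX * YY ^ 2 + cst (v $ 2) * XX ^ 2 * YY ^ 2)
       \<in> (s <#\<^bsub>R\<^esub> W c 8) <+>\<^bsub>R\<^esub> W c 8)"

definition M2_matrix :: "(nat \<Rightarrow> nat \<Rightarrow> 'k::field) \<Rightarrow> 'k poly poly set \<Rightarrow> 'k poly poly set \<Rightarrow> 'k mat" where
  "M2_matrix c s t = mat_of_cols 3 (map (\<lambda>m. image_in_V c s (cls c m \<otimes>\<^bsub>coord_ring c\<^esub> t))
     [1, XX, YY, XX ^ 2, XX * YY])"

text \<open>In the above basis \<open>t\<close> and \<open>xt\<close>, \<open>yt\<close> have coordinates \<open>(1, 0, 0)\<close>, \<open>(*, beta2, 0)\<close> and \<open>(*, *, 1)\<close>,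
  so \<open>beta2\<close> is the determinant of the first three columns; \<open>gamma4\<close> is the last coordinate of \<open>x^2 t\<close>.\<close>

definition beta2 :: "'k::field mat \<Rightarrow> 'k" where "beta2 M = M $$ (1, 1)"
definition gamma4 :: "'k::field mat \<Rightarrow> 'k" where "gamma4 M = M $$ (2, 3)"

text \<open>The coordinates of a kernel vector of \<open>M''\<close> refer to \<open>1, x, y, x^2, xy\<close>. If the inversion of the
  product \<open>beta2 gamma4\<close> is impossible, nothing is returned. The last component is the inverse of
  \<open>a'' = - gamma4\<close>, computed without a further inversion.\<close>

definition step3 :: "'k::field mat \<Rightarrow> 'k rep \<Rightarrow> bool" where
  "step3 M r \<longleftrightarrow> beta2 M * gamma4 M \<noteq> 0 \<and>
     vec_of_list [rc r, rb r, ra r, 1, 0] \<in> mat_kernel M \<and>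
     vec_of_list [rf r, re r, rd r, 0, 1] \<in> mat_kernel M \<and>
     r_ainv r = - beta2 M * inverse (beta2 M * gamma4 M)"

definition step4 :: "(nat \<Rightarrow> nat \<Rightarrow> 'k::field) \<Rightarrow> 'k rep \<Rightarrow> 'k rep \<Rightarrow> bool" where
  "step4 c r out \<longleftrightarrow> (let R = coord_ring c in
     ra out = ra r \<and> rb out = rb r \<and> rc out = rc r \<and> r_ainv out = r_ainv r \<and>
     (\<exists>H \<in> W c 8. G_of c out \<otimes>\<^bsub>R\<^esub> G_of c r \<oplus>\<^bsub>R\<^esub> F_of c r \<otimes>\<^bsub>R\<^esub> H \<in> W c 5))"

definition steps_return :: "(nat \<Rightarrow> nat \<Rightarrow> 'k::field) \<Rightarrow> 'k mat \<Rightarrow> 'k poly poly set list \<Rightarrow> 'k rep \<Rightarrow> bool" where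
  "steps_return c M B out \<longleftrightarrow>
     (\<exists>s t r. step2 c M B s t \<and> step3 (M2_matrix c s t) r \<and> step4 c r out)"

definition inversions_possible :: "(nat \<Rightarrow> nat \<Rightarrow> 'k::field) \<Rightarrow> 'k mat \<Rightarrow> 'k poly poly set list \<Rightarrow> bool" where
  "inversions_possible c M B \<longleftrightarrow> U_det M \<noteq> 0 \<and>
     (\<exists>s t. step2 c M B s t \<and> beta2 (M2_matrix c s t) * gamma4 (M2_matrix c s t) \<noteq> 0)"

text \<open>There is an output, and every output represents a typical divisor of degree 3 with the right class.\<close>

definition typical_sum_returned :: "(nat \<Rightarrow> nat \<Rightarrow> 'k::field) \<Rightarrow> 'k divisor \<Rightarrow> 'k divisor \<Rightarrow>
    'k mat \<Rightarrow> 'k poly poly set list \<Rightarrow> bool" where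
  "typical_sum_returned c D D' M B \<longleftrightarrow> (\<exists>out. steps_return c M B out) \<and>
     (\<forall>out. steps_return c M B out \<longrightarrow>
       (\<exists>D'''. good c D''' \<and> divdeg c D''' = 3 \<and> represents c out D''' \<and>
          jac_class c D''' = jac_class c D \<otimes>\<^bsub>Pic0 c\<^esub> jac_class c D' \<and> typical c D'''))"

end

theory Submission
  imports Defs "HOL-Computational_Algebra.Formal_Laurent_Series"
begin

text \<open>The inversions are needed to return anything, so the content is that they suffice. The proof counts
  pole orders. A function is identified with its expansion at the point at infinity, a Laurent series in
  \<open>x/y\<close>; then \<open>deg\<close> is the order of the pole. The pole orders that occur are \<open>0, 3, 4, 6, 7, ...\<close>, the
  semigroup generated by 3 and 4, so that \<open>W^5\<close> and \<open>W^8\<close> have dimensions 3 and 6.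

  The smoothness of the curve provides a local uniformizer at every closed point (\<open>uniformizer_exists\<close>),
  hence orders of vanishing, and the ideal \<open>I_D\<close> of an effective divisor has codimension \<open>deg D\<close>
  (\<open>rel_dim_ID\<close>). Moreover \<open>z R\<close> has codimension \<open>deg z\<close> (\<open>rel_dim_principal\<close>), and so a function has
  as many zeros as poles (\<open>edeg_dv\<close>). The counting argument is \<open>edeg_bound\<close>: if \<open>I_D\<close> contains functions
  of every pole order above \<open>N\<close>, then \<open>W^N\<close> maps onto \<open>R/I_D\<close>, hence \<open>deg D \<le> dim W^N\<close>, and in
  the case of equality \<open>W^N\<close> is a complement of \<open>I_D\<close>. It is applied twice.

  First, \<open>F\<close> and \<open>G\<close> with \<open>a \<noteq> 0\<close> have pole orders 6 and 7, and \<open>y F - x G\<close> has order 8; multiples of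
  these have all orders above 5. So \<open>D\<close> is the full set of common zeros of \<open>F\<close> and \<open>G\<close>, and \<open>W^5\<close> is a
  complement of \<open>I_D\<close>; this gives the columns of \<open>M\<close> their meaning. If \<open>U \<noteq> 0\<close>, then modulo \<open>I_D\<close>
  the function 1 is a combination of the functions that give the first three columns. In the addition
  this makes \<open>D\<close> and \<open>D'\<close> disjoint, so that \<open>I_D\<close> and \<open>I_{D'}\<close> intersect in \<open>I_{D+D'}\<close>. In the doubling
  it shows that \<open>G\<^sub>1\<close>, which vanishes on \<open>A = div F - D\<close>, vanishes to no higher order at the points
  of \<open>D\<close>, so that the functions \<open>z\<close> in \<open>I_D\<close> for which \<open>z G\<^sub>1 / F\<close> again vanishes on \<open>D\<close> are those
  of \<open>I_{2D}\<close>. In both cases \<open>s\<close> and \<open>t\<close> vanish on the divisor \<open>D + D'\<close> of degree 6.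

  Second, \<open>s\<close> and \<open>t\<close> have pole orders 9 and 10, and if \<open>beta2 \<noteq> 0\<close> then a combination of them has
  order 11; multiples have all orders above 8. So \<open>W^8\<close> is a complement of \<open>I_{D+D'}\<close>. The kernel of
  \<open>M''\<close> consists of \<open>z\<close> with \<open>z t = s h + w\<close>, where \<open>w \<in> W^8\<close>. As \<open>w\<close> vanishes on \<open>D + D'\<close> it is 0, and
  \<open>z t = s h\<close> shows that \<open>z\<close> vanishes on the divisor \<open>E = div s - D - D'\<close> of degree \<open>9 - 6 = 3\<close>. Hence
  \<open>F''\<close> and \<open>G''\<close> lie in \<open>I_E\<close>, and \<open>a'' \<noteq> 0\<close> makes the first count apply to them:
  \<open>G''' G'' + F'' H''\<close> lies in the intersection of \<open>W^5\<close> and \<open>I_E\<close>, which is 0, and this relation makes \<open>G'''\<close> vanish on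
  \<open>D''' = div F'' - E\<close> (\<open>output_divisor\<close>). This divisor has degree \<open>6 - 3 = 3\<close>, is linearly equivalent to
  \<open>D + D'\<close> up to a multiple of the point at infinity, and is typical because \<open>F''\<close> and \<open>G'''\<close> with
  \<open>a'' \<noteq> 0\<close> lie in its ideal (\<open>typical_FG\<close>).\<close>

section \<open>The branch at infinity\<close>

lemma fps_X_power_dvd_iff:
  fixes f :: "'a::field fps"
  shows "fps_X ^ n dvd f \<longleftrightarrow> (\<forall>k<n. fps_nth f k = 0)"
proof (cases "f = 0")
  case False
  have "fps_X ^ n dvd f \<longleftrightarrow> n \<le> subdegree f"
    using False by (simp add: fps_dvd_iff)
  also have "\<dots> \<longleftrightarrow> (\<forall>k<n. fps_nth f k = 0)"
    using False by (meson leI nth_less_subdegree_zero nth_subdegree_nonzero order_less_le_trans)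
  finally show ?thesis .
qed simp

text \<open>For \<open>k \<ge> 2\<close> every term of \<open>(a^k - b^k) / (a - b)\<close> contains a factor \<open>a\<close> or \<open>b\<close>; hence the additional factor
  \<open>d\<close>. With \<open>d\<close> and \<open>e\<close> powers of a variable, this makes the map defined next contracting.\<close>

lemma power_diff_dvd:
  fixes a b d :: "'a::comm_ring_1"
  assumes "d dvd a" "d dvd b" "e dvd a - b" "2 \<le> k"
  shows "d * e dvd a ^ k - b ^ k"
proof -
  have "d dvd b ^ (k - Suc i) * a ^ i" for i
  proof (cases "i = 0")
    case True
    then have "b dvd b ^ (k - Suc i)" using assms(4) by (intro dvd_power) auto
    from dvd_mult2[OF dvd_trans[OF assms(2) this]] show ?thesis .
  next
    case False
    then have "a dvd a ^ i" by (intro dvd_power) auto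
    from dvd_mult[OF dvd_trans[OF assms(1) this]] show ?thesis .
  qed
  then have "d dvd (\<Sum>i<k. b ^ (k - Suc i) * a ^ i)" by (intro dvd_sum)
  then show ?thesis using mult_dvd_mono[OF assms(3)] unfolding power_diff_sumr2[of a k b]
    by (metis mult.commute)
qed

lemma monomials_of_curve:
  "{(i, j). 3 * i + 4 * j < (12::nat)} = {(0,0),(1,0),(2,0),(3,0),(0,1),(1,1),(2,1),(0,2),(1,2)}"
  (is "?A = ?B")
proof (rule subset_antisym)
  show "?A \<subseteq> ?B"
  proof
    fix p assume "p \<in> ?A"
    then have *: "3 * fst p + 4 * snd p < 12" by (simp add: case_prod_beta)
    then have "fst p = 0 \<or> fst p = 1 \<or> fst p = 2 \<or> fst p = 3" "snd p = 0 \<or> snd p = 1 \<or> snd p = 2"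
      by linarith+
    then show "p \<in> ?B" using * by (cases p) auto
  qed
qed simp

locale c34_equation =
  fixes c :: "nat \<Rightarrow> nat \<Rightarrow> 'k::field"
begin

text \<open>Divided by \<open>y^4\<close>, the curve equation becomes the fixed point equation of this map for \<open>w = 1/y\<close>, with
  \<open>u = x/y\<close> in the role of \<open>fps_X\<close>.\<close>

definition branch_step :: "'k fps \<Rightarrow> 'k fps" where
  "branch_step w = fps_X ^ 4 -
     (\<Sum>(i, j) \<in> {(i, j). 3 * i + 4 * j < 12}. fps_const (c i j) * fps_X ^ i * w ^ (4 - i - j))"

lemma branch_step_dvd: "fps_X dvd w \<Longrightarrow> fps_X dvd branch_step w"
proof -
  assume w: "fps_X dvd w"
  have "fps_X dvd fps_const (c i j) * fps_X ^ i * w ^ (4 - i - j)" if "3 * i + 4 * j < 12" for i j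
  proof -
    have "w dvd w ^ (4 - i - j)" using that by (intro dvd_power) auto
    from dvd_mult[OF dvd_trans[OF w this]] show ?thesis .
  qed
  then show ?thesis unfolding branch_step_def by (intro dvd_diff dvd_sum) (auto intro: dvd_power)
qed

text \<open>A monomial with \<open>i = 0\<close> contains \<open>w\<close> with exponent \<open>4 - j \<ge> 2\<close>; for \<open>i > 0\<close> the factor \<open>u^i\<close> gains an order.\<close>

lemma branch_step_contracts:
  assumes "fps_X dvd v" "fps_X dvd w" "fps_X ^ n dvd v - w"
  shows "fps_X ^ Suc n dvd branch_step v - branch_step w"
proof -
  have "fps_X ^ Suc n dvd fps_const (c i j) * fps_X ^ i * w ^ (4 - i - j) - fps_const (c i j) * fps_X ^ i * v ^ (4 - i - j)"
    if "3 * i + 4 * j < 12" for i j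
  proof -
    have *: "fps_const (c i j) * fps_X ^ i * w ^ (4 - i - j) - fps_const (c i j) * fps_X ^ i * v ^ (4 - i - j)
        = fps_const (c i j) * (- (fps_X ^ i * (v ^ (4 - i - j) - w ^ (4 - i - j))))"
      by (simp add: algebra_simps)
    have "fps_X ^ Suc n dvd fps_X ^ i * (v ^ (4 - i - j) - w ^ (4 - i - j))"
    proof (cases i)
      case 0
      then have "2 \<le> 4 - i - j" using that by auto
      from power_diff_dvd[OF assms(1,2,3) this] show ?thesis by (simp add: 0)
    next
      case (Suc i')
      have "fps_X ^ n dvd v ^ (4 - i - j) - w ^ (4 - i - j)"
        unfolding power_diff_sumr2[of v] using assms(3) by (rule dvd_mult2)
      moreover have "fps_X dvd fps_X ^ i" by (simp add: Suc)
      ultimately have "fps_X * fps_X ^ n dvd fps_X ^ i * (v ^ (4 - i - j) - w ^ (4 - i - j))"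
        by (rule mult_dvd_mono[rotated])
      then show ?thesis by simp
    qed
    then show ?thesis unfolding * by (intro dvd_mult) (simp only: dvd_minus_iff)
  qed
  then have "fps_X ^ Suc n dvd (\<Sum>(i, j) \<in> {(i, j). 3 * i + 4 * j < 12}.
      fps_const (c i j) * fps_X ^ i * w ^ (4 - i - j) - fps_const (c i j) * fps_X ^ i * v ^ (4 - i - j))"
    by (intro dvd_sum) auto
  also have "\<dots> = branch_step v - branch_step w"
    by (simp add: branch_step_def sum_subtractf case_prod_beta)
  finally show ?thesis .
qed

text \<open>Contraction gives the fixed point: the iterates of \<^const>\<open>branch_step\<close> stabilise coefficientwise.\<close>

lemma branch_exists: "\<exists>w. fps_X dvd w \<and> branch_step w = w"
proof -
  define it where "it n = (branch_step ^^ n) 0" for n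
  have itS: "it (Suc n) = branch_step (it n)" for n by (simp add: it_def)
  have X: "fps_X dvd it n" for n
    by (induction n) (auto simp: it_def branch_step_dvd)
  have step: "fps_X ^ n dvd it (Suc n) - it n" for n
  proof (induction n)
    case (Suc n)
    then show ?case unfolding itS[of "Suc n"] itS[of n] by (intro branch_step_contracts) (auto simp: X branch_step_dvd)
  qed simp
  have stable: "fps_nth (it m) k = fps_nth (it n) k" if "k < n" "n \<le> m" for k n m
    using that(2)
  proof (induction m rule: dec_induct)
    case (step m)
    have "fps_nth (it (Suc m) - it m) k = 0"
      using \<open>fps_X ^ m dvd it (Suc m) - it m\<close> that(1) step(1) unfolding fps_X_power_dvd_iff by auto
    then show ?case using step.IH by simp
  qed simp
  define w where "w = Abs_fps (\<lambda>n. fps_nth (it (Suc n)) n)"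
  have w: "fps_X ^ n dvd w - it n" for n
    unfolding fps_X_power_dvd_iff
  proof (intro allI impI)
    fix k assume "k < n"
    then have "fps_nth (it n) k = fps_nth (it (Suc k)) k" by (intro stable) auto
    then show "fps_nth (w - it n) k = 0" by (simp add: w_def)
  qed
  have "fps_X dvd w - it 1" using w[of 1] by simp
  from dvd_add[OF this X[of 1]] have Xw: "fps_X dvd w" by simp
  have "w - branch_step w = 0"
  proof (rule fps_ext)
    fix k
    have "fps_X ^ Suc k dvd branch_step w - branch_step (it k)"
      by (rule branch_step_contracts[OF Xw X w])
    from dvd_diff[OF w[of "Suc k"] this] show "fps_nth (w - branch_step w) k = fps_nth 0 k"
      unfolding fps_X_power_dvd_iff itS by auto
  qed
  then show ?thesis using Xw by auto
qed

text \<open>\<open>w = 1/y\<close> as a power series in the uniformizer \<open>u = x/y\<close>.\<close>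

definition branch :: "'k fps" where
  "branch = (SOME w. fps_X dvd w \<and> branch_step w = w)"

lemma branch: "fps_X dvd branch" "branch_step branch = branch"
  using someI_ex[OF branch_exists] by (auto simp: branch_def)

text \<open>In the fixed point equation every term except \<open>u^4\<close> is divisible by \<open>w\<close>, with a quotient that has no constant
  term. So \<open>w\<close> is \<open>u^4\<close> up to a unit, and \<open>y = 1/w\<close> and \<open>x = u y\<close> have poles of order 4 and 3.\<close>

lemma branch_unit:
  obtains e where "branch * e = fps_X ^ 4" "fps_nth e 0 = 1"
proof
  let ?M = "{(i, j). 3 * i + 4 * j < (12::nat)}"
  let ?e = "1 + (\<Sum>(i, j) \<in> ?M. fps_const (c i j) * fps_X ^ i * branch ^ (3 - i - j))"
  have "branch * ?e = branch + (\<Sum>(i, j) \<in> ?M. fps_const (c i j) * fps_X ^ i * branch ^ (4 - i - j))"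
  proof -
    have "branch * (fps_const (c i j) * fps_X ^ i * branch ^ (3 - i - j)) =
        fps_const (c i j) * fps_X ^ i * branch ^ (4 - i - j)" if "3 * i + 4 * j < 12" for i j
    proof -
      have "branch ^ (4 - i - j) = branch * branch ^ (3 - i - j)"
        using that by (subst power_Suc[symmetric], intro arg_cong[where f = "\<lambda>n. branch ^ n"]) auto
      then show ?thesis by (simp only: ac_simps)
    qed
    then show ?thesis by (auto simp: distrib_left sum_distrib_left intro!: sum.cong)
  qed
  also have "\<dots> = fps_X ^ 4"
    using branch(2)[unfolded branch_step_def diff_eq_eq] by (rule sym)
  finally show "branch * ?e = fps_X ^ 4" .
  have "fps_nth branch 0 = 0" using branch(1) fps_X_power_dvd_iff[of 1 branch] by auto
  then show "fps_nth ?e 0 = 1"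
    by (simp add: monomials_of_curve fps_mult_nth_0 fps_nth_power_0)
qed

lemma branch_nth: "\<forall>k<4. fps_nth branch k = 0" "fps_nth branch 4 = 1" "branch \<noteq> 0"
proof -
  obtain e where e: "branch * e = fps_X ^ 4" "fps_nth e 0 = 1" by (rule branch_unit)
  then have "branch * e * inverse e = fps_X ^ 4 * inverse e" by simp
  then have b: "branch = fps_X ^ 4 * inverse e"
    using e(2) inverse_mult_eq_1'[of e] by (simp add: mult.assoc)
  show "\<forall>k<4. fps_nth branch k = 0" unfolding b by (simp add: fps_X_power_mult_nth)
  show "fps_nth branch 4 = 1" unfolding b using e(2) by (simp add: fps_X_power_mult_nth)
  then show "branch \<noteq> 0" by auto
qed

definition Y :: "'k fls" where "Y = inverse (fps_to_fls branch)"
definition X :: "'k fls" where "X = fls_X * Y"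

lemma Y_nonzero: "Y \<noteq> 0" using branch_nth(3) by (simp add: Y_def)
lemma X_nonzero: "X \<noteq> 0" using Y_nonzero by (simp add: X_def)

lemma subdegree_branch: "subdegree branch = 4"
  using branch_nth by (intro subdegreeI) auto

lemma subdegree_Y: "fls_subdegree Y = -4"
  by (simp add: Y_def fls_subdegree_fls_to_fps subdegree_branch branch_nth(3))

lemma subdegree_X: "fls_subdegree X = -3"
  using Y_nonzero by (simp add: X_def subdegree_Y)

lemma curve_relation:
  "Y ^ 3 - X ^ 4 + (\<Sum>(i, j) \<in> {(i, j). 3 * i + 4 * j < 12}. fls_const (c i j) * X ^ i * Y ^ j) = 0"
proof -
  let ?w = "fps_to_fls branch"
  have w: "?w \<noteq> 0" using branch_nth(3) by simp
  have "fps_to_fls (branch_step branch) = ?w" using branch(2) by simp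
  then have 1: "fls_X ^ 4 - (\<Sum>(i, j) \<in> {(i, j). 3 * i + 4 * j < 12}. fls_const (c i j) * fls_X ^ i * ?w ^ (4 - i - j)) = ?w"
    unfolding branch_step_def
    by (simp add: monomials_of_curve fls_times_fps_to_fls fps_to_fls_power)
  have "fls_const (c i j) * X ^ i * Y ^ j * ?w ^ 4 = fls_const (c i j) * fls_X ^ i * ?w ^ (4 - i - j)"
    if "3 * i + 4 * j < 12" for i j
  proof -
    have "i + j + (4 - i - j) = 4" using that by auto
    then have *: "?w ^ 4 = ?w ^ i * ?w ^ j * ?w ^ (4 - i - j)" by (metis power_add)
    have 1: "inverse ?w ^ n * ?w ^ n = 1" for n
      using w by (simp add: power_mult_distrib[symmetric])
    have "fls_const (c i j) * X ^ i * Y ^ j * ?w ^ 4 = fls_const (c i j) * fls_X ^ i * ?w ^ (4 - i - j) *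
        ((inverse ?w ^ i * ?w ^ i) * (inverse ?w ^ j * ?w ^ j))"
      unfolding * X_def Y_def power_mult_distrib by (simp only: ac_simps)
    then show ?thesis unfolding 1 by (simp only: mult_1_right)
  qed
  then have 2: "(\<Sum>(i, j) \<in> {(i, j). 3 * i + 4 * j < 12}. fls_const (c i j) * X ^ i * Y ^ j) * ?w ^ 4
      = (\<Sum>(i, j) \<in> {(i, j). 3 * i + 4 * j < 12}. fls_const (c i j) * fls_X ^ i * ?w ^ (4 - i - j))"
    by (auto simp: sum_distrib_right intro!: sum.cong)
  have "inverse ?w * ?w = 1" using w by simp
  then have "Y ^ 3 * ?w ^ 3 = 1" "Y ^ 4 * ?w ^ 4 = 1"
    by (simp_all add: Y_def flip: power_mult_distrib)
  moreover have "Y ^ 3 * ?w ^ 4 = (Y ^ 3 * ?w ^ 3) * ?w" "X ^ 4 * ?w ^ 4 = fls_X ^ 4 * (Y ^ 4 * ?w ^ 4)"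
    by (simp_all add: X_def power_mult_distrib eval_nat_numeral ac_simps)
  ultimately have 3: "Y ^ 3 * ?w ^ 4 = ?w" "X ^ 4 * ?w ^ 4 = fls_X ^ 4" by simp_all
  have 4: "a - b = w \<Longrightarrow> w - a + b = 0" for a b w :: "'k fls" by auto
  have "(Y ^ 3 - X ^ 4 + (\<Sum>(i, j) \<in> {(i, j). 3 * i + 4 * j < 12}.
      fls_const (c i j) * X ^ i * Y ^ j)) * ?w ^ 4 = 0"
    unfolding distrib_right left_diff_distrib 2 3 by (rule 4[OF 1])
  then show ?thesis using w by simp
qed

end

section \<open>The coordinate ring inside the Laurent series\<close>

lemma comm_ring_hom_eval:
  assumes "comm_ring_hom h"
  shows "comm_ring_hom (\<lambda>p. poly (map_poly h p) y)"
proof -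
  interpret comm_ring_hom h by fact
  let ?e = "\<lambda>p. poly (map_poly h p) y"
  have add: "?e (p + q) = ?e p + ?e q" for p q
    by (induction p q rule: poly_induct2) (simp_all add: map_poly_pCons algebra_simps hom_add)
  have smult: "?e (smult a p) = h a * ?e p" for a p
    by (induction p) (simp_all add: map_poly_pCons algebra_simps hom_mult)
  have "?e (p * q) = ?e p * ?e q" for p q
    by (induction p) (simp_all add: map_poly_pCons add smult algebra_simps)
  then show ?thesis by unfold_locales (simp_all add: add)
qed

interpretation fls_const_hom: comm_ring_hom "fls_const :: 'k::field \<Rightarrow> 'k fls"
  by unfold_locales (simp_all add: fls_plus_const)

global_interpretation V: vector_space "\<lambda>k z. fls_const (k :: 'k::field) * z"
  defines kspan = V.span and kindependent = V.independent
  by unfold_locales (simp_all add: algebra_simps flip: fls_plus_const fls_const_mult_const)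

text \<open>The semigroup generated by 3 and 4. Each element is \<open>3 i + 4 j\<close> for a unique pair with \<open>j \<le> 2\<close>, and thus
  the pole order of a unique monomial in a basis of the coordinate ring.\<close>

definition pole_orders :: "int set" where
  "pole_orders = {n. 0 \<le> n \<and> n \<notin> {1, 2, 5}}"

definition has_degree_le :: "int \<Rightarrow> 'a::zero fls \<Rightarrow> bool" where
  "has_degree_le n z \<longleftrightarrow> (\<forall>k < - n. fls_nth z k = 0)"

lemma has_degree_le_subdegree: "z \<noteq> 0 \<Longrightarrow> has_degree_le n z \<longleftrightarrow> - n \<le> fls_subdegree z"
  unfolding has_degree_le_def
  by (metis fls_eq0_below_subdegree fls_subdegree_geI linorder_not_less nth_fls_subdegree_nonzero order_less_le_trans)

lemma has_degree_le_mult: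
  fixes a b :: "'a::field fls"
  assumes "has_degree_le m a" "has_degree_le n b"
  shows "has_degree_le (m + n) (a * b)"
    and "fls_nth (a * b) (- (m + n)) = fls_nth a (- m) * fls_nth b (- n)"
proof -
  show "has_degree_le (m + n) (a * b)"
  proof (cases "a = 0 \<or> b = 0")
    case True
    then show ?thesis by (auto simp: has_degree_le_def)
  next
    case False
    then show ?thesis using assms by (simp add: has_degree_le_subdegree)
  qed
  show "fls_nth (a * b) (- (m + n)) = fls_nth a (- m) * fls_nth b (- n)"
  proof (cases "a = 0 \<or> b = 0")
    case False
    then have le: "- m \<le> fls_subdegree a" "- n \<le> fls_subdegree b"
      using assms by (auto simp: has_degree_le_subdegree)
    show ?thesis
    proof (cases "- m = fls_subdegree a \<and> - n = fls_subdegree b")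
      case True
      then have "- (m + n) = fls_subdegree a + fls_subdegree b" by simp
      then show ?thesis using True by (simp only: fls_times_base)
    next
      case False
      then have "- m < fls_subdegree a \<or> - n < fls_subdegree b" using le by auto
      moreover from this have "- (m + n) < fls_subdegree a + fls_subdegree b" using le by auto
      ultimately show ?thesis by (auto simp: fls_times_nth_eq0)
    qed
  qed auto
qed

lemma has_degree_le_mono: "has_degree_le m z \<Longrightarrow> m \<le> n \<Longrightarrow> has_degree_le n z"
  by (auto simp: has_degree_le_def)

lemma has_degree_le_lincomb:
  fixes a b :: "'a::field fls"
  shows "has_degree_le n a \<Longrightarrow> has_degree_le n b \<Longrightarrow> has_degree_le n (a + b)"
    "has_degree_le n a \<Longrightarrow> has_degree_le n b \<Longrightarrow> has_degree_le n (a - b)"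
    "has_degree_le n a \<Longrightarrow> has_degree_le n (- a)"
    "has_degree_le n a \<Longrightarrow> has_degree_le n (fls_const k * a)"
    "has_degree_le n 0"
  by (auto simp: has_degree_le_def)

lemma has_degree_le_pred:
  "has_degree_le (n - 1) z \<longleftrightarrow> has_degree_le n z \<and> fls_nth z (- n) = 0"
  unfolding has_degree_le_def
  by (metis add_diff_cancel_left' diff_minus_eq_add less_add_one minus_diff_eq not_less_iff_gr_or_eq order_less_irrefl
      order_less_trans uminus_add_conv_diff zless_add1_eq)

context c34_equation
begin

definition ev_x :: "'k poly \<Rightarrow> 'k fls" where "ev_x a = poly (map_poly fls_const a) X"
definition ev :: "'k poly poly \<Rightarrow> 'k fls" where "ev p = poly (map_poly ev_x p) Y"

sublocale ev_x: comm_ring_hom ev_x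
  unfolding ev_x_def by (rule comm_ring_hom_eval) (rule fls_const_hom.comm_ring_hom_axioms)

sublocale ev: comm_ring_hom ev
  unfolding ev_def by (rule comm_ring_hom_eval) (rule ev_x.comm_ring_hom_axioms)

lemma ev_x_pCons: "ev_x (pCons k a) = fls_const k + X * ev_x a"
  by (simp add: ev_x_def map_poly_pCons)

lemma ev_pCons: "ev (pCons a p) = ev_x a + Y * ev p"
  by (simp add: ev_def map_poly_pCons)

lemma ev_const: "ev [:a:] = ev_x a" by (simp add: ev_pCons)
lemma ev_x_const: "ev_x [:k:] = fls_const k" by (simp add: ev_x_pCons)
lemma ev_cst: "ev (cst k) = fls_const k" by (simp add: ev_const ev_x_const)
lemma ev_XX: "ev XX = X" by (simp add: ev_const ev_x_pCons)
lemma ev_YY: "ev YY = Y" by (simp add: ev_pCons)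

lemma ev_curve_eq: "ev (curve_eq c) = 0"
proof -
  have "ev (curve_eq c) = Y ^ 3 - X ^ 4 +
      (\<Sum>(i, j) \<in> {(i, j). 3 * i + 4 * j < 12}. fls_const (c i j) * X ^ i * Y ^ j)"
    unfolding curve_eq_def
    by (simp only: ev.hom_add ev.hom_minus ev.hom_power ev.hom_sum ev_XX ev_YY case_prod_unfold ev.hom_mult ev_cst)
  then show ?thesis by (simp only: curve_relation)
qed

text \<open>The coordinate ring, realized by expansions at infinity.\<close>

definition S :: "'k fls set" where "S = range ev"

lemma S_closed [simp, intro]:
  "0 \<in> S" "1 \<in> S" "X \<in> S" "Y \<in> S" "fls_const k \<in> S"
  "a \<in> S \<Longrightarrow> b \<in> S \<Longrightarrow> a + b \<in> S" "a \<in> S \<Longrightarrow> b \<in> S \<Longrightarrow> a - b \<in> S"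
  "a \<in> S \<Longrightarrow> b \<in> S \<Longrightarrow> a * b \<in> S" "a \<in> S \<Longrightarrow> - a \<in> S"  "ev p \<in> S"
  using rangeI[of ev 0] rangeI[of ev 1] rangeI[of ev XX] rangeI[of ev YY] rangeI[of ev "cst k"]
  by (auto simp: S_def ev_XX ev_YY ev_cst simp flip: ev.hom_add ev.hom_minus ev.hom_mult ev.hom_uminus)

lemma S_power [simp, intro]: "a \<in> S \<Longrightarrow> a ^ n \<in> S"
  by (induction n) auto

lemma S_sum [intro]: "(\<And>i. i \<in> A \<Longrightarrow> f i \<in> S) \<Longrightarrow> sum f A \<in> S"
  by (induction A rule: infinite_finite_induct) auto

lemma S_span: "B \<subseteq> S \<Longrightarrow> kspan B \<subseteq> S"
  by (intro V.span_minimal) (auto simp: V.subspace_def)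

text \<open>The monomial \<open>x^i y^j\<close> with \<open>j \<le> 2\<close> and \<open>n = 3 i + 4 j\<close>; modulo 3 the last equation reads \<open>n = j\<close>.\<close>

definition mon :: "int \<Rightarrow> 'k fls" where
  "mon n = X ^ nat ((n - 4 * (n mod 3)) div 3) * Y ^ nat (n mod 3)"

lemma mon_eq: "j \<le> 2 \<Longrightarrow> mon (3 * int i + 4 * int j) = X ^ i * Y ^ j"
proof -
  assume "j \<le> 2"
  then have m: "(3 * int i + 4 * int j) mod 3 = int j" by presburger
  have "nat ((3 * int i + 4 * int j - 4 * ((3 * int i + 4 * int j) mod 3)) div 3) = i" unfolding m by simp
  then show ?thesis unfolding mon_def m by simp
qed

lemma pole_orders_rep:
  assumes "n \<in> pole_orders"
  obtains i j where "j \<le> 2" "n = 3 * int i + 4 * int j"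
proof -
  have "0 \<le> (n - 4 * (n mod 3)) div 3" "n = 3 * ((n - 4 * (n mod 3)) div 3) + 4 * (n mod 3)"
    using assms unfolding pole_orders_def by (simp, presburger)+
  then show ?thesis by (intro that[of "nat (n mod 3)" "nat ((n - 4 * (n mod 3)) div 3)"]) auto
qed

lemma pole_orders_rep': "j \<le> 2 \<Longrightarrow> 3 * int i + 4 * int j \<in> pole_orders"
  unfolding pole_orders_def by (simp, presburger)

lemma X_deg: "has_degree_le 3 X" "fls_nth X (-3) = 1"
  and Y_deg: "has_degree_le 4 Y" "fls_nth Y (-4) = 1"
proof -
  show X3: "has_degree_le 3 X" and Y4: "has_degree_le 4 Y"
    using X_nonzero Y_nonzero by (simp_all add: has_degree_le_subdegree subdegree_X subdegree_Y)
  let ?w = "fps_to_fls branch"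
  have w: "has_degree_le (-4) ?w" "fls_nth ?w 4 = 1"
    using branch_nth by (auto simp: has_degree_le_def)
  have "fls_nth (Y * ?w) 0 = fls_nth Y (-4) * fls_nth ?w 4"
    using has_degree_le_mult(2)[OF Y4 w(1)] by simp
  moreover have "Y * ?w = 1" using branch_nth by (simp add: Y_def)
  ultimately show "fls_nth Y (-4) = 1" using w by simp
  then show "fls_nth X (-3) = 1" by (simp add: X_def fls_X_times_conv_shift)
qed

lemma power_deg:
  assumes "has_degree_le m z" "fls_nth z (- m) = 1"
  shows "has_degree_le (int n * m) ((z :: 'k fls) ^ n) \<and> fls_nth (z ^ n) (- (int n * m)) = 1"
proof (induction n)
  case (Suc n)
  have *: "int (Suc n) * m = m + int n * m" by (simp add: algebra_simps)
  show ?case unfolding * power_Suc using has_degree_le_mult[OF assms(1), of "int n * m" "z ^ n"] Suc assms(2) by simp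
qed (auto simp: has_degree_le_def)

lemma XY_deg:
  "has_degree_le (3 * int i + 4 * int j) (X ^ i * Y ^ j)"
  "fls_nth (X ^ i * Y ^ j) (- (3 * int i + 4 * int j)) = 1"
  using has_degree_le_mult[OF conjunct1[OF power_deg[OF X_deg, of i]] conjunct1[OF power_deg[OF Y_deg, of j]]]
    power_deg[OF X_deg, of i] power_deg[OF Y_deg, of j]
  by (simp_all add: mult.commute)

lemma mon_deg:
  assumes "n \<in> pole_orders"
  shows "has_degree_le n (mon n)" "fls_nth (mon n) (- n) = 1" "mon n \<in> S"
proof -
  obtain i j where ij: "j \<le> 2" "n = 3 * int i + 4 * int j" using assms by (rule pole_orders_rep)
  show "has_degree_le n (mon n)" "fls_nth (mon n) (- n) = 1" "mon n \<in> S"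
    unfolding ij(2) mon_eq[OF ij(1)] by (rule XY_deg) (rule XY_deg, simp)
qed

definition mons :: "int \<Rightarrow> 'k fls set" where "mons N = mon ` {n \<in> pole_orders. n \<le> N}"

lemma kspan_mons_mono: "M \<le> N \<Longrightarrow> kspan (mons M) \<subseteq> kspan (mons N)"
  by (intro V.span_mono) (auto simp: mons_def)

lemma XY_in_mons: "j \<le> 2 \<Longrightarrow> 3 * int i + 4 * int j \<le> N \<Longrightarrow> X ^ i * Y ^ j \<in> kspan (mons N)"
  unfolding mons_def by (metis (mono_tags, lifting) V.span_base image_eqI mem_Collect_eq mon_eq pole_orders_rep')

lemma X_mons: "z \<in> kspan (mons N) \<Longrightarrow> X * z \<in> kspan (mons (N + 3))"
proof (induction rule: V.span_induct_alt)
  case base then show ?case by (simp add: V.span_zero)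
next
  case (step k z y)
  obtain n where n: "n \<in> pole_orders" "n \<le> N" "z = mon n" using step(1) by (auto simp: mons_def)
  obtain i j where ij: "j \<le> 2" "n = 3 * int i + 4 * int j" using n(1) by (rule pole_orders_rep)
  have "X * z = X ^ Suc i * Y ^ j" unfolding n(3) ij(2) mon_eq[OF ij(1)] by simp
  also have "\<dots> \<in> kspan (mons (N + 3))" using n ij by (intro XY_in_mons) auto
  finally have "fls_const k * (X * z) + X * y \<in> kspan (mons (N + 3))" using step(2) by (intro V.span_add V.span_scale)
  then show ?case by (simp add: algebra_simps)
qed

lemma curve_relation': "Y ^ 3 = X ^ 4 - (\<Sum>(i, j) \<in> {(i, j). 3 * i + 4 * j < 12}. fls_const (c i j) * (X ^ i * Y ^ j))"
  using curve_relation by (simp add: algebra_simps eq_diff_eq case_prod_beta)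

text \<open>The curve equation replaces \<open>y^3\<close> by \<open>x^4\<close> and terms of smaller pole order, so the monomials with \<open>j \<le> 2\<close>
  suffice.\<close>

lemma Y_mons: "z \<in> kspan (mons N) \<Longrightarrow> Y * z \<in> kspan (mons (N + 4))"
proof (induction rule: V.span_induct_alt)
  case base then show ?case by (simp add: V.span_zero)
next
  case (step k z y)
  obtain n where n: "n \<in> pole_orders" "n \<le> N" "z = mon n" using step(1) by (auto simp: mons_def)
  obtain i j where ij: "j \<le> 2" "n = 3 * int i + 4 * int j" using n(1) by (rule pole_orders_rep)
  have "Y * z = X ^ i * Y ^ Suc j" unfolding n(3) ij(2) mon_eq[OF ij(1)] by simp
  also have "\<dots> \<in> kspan (mons (N + 4))"
  proof (cases "j \<le> 1")
    case True
    then show ?thesis using n ij by (intro XY_in_mons) auto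
  next
    case False
    then have j: "j = 2" using ij(1) by simp
    have "X ^ i * Y ^ Suc j = X ^ i * Y ^ 3" by (simp add: j numeral_3_eq_3)
    also have "\<dots> = X ^ (i + 4) * Y ^ 0 - (\<Sum>(a, b) \<in> {(i, j). 3 * i + 4 * j < 12}. fls_const (c a b) * (X ^ (i + a) * Y ^ b))"
      unfolding curve_relation' by (simp add: algebra_simps sum_distrib_left case_prod_beta power_add)
    also have "\<dots> \<in> kspan (mons (N + 4))"
    proof (intro V.span_diff V.span_sum XY_in_mons, goal_cases)
      case (3 p)
      then show ?case using n ij j
        by (cases p) (auto intro!: V.span_scale XY_in_mons)
    qed (use n ij j in auto)
    finally show ?thesis .
  qed
  finally have "fls_const k * (Y * z) + Y * y \<in> kspan (mons (N + 4))" using step(2) by (intro V.span_add V.span_scale)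
  then show ?case by (simp add: algebra_simps)
qed

lemma ev_x_mons: "\<exists>N. ev_x a \<in> kspan (mons N)"
proof (induction a)
  case (pCons k a)
  then obtain N where N: "ev_x a \<in> kspan (mons N)" by auto
  have "fls_const k * (X ^ 0 * Y ^ 0) + X * ev_x a \<in> kspan (mons (max 0 (N + 3)))"
    using X_mons[OF N] kspan_mons_mono[of "N + 3" "max 0 (N + 3)"] XY_in_mons[of 0 0 "max 0 (N + 3)"]
    by (intro V.span_add V.span_scale) auto
  then show ?case by (auto simp: ev_x_pCons)
qed (auto intro: V.span_zero)

lemma S_mons: "z \<in> S \<Longrightarrow> \<exists>N. z \<in> kspan (mons N)"
proof -
  have "\<exists>N. ev p \<in> kspan (mons N)" for p
  proof (induction p)
    case (pCons a p)
    then obtain N where N: "ev p \<in> kspan (mons N)" by auto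
    obtain M where M: "ev_x a \<in> kspan (mons M)" using ev_x_mons by auto
    have "ev_x a + Y * ev p \<in> kspan (mons (max M (N + 4)))"
      using Y_mons[OF N] M kspan_mons_mono[of "N + 4" "max M (N + 4)"] kspan_mons_mono[of M "max M (N + 4)"]
      by (intro V.span_add) auto
    then show ?case by (auto simp: ev_pCons)
  qed (auto intro: V.span_zero)
  then show "z \<in> S \<Longrightarrow> \<exists>N. z \<in> kspan (mons N)" by (auto simp: S_def)
qed

text \<open>The basis monomials have distinct pole orders, so the leading terms of a combination cannot cancel.\<close>

lemma mons_subdegree:
  assumes "z \<in> kspan (mons (int N - 1))"
  shows "z = 0 \<or> - fls_subdegree z \<in> pole_orders \<and> - fls_subdegree z < int N"
  using assms
proof (induction N arbitrary: z)
  case 0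
  have "mons (-1) = {}" by (auto simp: mons_def pole_orders_def)
  then show ?case using 0 by (simp add: V.span_empty)
next
  case (Suc N)
  show ?case
  proof (cases "int N \<in> pole_orders")
    case False
    then have "{n \<in> pole_orders. n \<le> int (Suc N) - 1} = {n \<in> pole_orders. n \<le> int N - 1}"
      by (auto simp: order_le_less)
    then have "mons (int (Suc N) - 1) = mons (int N - 1)" by (simp add: mons_def)
    then show ?thesis using Suc.IH[of z] Suc.prems by auto
  next
    case True
    then have "{n \<in> pole_orders. n \<le> int (Suc N) - 1} = insert (int N) {n \<in> pole_orders. n \<le> int N - 1}"
      by (auto simp: order_le_less)
    then have "mons (int (Suc N) - 1) = insert (mon (int N)) (mons (int N - 1))" by (simp add: mons_def)
    then obtain k where k: "z - fls_const k * mon (int N) \<in> kspan (mons (int N - 1))"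
      using Suc.prems by (auto simp: V.span_insert)
    define z' where "z' = z - fls_const k * mon (int N)"
    have z': "z' = 0 \<or> - fls_subdegree z' \<in> pole_orders \<and> - fls_subdegree z' < int N"
      using Suc.IH[OF k] by (simp add: z'_def)
    show ?thesis
    proof (cases "k = 0")
      case True
      then show ?thesis using z' by (auto simp: z'_def)
    next
      case False
      have z: "z = z' + fls_const k * mon (int N)" by (simp add: z'_def)
      have "has_degree_le (int N - 1) z'"
        using z' by (cases "z' = 0") (auto simp: has_degree_le_subdegree has_degree_le_lincomb(5))
      then have "has_degree_le (int N) z'" "fls_nth z' (- int N) = 0" by (simp_all add: has_degree_le_pred)
      then have "has_degree_le (int N) z" "fls_nth z (- int N) = k"
        using mon_deg[OF \<open>int N \<in> pole_orders\<close>] unfolding z by (auto intro!: has_degree_le_lincomb)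
      then have "fls_subdegree z = - int N"
        using False by (intro fls_subdegree_eqI) (auto simp: has_degree_le_def)
      then show ?thesis using \<open>int N \<in> pole_orders\<close> by simp
    qed
  qed
qed

lemma S_subdegree:
  assumes "z \<in> S" "z \<noteq> 0"
  shows "- fls_subdegree z \<in> pole_orders"
proof -
  obtain N where "z \<in> kspan (mons N)" using S_mons[OF assms(1)] by auto
  then have "z \<in> kspan (mons (int (nat (N + 1)) - 1))" using kspan_mons_mono[of N "int (nat (N + 1)) - 1"] by auto
  from mons_subdegree[OF this] show ?thesis using assms(2) by auto
qed

text \<open>The space \<open>W^n\<close>. Integers \<open>n\<close> allow inductions to end at \<open>W^(-1) = 0\<close>.\<close>

definition Fil :: "int \<Rightarrow> 'k fls set" where "Fil n = {z \<in> S. has_degree_le n z}"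

lemma Fil_pred: "Fil (n - 1) = {z \<in> Fil n. fls_nth z (- n) = 0}"
  by (auto simp: Fil_def has_degree_le_pred)

lemma Fil_mono: "m \<le> n \<Longrightarrow> Fil m \<subseteq> Fil n"
  by (auto simp: Fil_def intro: has_degree_le_mono)

lemma Fil_lincomb [intro]:
  "0 \<in> Fil n" "a \<in> Fil n \<Longrightarrow> b \<in> Fil n \<Longrightarrow> a + b \<in> Fil n" "a \<in> Fil n \<Longrightarrow> b \<in> Fil n \<Longrightarrow> a - b \<in> Fil n"
  "a \<in> Fil n \<Longrightarrow> - a \<in> Fil n" "a \<in> Fil n \<Longrightarrow> fls_const k * a \<in> Fil n"
  by (auto simp: Fil_def intro: has_degree_le_lincomb)

lemma Fil_mult: "a \<in> Fil m \<Longrightarrow> b \<in> Fil n \<Longrightarrow> a * b \<in> Fil (m + n)"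
  by (auto simp: Fil_def intro: has_degree_le_mult)

lemma Fil_gap: "n \<notin> pole_orders \<Longrightarrow> Fil n = Fil (n - 1)"
proof -
  assume n: "n \<notin> pole_orders"
  have "fls_nth z (- n) = 0" if "z \<in> Fil n" for z
  proof (rule ccontr)
    assume "fls_nth z (- n) \<noteq> 0"
    then have "fls_subdegree z = - n" "z \<noteq> 0"
      using that by (auto simp: Fil_def has_degree_le_def intro!: fls_subdegree_eqI)
    then show False using S_subdegree[of z] that n by (auto simp: Fil_def)
  qed
  then show ?thesis by (auto simp: Fil_pred)
qed

lemma Fil_neg: "Fil (-1) = {0}"
proof -
  have "z = 0" if "z \<in> Fil (-1)" for z
  proof (rule ccontr)
    assume "z \<noteq> 0"
    then show False
      using that S_subdegree[of z] has_degree_le_subdegree[of z "-1"] by (auto simp: Fil_def pole_orders_def)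
  qed
  then show ?thesis by auto
qed

lemma S_Fil: "z \<in> S \<Longrightarrow> \<exists>n. z \<in> Fil (int n)"
proof -
  assume z: "z \<in> S"
  have "has_degree_le (int (nat (- fls_subdegree z))) z"
    by (cases "z = 0") (auto simp: has_degree_le_subdegree has_degree_le_lincomb(5))
  then show ?thesis using z unfolding Fil_def by blast
qed

text \<open>Elimination of leading terms, from the largest pole order downwards. Nothing needs to be eliminated at orders
  outside the semigroup, because \<open>W^n\<close> does not grow there.\<close>

lemma Fil_descend:
  assumes T: "V.subspace T"
    and lead: "\<And>i. m < i \<Longrightarrow> i \<le> m + int n \<Longrightarrow> i \<in> pole_orders \<Longrightarrow> \<exists>e \<in> T \<inter> Fil i. fls_nth e (- i) \<noteq> 0"
    and z: "z \<in> Fil (m + int n)"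
  shows "\<exists>t \<in> T. z - t \<in> Fil m"
  using lead z
proof (induction n arbitrary: z)
  case 0
  then show ?case using V.subspace_0[OF T] by (intro bexI[of _ 0]) auto
next
  case (Suc n)
  let ?i = "m + int (Suc n)"
  have "\<exists>t0 \<in> T. z - t0 \<in> Fil (?i - 1)"
  proof (cases "?i \<in> pole_orders")
    case False
    then show ?thesis using Suc.prems(2) Fil_gap[OF False] V.subspace_0[OF T] by (intro bexI[of _ 0]) auto
  next
    case True
    obtain e where e: "e \<in> T" "e \<in> Fil ?i" "fls_nth e (- ?i) \<noteq> 0" using Suc.prems(1)[OF _ _ True] by auto
    let ?k = "fls_nth z (- ?i) / fls_nth e (- ?i)"
    have "z - fls_const ?k * e \<in> Fil (?i - 1)"
      unfolding Fil_pred using e Suc.prems(2) by (simp add: Fil_lincomb)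
    then show ?thesis using V.subspace_scale[OF T e(1), of ?k] by auto
  qed
  then obtain t0 where t0: "t0 \<in> T" "z - t0 \<in> Fil (m + int n)" by auto
  obtain t1 where t1: "t1 \<in> T" "z - t0 - t1 \<in> Fil m" using Suc.IH[OF Suc.prems(1) t0(2)] by auto
  then show ?case using t0(1) V.subspace_add[OF T t0(1) t1(1)] by (intro bexI[of _ "t0 + t1"]) (auto simp: algebra_simps)
qed

end

lemma fls_subdegree_add_distinct:
  fixes f g :: "'a::field fls"
  assumes "f \<noteq> 0" "g \<noteq> 0" "fls_subdegree f \<noteq> fls_subdegree g"
  shows "f + g \<noteq> 0" "fls_subdegree (f + g) \<in> {fls_subdegree f, fls_subdegree g}"
proof -
  have "fls_subdegree (f + g) \<in> {fls_subdegree f, fls_subdegree g} \<and> f + g \<noteq> 0"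
  proof (cases "fls_subdegree f < fls_subdegree g")
    case True
    then have "fls_nth (f + g) (fls_subdegree f) \<noteq> 0" using assms by simp
    from fls_nonzeroI[OF this] show ?thesis using fls_subdegree_add_eq1[OF assms(1) True] by auto
  next
    case False
    then have l: "fls_subdegree g < fls_subdegree f" using assms by simp
    then have "fls_nth (f + g) (fls_subdegree g) \<noteq> 0" using assms by simp
    from fls_nonzeroI[OF this] show ?thesis using fls_subdegree_add_eq2[OF assms(2) l] by auto
  qed
  then show "f + g \<noteq> 0" "fls_subdegree (f + g) \<in> {fls_subdegree f, fls_subdegree g}" by auto
qed

definition total_degree_le :: "nat \<Rightarrow> 'k::field poly poly \<Rightarrow> bool" where
  "total_degree_le N p \<longleftrightarrow> (\<forall>i j. coeff (coeff p j) i \<noteq> 0 \<longrightarrow> i + j \<le> N)"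

lemma total_degree_le_add:
  "total_degree_le N p \<Longrightarrow> total_degree_le N q \<Longrightarrow> total_degree_le N (p + q)"
  unfolding total_degree_le_def by (metis add.right_neutral coeff_add)

lemma total_degree_le_mult:
  assumes "total_degree_le N p" "total_degree_le M q"
  shows "total_degree_le (N + M) (p * q)"
  unfolding total_degree_le_def
proof (intro allI impI)
  fix i j assume "coeff (coeff (p * q) j) i \<noteq> 0"
  then have "(\<Sum>l\<le>j. \<Sum>k\<le>i. coeff (coeff p l) k * coeff (coeff q (j - l)) (i - k)) \<noteq> 0"
    by (simp add: coeff_mult coeff_sum)
  then obtain l where l: "l \<le> j" "(\<Sum>k\<le>i. coeff (coeff p l) k * coeff (coeff q (j - l)) (i - k)) \<noteq> 0"
    by (meson atMost_iff sum.not_neutral_contains_not_neutral)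
  then obtain k where k: "k \<le> i" "coeff (coeff p l) k * coeff (coeff q (j - l)) (i - k) \<noteq> 0"
    by (meson atMost_iff sum.not_neutral_contains_not_neutral)
  then have "k + l \<le> N" "(i - k) + (j - l) \<le> M"
    using assms unfolding total_degree_le_def by (metis mult_zero_left, metis mult_zero_right)
  then show "i + j \<le> N + M" using l(1) k(1) by simp
qed

lemma total_degree_le_mono: "total_degree_le N p \<Longrightarrow> N \<le> M \<Longrightarrow> total_degree_le M p"
  by (meson order_trans total_degree_le_def)

lemma total_degree_le_base:
  "total_degree_le 0 (cst k)" "total_degree_le 1 (XX :: 'k::field poly poly)" "total_degree_le 1 (YY :: 'k::field poly poly)"
  "total_degree_le 0 (1 :: 'k::field poly poly)" "total_degree_le 0 (0 :: 'k::field poly poly)"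
  by (auto simp: total_degree_le_def coeff_pCons one_pCons split: nat.splits)

lemma total_degree_le_power: "total_degree_le N p \<Longrightarrow> total_degree_le (n * N) (p ^ n)"
proof (induction n)
  case (Suc n)
  show ?case using total_degree_le_mult[OF Suc.prems Suc.IH[OF Suc.prems]] by simp
qed (simp add: total_degree_le_base)

lemma total_degree_le_sum:
  "(\<And>x. x \<in> A \<Longrightarrow> total_degree_le N (f x)) \<Longrightarrow> total_degree_le N (sum f A)"
proof (induction A rule: infinite_finite_induct)
qed (auto intro: total_degree_le_add total_degree_le_mono[OF total_degree_le_base(5)])

lemma unit_at_infinity_iff:
  "unit_at_infinity N A \<longleftrightarrow> total_degree_le N A \<and> coeff (coeff A N) 0 \<noteq> 0"
  by (simp add: unit_at_infinity_def total_degree_le_def)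

context c34_equation
begin

lemma ev_x_subdegree:
  "a \<noteq> 0 \<Longrightarrow> ev_x a \<noteq> 0 \<and> fls_subdegree (ev_x a) = - 3 * int (degree a)"
proof (induction a)
  case (pCons k a)
  show ?case
  proof (cases "a = 0")
    case True
    then show ?thesis using pCons by (simp add: ev_x_const)
  next
    case False
    then have "ev_x a \<noteq> 0" "fls_subdegree (ev_x a) = - 3 * int (degree a)" using pCons by auto
    then have X: "X * ev_x a \<noteq> 0" "fls_subdegree (X * ev_x a) = - 3 * int (degree (pCons k a))"
      using X_nonzero False by (auto simp: subdegree_X)
    then have lt: "fls_subdegree (X * ev_x a) < fls_subdegree (fls_const k)" using False by simp
    have sd: "fls_subdegree (ev_x (pCons k a)) = fls_subdegree (X * ev_x a)"
      using fls_subdegree_add_eq1[OF X(1) lt] by (simp add: ev_x_pCons add.commute)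
    then have "ev_x (pCons k a) \<noteq> 0" using lt by auto
    then show ?thesis using sd X(2) by simp
  qed
qed simp

lemma ev_x_degree_le: "degree a \<le> N \<Longrightarrow> has_degree_le (3 * int N) (ev_x a)"
  using ev_x_subdegree[of a] by (cases "a = 0") (auto simp: has_degree_le_subdegree has_degree_le_lincomb(5))

text \<open>The pole orders of \<open>a0(x)\<close>, \<open>a1(x) y\<close> and \<open>a2(x) y^2\<close> are distinct modulo 3, so nonzero summands cannot cancel.\<close>

lemma ev_y_quadratic:
  assumes "ev [:a0, a1, a2:] = 0"
  shows "a0 = 0 \<and> a1 = 0 \<and> a2 = 0"
proof -
  define t where "t = (\<lambda>j a. Y ^ j * ev_x a)"
  have t: "t j a \<noteq> 0 \<and> fls_subdegree (t j a) = - 3 * int (degree a) - 4 * int j" if "a \<noteq> 0" for j a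
    using ev_x_subdegree[OF that] Y_nonzero by (simp add: t_def subdegree_Y fls_subdegree_pow)
  have t0: "t j 0 = 0" for j by (simp add: t_def)
  have sum: "t 0 a0 + t 1 a1 + t 2 a2 = 0"
    using assms by (simp add: ev_pCons t_def power2_eq_square algebra_simps)
  have two: "t i a + t j b \<noteq> 0 \<and> (\<exists>n. fls_subdegree (t i a + t j b) = - 3 * int n - 4 * int i \<or>
      fls_subdegree (t i a + t j b) = - 3 * int n - 4 * int j)"
    if "a \<noteq> 0 \<or> b \<noteq> 0" "i < j" "j \<le> 2" for a b i j
  proof (cases "a \<noteq> 0 \<and> b \<noteq> 0")
    case True
    have "fls_subdegree (t i a) \<noteq> fls_subdegree (t j b)"
      using t[of a i] t[of b j] True that by (simp, presburger)
    then show ?thesis using fls_subdegree_add_distinct[of "t i a" "t j b"] t[of a i] t[of b j] True by auto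
  next
    case False
    then show ?thesis using that t[of a i] t[of b j] t0 by auto
  qed
  show ?thesis
  proof (cases "a1 = 0 \<and> a2 = 0")
    case True
    then show ?thesis using sum t0 t[of a0 0] by auto
  next
    case False
    then have *: "t 1 a1 + t 2 a2 \<noteq> 0" "\<exists>n. fls_subdegree (t 1 a1 + t 2 a2) = - 3 * int n - 4 \<or>
      fls_subdegree (t 1 a1 + t 2 a2) = - 3 * int n - 8" using two[of a1 a2 1 2] by auto
    have eq: "t 1 a1 + t 2 a2 = - t 0 a0" using sum by (simp add: eq_neg_iff_add_eq_0 algebra_simps)
    then have "a0 \<noteq> 0" using *(1) t0 by auto
    then have "\<exists>n. - 3 * int (degree a0) = - 3 * int n - 4 \<or> - 3 * int (degree a0) = - 3 * int n - 8"
      using *(2) t[of a0 0] unfolding eq by simp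
    then show ?thesis by presburger
  qed
qed

lemma curve_eq_pCons:
  "curve_eq c = [:[:c 0 0, c 1 0, c 2 0, c 3 0, -1:], [:c 0 1, c 1 1, c 2 1:], [:c 0 2, c 1 2:], 1:]"
  unfolding curve_eq_def monomials_of_curve by (simp add: power_numeral_reduce)

text \<open>The curve equation is monic of degree 3 in \<open>y\<close>, and division by it leaves a remainder of degree at most 2. So
  the expansion at infinity embeds the coordinate ring into the Laurent series.\<close>

lemma ev_eq_0_iff: "ev p = 0 \<longleftrightarrow> curve_eq c dvd p"
proof
  assume p: "ev p = 0"
  let ?f = "curve_eq c"
  have f: "degree ?f = 3" "coeff ?f 3 = 1" "?f \<noteq> 0" by (simp_all add: curve_eq_pCons eval_nat_numeral)
  obtain q r where qr: "pseudo_divmod p ?f = (q, r)" by fastforce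
  from pseudo_divmod[OF f(3) qr] have d: "p = ?f * q + r" "r = 0 \<or> degree r < 3"
    using f by simp_all
  have "ev r = 0" using p d(1) by (simp add: ev.hom_add ev.hom_mult ev_curve_eq)
  moreover have "r = [:coeff r 0, coeff r 1, coeff r 2:]"
  proof (rule poly_eqI)
    fix n
    have "coeff r n = 0" if "3 \<le> n" using d(2) that by (auto intro: coeff_eq_0)
    then show "coeff r n = coeff [:coeff r 0, coeff r 1, coeff r 2:] n"
      by (auto simp: coeff_pCons numeral_eq_Suc split: nat.splits)
  qed
  ultimately have "r = 0" using ev_y_quadratic[of "coeff r 0" "coeff r 1" "coeff r 2"] by simp
  then show "?f dvd p" using d by simp
qed (auto simp: ev.hom_mult ev_curve_eq)

subsection \<open>The isomorphism\<close>

lemma cring_KXY: "cring (KXY :: 'k poly poly ring)"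
proof (rule cringI)
  show "abelian_group (KXY :: 'k poly poly ring)"
    by (rule abelian_groupI) (auto simp: KXY_def algebra_simps intro: exI[of _ "- _"])
  show "comm_monoid (KXY :: 'k poly poly ring)"
    by (rule comm_monoidI) (auto simp: KXY_def algebra_simps)
qed (auto simp: KXY_def algebra_simps)

abbreviation R where "R \<equiv> coord_ring c"

lemma ideal_curve: "ideal (PIdl\<^bsub>KXY\<^esub> (curve_eq c)) KXY"
  by (intro cring.cgenideal_ideal cring_KXY) (simp add: KXY_def)

lemma PIdl_curve: "PIdl\<^bsub>KXY\<^esub> (curve_eq c) = {p. curve_eq c dvd p}"
  by (auto simp: cgenideal_def KXY_def dvd_def mult.commute)

lemma cring_R: "cring R"
  unfolding coord_ring_def by (rule ideal.quotient_is_cring[OF ideal_curve cring_KXY])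

lemma cls_hom: "cls c \<in> Ring.ring_hom KXY R"
  unfolding coord_ring_def cls_def[abs_def] by (rule ideal.rcos_ring_hom[OF ideal_curve])

lemma KXY_minus: "p \<ominus>\<^bsub>KXY\<^esub> q = (p :: 'k poly poly) - q"
proof -
  interpret cring "KXY :: 'k poly poly ring" by (rule cring_KXY)
  have "\<ominus>\<^bsub>KXY\<^esub> q = - q" by (rule minus_equality) (auto simp: KXY_def)
  then show ?thesis by (simp add: a_minus_def KXY_def)
qed

lemma cls_eq_iff: "cls c p = cls c q \<longleftrightarrow> ev p = ev q"
proof -
  interpret cring "KXY :: 'k poly poly ring" by (rule cring_KXY)
  have "cls c p = cls c q \<longleftrightarrow> p - q \<in> PIdl\<^bsub>KXY\<^esub> (curve_eq c)"
    unfolding cls_def KXY_minus[symmetric] by (rule quotient_eq_iff_same_a_r_cos[OF ideal_curve, symmetric]) (auto simp: KXY_def)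
  also have "\<dots> \<longleftrightarrow> ev p = ev q" by (simp add: PIdl_curve ev.hom_minus flip: ev_eq_0_iff)
  finally show ?thesis .
qed

text \<open>The element of the coordinate ring with a given expansion at infinity.\<close>

definition el :: "'k fls \<Rightarrow> 'k poly poly set" where
  "el z = cls c (SOME p. ev p = z)"

lemma el_ev: "el (ev p) = cls c p"
  unfolding el_def cls_eq_iff by (rule someI) simp

lemma carrier_R: "carrier R = el ` S"
proof -
  have "carrier R = range (cls c)"
    by (auto simp: coord_ring_def FactRing_def A_RCOSETS_def RCOSETS_def cls_def a_r_coset_def KXY_def)
  also have "\<dots> = el ` S" by (simp add: S_def image_image el_ev)
  finally show ?thesis .
qed

lemma el_carrier [simp, intro]: "z \<in> S \<Longrightarrow> el z \<in> carrier R"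
  by (auto simp: carrier_R)

lemma el_eq_iff [simp]: "a \<in> S \<Longrightarrow> b \<in> S \<Longrightarrow> el a = el b \<longleftrightarrow> a = b"
  by (auto simp: S_def el_ev cls_eq_iff)

lemma el_mult: "a \<in> S \<Longrightarrow> b \<in> S \<Longrightarrow> el a \<otimes>\<^bsub>R\<^esub> el b = el (a * b)"
  using ring_hom_mult[OF cls_hom] by (auto simp: S_def el_ev KXY_def simp flip: ev.hom_mult)

lemma el_add: "a \<in> S \<Longrightarrow> b \<in> S \<Longrightarrow> el a \<oplus>\<^bsub>R\<^esub> el b = el (a + b)"
  using ring_hom_add[OF cls_hom] by (auto simp: S_def el_ev KXY_def simp flip: ev.hom_add)

lemma el_one: "\<one>\<^bsub>R\<^esub> = el 1"
  using ring_hom_one[OF cls_hom] el_ev[of 1] by (simp add: KXY_def)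

lemma el_zero: "\<zero>\<^bsub>R\<^esub> = el 0"
proof -
  interpret cring R by (rule cring_R)
  have "el 0 \<oplus>\<^bsub>R\<^esub> el 0 = el 0" by (simp add: el_add)
  then show ?thesis by (metis S_closed(1) add.l_cancel_one el_carrier)
qed

lemma el_uminus: "a \<in> S \<Longrightarrow> \<ominus>\<^bsub>R\<^esub> el a = el (- a)"
proof -
  interpret cring R by (rule cring_R)
  show "a \<in> S \<Longrightarrow> \<ominus>\<^bsub>R\<^esub> el a = el (- a)"
    by (rule minus_equality) (auto simp: el_add el_zero)
qed

lemma el_minus: "a \<in> S \<Longrightarrow> b \<in> S \<Longrightarrow> el a \<ominus>\<^bsub>R\<^esub> el b = el (a - b)"
  by (simp add: a_minus_def el_uminus el_add)

lemma cls_el: "cls c p = el (ev p)" by (simp add: el_ev)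

subsection \<open>Pole orders\<close>

text \<open>Among the monomials of total degree at most \<open>N\<close> only \<open>y^N\<close> has a pole of order \<open>4 N\<close>.\<close>

lemma total_degree_le_ev:
  "total_degree_le N p \<Longrightarrow> has_degree_le (4 * int N) (ev p) \<and> fls_nth (ev p) (- (4 * int N)) = coeff (coeff p N) 0"
proof (induction p arbitrary: N)
  case 0
  then show ?case by (simp add: has_degree_le_lincomb(5))
next
  case (pCons a p)
  have a: "degree a \<le> N"
    using pCons.prems unfolding total_degree_le_def by (intro degree_le) (metis add.right_neutral coeff_pCons_0 not_le)
  show ?case
  proof (cases N)
    case 0
    have "coeff p j = 0" for j
      using pCons.prems unfolding total_degree_le_def 0
      by (intro poly_eqI) (metis add_is_0 coeff_0 coeff_pCons_Suc le_zero_eq nat.distinct(1))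
    then have p: "p = 0" by (auto simp: poly_eq_iff)
    obtain k where "a = [:k:]" using a 0 degree_eq_zeroE by blast
    then show ?thesis using 0 p by (simp add: ev_const ev_x_const has_degree_le_def)
  next
    case (Suc M)
    have "total_degree_le M p"
      using pCons.prems unfolding total_degree_le_def Suc by (metis add_Suc_right coeff_pCons_Suc Suc_le_mono)
    from pCons.IH[OF this] have IH: "has_degree_le (4 * int M) (ev p)" "fls_nth (ev p) (- (4 * int M)) = coeff (coeff p M) 0"
      by auto
    have e: "4 * int N = 4 + 4 * int M" using Suc by simp
    have "has_degree_le (4 * int N) (Y * ev p)" "fls_nth (Y * ev p) (- (4 * int N)) = coeff (coeff p M) 0"
      unfolding e using has_degree_le_mult[OF Y_deg(1) IH(1)] IH(2) Y_deg(2) by simp_all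
    moreover have "has_degree_le (4 * int N - 1) (ev_x a)"
      using Suc by (intro has_degree_le_mono[OF ev_x_degree_le[OF a]]) simp
    then have "has_degree_le (4 * int N) (ev_x a)" "fls_nth (ev_x a) (- (4 * int N)) = 0" by (simp_all add: has_degree_le_pred)
    ultimately show ?thesis unfolding ev_pCons by (simp add: has_degree_le_lincomb Suc)
  qed
qed

lemma unit_at_infinity_ev:
  assumes "unit_at_infinity N A"
  shows "ev A \<noteq> 0" "fls_subdegree (ev A) = - 4 * int N"
proof -
  have "has_degree_le (4 * int N) (ev A)" "fls_nth (ev A) (- (4 * int N)) \<noteq> 0"
    using assms total_degree_le_ev[of N A] by (simp_all add: unit_at_infinity_iff)
  then show "ev A \<noteq> 0" "fls_subdegree (ev A) = - 4 * int N"
    by (auto simp: has_degree_le_def intro!: fls_subdegree_eqI)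
qed

lemma Fil_eq_kspan: "Fil n = kspan (mons n)"
proof
  show "kspan (mons n) \<subseteq> Fil n"
    by (rule V.span_minimal) (auto simp: mons_def V.subspace_def Fil_def mon_deg
        intro: has_degree_le_lincomb has_degree_le_mono[OF mon_deg(1)])
  show "Fil n \<subseteq> kspan (mons n)"
  proof
    fix z assume z: "z \<in> Fil n"
    show "z \<in> kspan (mons n)"
    proof (cases "n < 0")
      case True
      then have "z \<in> Fil (-1)" using z Fil_mono[of n "-1"] by auto
      then show ?thesis by (simp add: Fil_neg V.span_zero)
    next
      case False
      have "\<exists>t\<in>kspan (mons n). z - t \<in> Fil (- 1)"
      proof (rule Fil_descend[where n = "nat (n + 1)"])
        fix i assume i: "i \<le> - 1 + int (nat (n + 1))" "i \<in> pole_orders"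
        then have "i \<le> n" using False by simp
        with i(2) have "mon i \<in> kspan (mons n)" "mon i \<in> Fil i" "fls_nth (mon i) (- i) \<noteq> 0"
          using mon_deg[of i] by (auto simp: mons_def Fil_def intro!: V.span_base)
        then show "\<exists>e\<in>kspan (mons n) \<inter> Fil i. fls_nth e (- i) \<noteq> 0" by auto
      qed (use z False in auto)
      then show ?thesis by (auto simp: Fil_neg)
    qed
  qed
qed

text \<open>In the local ring at infinity \<open>x^4 / y^3\<close> is the unit \<open>E / y^3\<close>, where \<open>E\<close> has total degree 3. This turns each
  \<open>x^i y^j\<close> into a fraction with the denominator \<open>x^n y^N / y^n\<close>.\<close>

lemma pole_fraction:
  assumes "z \<in> Fil (int n)"
  shows "\<exists>N B. total_degree_le N B \<and> X ^ n * Y ^ N * z = Y ^ n * ev B"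
proof -
  define E where "E = XX ^ 4 + curve_eq c"
  have E: "ev E = X ^ 4" by (simp add: E_def ev.hom_add ev.hom_power ev_XX ev_curve_eq)
  have "E = YY ^ 3 + (\<Sum>(i, j) \<in> {(i, j). 3 * i + 4 * j < 12}. cst (c i j) * XX ^ i * YY ^ j)"
    by (simp add: E_def curve_eq_def)
  moreover have "total_degree_le 3 (cst (c i j) * XX ^ i * YY ^ j)" if "3 * i + 4 * j < 12" for i j
  proof -
    have "total_degree_le (0 + i * 1 + j * 1) (cst (c i j) * XX ^ i * YY ^ j)"
      by (intro total_degree_le_mult total_degree_le_power total_degree_le_base)
    then show ?thesis using that by (elim total_degree_le_mono) simp
  qed
  moreover have "total_degree_le 3 (YY ^ 3 :: 'k poly poly)"
    using total_degree_le_power[OF total_degree_le_base(3), of 3] by simp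
  ultimately have tE: "total_degree_le 3 E" by (auto intro!: total_degree_le_add total_degree_le_sum)
  show ?thesis using assms unfolding Fil_eq_kspan
  proof (induction rule: V.span_induct_alt)
    case base
    show ?case using total_degree_le_base(5) by (intro exI[of _ 0]) auto
  next
    case (step k m z)
    obtain d where d: "d \<in> pole_orders" "d \<le> int n" "m = mon d" using step(1) by (auto simp: mons_def)
    obtain i j where ij: "j \<le> 2" "d = 3 * int i + 4 * int j" using d(1) by (rule pole_orders_rep)
    define l where "l = n - (3 * i + 4 * j)"
    have n: "n = 3 * i + 4 * j + l" using d ij by (simp add: l_def)
    let ?N = "3 * (i + j) + l" and ?B = "E ^ (i + j) * XX ^ l"
    have B: "total_degree_le ?N ?B" "X ^ n * Y ^ ?N * m = Y ^ n * ev ?B"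
    proof -
      have "total_degree_le ((i + j) * 3 + l * 1) ?B"
        by (intro total_degree_le_mult total_degree_le_power tE total_degree_le_base)
      then show "total_degree_le ?N ?B" by (simp add: mult.commute)
      have m: "m = X ^ i * Y ^ j" using d(3) ij mon_eq by simp
      have "X ^ n * Y ^ ?N * m = X ^ (n + i) * Y ^ (?N + j)" unfolding m power_add by (simp only: ac_simps)
      also have "n + i = 4 * (i + j) + l" using n by simp
      also have "?N + j = n" using n by simp
      also have "X ^ (4 * (i + j) + l) = (X ^ 4) ^ (i + j) * X ^ l"
        by (simp only: power_add[of X "4 * (i + j)"] power_mult)
      finally show "X ^ n * Y ^ ?N * m = Y ^ n * ev ?B"
        by (simp only: ev.hom_mult ev.hom_power E ev_XX mult.commute)
    qed
    obtain M C where C: "total_degree_le M C" "X ^ n * Y ^ M * z = Y ^ n * ev C" using step(2) by auto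
    have "total_degree_le (?N + M) (cst k * (YY ^ M * ?B) + YY ^ ?N * C)"
    proof (rule total_degree_le_add)
      have "total_degree_le (0 + (M * 1 + ?N)) (cst k * (YY ^ M * ?B))"
        by (intro total_degree_le_mult[OF _ B(1)] total_degree_le_mult[OF _ total_degree_le_mult] total_degree_le_power total_degree_le_base B(1))
      then show "total_degree_le (?N + M) (cst k * (YY ^ M * ?B))" by (simp add: add.commute)
      have "total_degree_le (?N * 1 + M) (YY ^ ?N * C)"
        by (intro total_degree_le_mult[OF _ C(1)] total_degree_le_power total_degree_le_base)
      then show "total_degree_le (?N + M) (YY ^ ?N * C)" by simp
    qed
    moreover have "X ^ n * Y ^ (?N + M) * (fls_const k * m + z) = Y ^ n * ev (cst k * (YY ^ M * ?B) + YY ^ ?N * C)"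
    proof -
      have "X ^ n * Y ^ (?N + M) * (fls_const k * m + z) =
          fls_const k * Y ^ M * (X ^ n * Y ^ ?N * m) + Y ^ ?N * (X ^ n * Y ^ M * z)"
        unfolding power_add by (simp add: algebra_simps)
      also have "\<dots> = Y ^ n * ev (cst k * (YY ^ M * ?B) + YY ^ ?N * C)"
        unfolding B(2) C(2) by (simp only: ev.hom_add ev.hom_mult ev.hom_power ev_cst ev_YY distrib_left ac_simps)
      finally show ?thesis .
    qed
    ultimately show ?case by blast
  qed
qed

text \<open>Numerator and denominator of a unit at infinity have the same pole order \<open>4 N\<close>, so that an element of pole
  order \<open>n\<close> in the sense of fractions has the order of \<open>(y/x)^n\<close>.\<close>

lemma has_pole_order_el:
  assumes "z \<in> S" "z \<noteq> 0"
  shows "has_pole_order c (el z) n \<longleftrightarrow> fls_subdegree z = - int n"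
proof -
  have *: "cls c (XX ^ n * A) \<otimes>\<^bsub>R\<^esub> el z = cls c (YY ^ n * B) \<longleftrightarrow> X ^ n * ev A * z = Y ^ n * ev B" for A B
    using assms by (simp add: cls_el el_mult ev.hom_mult ev.hom_power ev_XX ev_YY del: mult_cancel_right mult_cancel_left)
  show ?thesis
  proof
    assume "has_pole_order c (el z) n"
    then obtain N A B where u: "unit_at_infinity N A" "unit_at_infinity N B" and e: "X ^ n * ev A * z = Y ^ n * ev B"
      unfolding has_pole_order_def * by auto
    have "fls_subdegree (X ^ n * ev A * z) = - 3 * int n - 4 * int N + fls_subdegree z"
      using assms X_nonzero unit_at_infinity_ev[OF u(1)] by (simp add: subdegree_X fls_subdegree_pow)
    moreover have "fls_subdegree (Y ^ n * ev B) = - 4 * int n - 4 * int N"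
      using Y_nonzero unit_at_infinity_ev[OF u(2)] by (simp add: subdegree_Y fls_subdegree_pow)
    ultimately show "fls_subdegree z = - int n" using e by simp
  next
    assume d: "fls_subdegree z = - int n"
    then have z: "z \<in> Fil (int n)" using assms by (simp add: Fil_def has_degree_le_subdegree)
    then obtain N B where B: "total_degree_le N B" "X ^ n * Y ^ N * z = Y ^ n * ev B" using pole_fraction by blast
    have "coeff (coeff B N) 0 \<noteq> 0"
    proof
      assume 0: "coeff (coeff B N) 0 = 0"
      have nz: "ev B \<noteq> 0" using B(2) assms X_nonzero Y_nonzero by auto
      have "fls_subdegree (X ^ n * Y ^ N * z) = - 4 * int n - 4 * int N"
        using assms X_nonzero Y_nonzero d by (simp add: subdegree_X subdegree_Y fls_subdegree_pow)
      moreover have "fls_subdegree (Y ^ n * ev B) = - 4 * int n + fls_subdegree (ev B)"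
        using Y_nonzero nz by (simp add: subdegree_Y fls_subdegree_pow)
      ultimately have "fls_subdegree (ev B) = - (4 * int N)" using B(2) by simp
      then have "fls_nth (ev B) (- (4 * int N)) \<noteq> 0" using nz nth_fls_subdegree_nonzero by metis
      then show False using total_degree_le_ev[OF B(1)] 0 by simp
    qed
    then have "unit_at_infinity N B" using B by (simp add: unit_at_infinity_iff)
    moreover have "unit_at_infinity N (YY ^ N :: 'k poly poly)"
    proof -
      have "(YY :: 'k poly poly) ^ N = monom 1 N" by (simp add: monom_altdef)
      then have 1: "coeff ((YY :: 'k poly poly) ^ N) N = 1" by (simp only: coeff_monom refl if_True)
      show ?thesis using total_degree_le_power[OF total_degree_le_base(3), of N]
        unfolding unit_at_infinity_iff 1 by simp
    qed
    ultimately show "has_pole_order c (el z) n"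
      unfolding has_pole_order_def * using B(2)
      by (intro exI[of _ N] exI[of _ "YY ^ N"] exI[of _ B]) (simp add: ev.hom_power ev_YY)
  qed
qed

lemma fdeg_el: "z \<in> S \<Longrightarrow> z \<noteq> 0 \<Longrightarrow> int (fdeg c (el z)) = - fls_subdegree z"
proof -
  assume z: "z \<in> S" "z \<noteq> 0"
  then have "0 \<le> - fls_subdegree z" using S_subdegree by (auto simp: pole_orders_def)
  then obtain n where n: "- fls_subdegree z = int n" using nonneg_int_cases by blast
  then have "fdeg c (el z) = n" unfolding fdeg_def has_pole_order_el[OF z] by (intro the_equality) auto
  then show ?thesis using n by simp
qed

lemma W_eq: "W c N = el ` Fil (int N)"
proof -
  have "el z \<in> W c N \<longleftrightarrow> z \<in> Fil (int N)" if "z \<in> S" for z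
    using that fdeg_el[OF that]
    by (cases "z = 0") (auto simp: W_def el_zero Fil_def has_degree_le_subdegree has_degree_le_lincomb(5))
  moreover have "W c N \<subseteq> el ` S" by (auto simp: W_def carrier_R)
  ultimately show ?thesis by (auto simp: Fil_def)
qed

end

section \<open>Relative dimension\<close>

text \<open>The spaces here have infinite dimension, so the dimension of a quotient \<open>I / J\<close> is expressed by a
  family in \<open>I\<close> that is a basis modulo \<open>J\<close>.\<close>

definition indep_mod :: "'k::field fls set \<Rightarrow> 'k fls set \<Rightarrow> bool" where
  "indep_mod J B \<longleftrightarrow> (\<forall>a. (\<Sum>b\<in>B. fls_const (a b) * b) \<in> J \<longrightarrow> (\<forall>b\<in>B. a b = 0))"

definition spans_mod :: "'k::field fls set \<Rightarrow> 'k fls set \<Rightarrow> 'k fls set \<Rightarrow> bool" where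
  "spans_mod J B I \<longleftrightarrow> (\<forall>z\<in>I. \<exists>t\<in>kspan B. z - t \<in> J)"

definition rel_dim :: "'k::field fls set \<Rightarrow> 'k fls set \<Rightarrow> nat \<Rightarrow> bool" where
  "rel_dim I J n \<longleftrightarrow> (\<exists>B. finite B \<and> card B = n \<and> B \<subseteq> I \<and> indep_mod J B \<and> spans_mod J B I)"

text \<open>Replacing each member of \<open>C\<close> by a congruent element of the span of \<open>B\<close> reduces this to vector spaces.\<close>

lemma indep_mod_card_le:
  assumes J: "V.subspace J" and C: "finite C" "indep_mod J C" and B: "finite B" "spans_mod J B C"
  shows "card C \<le> card B"
proof -
  have "\<forall>z\<in>C. \<exists>t. t \<in> kspan B \<and> z - t \<in> J" using B(2) by (auto simp: spans_mod_def)
  then obtain t where t: "\<And>z. z \<in> C \<Longrightarrow> t z \<in> kspan B \<and> z - t z \<in> J" by metis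
  have key: "\<forall>b\<in>C. a b = 0" if "(\<Sum>b\<in>C. fls_const (a b) * t b) = 0" for a
  proof -
    have "(\<Sum>b\<in>C. fls_const (a b) * b) = (\<Sum>b\<in>C. fls_const (a b) * (b - t b))"
      using that by (simp add: right_diff_distrib sum_subtractf)
    also have "\<dots> \<in> J" using t by (intro V.subspace_sum[OF J] V.subspace_scale[OF J]) auto
    finally show ?thesis using C(2) by (simp add: indep_mod_def)
  qed
  have inj: "inj_on t C"
  proof (rule inj_onI, rule ccontr)
    fix x y assume xy: "x \<in> C" "y \<in> C" "t x = t y" "x \<noteq> y"
    define a :: "'a fls \<Rightarrow> 'a" where "a = (\<lambda>z. 0)(x := 1, y := -1)"
    have a: "a x = 1" "a y = -1" "\<And>z. z \<notin> {x, y} \<Longrightarrow> a z = 0" using xy(4) by (auto simp: a_def)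
    have "(\<Sum>b\<in>C. fls_const (a b) * t b) = (\<Sum>b\<in>{x, y}. fls_const (a b) * t b)"
      using xy(1,2) C(1) a(3) by (intro sum.mono_neutral_right) auto
    also have "\<dots> = fls_const (a x) * t x + fls_const (a y) * t y" using xy(4) by simp
    also have "\<dots> = 0" unfolding a xy(3) by simp
    finally have "\<forall>b\<in>C. a b = 0" by (rule key)
    then show False using xy(1) a(1) by auto
  qed
  have "V.independent (t ` C)"
  proof (rule V.independent_if_scalars_zero)
    fix f x assume f: "(\<Sum>x\<in>t ` C. fls_const (f x) * x) = 0" and x: "x \<in> t ` C"
    have "(\<Sum>b\<in>C. fls_const (f (t b)) * t b) = 0"
      using f unfolding sum.reindex[OF inj] comp_def .
    then have "\<forall>b\<in>C. f (t b) = 0" by (rule key)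
    then show "f x = 0" using x by blast
  qed (use C in auto)
  from V.independent_span_bound[OF B(1) this] show ?thesis
    using t by (auto simp: card_image[OF inj])
qed

lemma not_indep_mod_shrink:
  assumes J: "V.subspace J" and B: "finite B" "\<not> indep_mod J B"
  obtains b where "b \<in> B" "\<And>I. spans_mod J B I \<Longrightarrow> spans_mod J (B - {b}) I"
proof -
  obtain a b where a: "(\<Sum>b\<in>B. fls_const (a b) * b) \<in> J" "b \<in> B" "a b \<noteq> 0"
    using B(2) by (auto simp: indep_mod_def)
  define u where "u = fls_const (inverse (a b)) * (\<Sum>b\<in>B - {b}. fls_const (a b) * b)"
  have u: "u \<in> kspan (B - {b})" unfolding u_def by (intro V.span_scale V.span_sum V.span_base) auto
  have "fls_const (inverse (a b)) * (\<Sum>b\<in>B. fls_const (a b) * b) = b + u"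
    using a B(1) by (simp add: u_def sum.remove distrib_left flip: mult.assoc)
  then have bu: "b + u \<in> J" using V.subspace_scale[OF J a(1)] by metis
  show ?thesis
  proof (rule that[OF a(2)], unfold spans_mod_def, rule ballI)
    fix I z assume "\<forall>z\<in>I. \<exists>t\<in>kspan B. z - t \<in> J" "z \<in> I"
    then obtain t where t: "t \<in> kspan B" "z - t \<in> J" by auto
    have "B = insert b (B - {b})" using a by auto
    then obtain k where k: "t - fls_const k * b \<in> kspan (B - {b})"
      using t(1) by (metis V.span_breakdown_eq)
    have "t - fls_const k * b - fls_const k * u \<in> kspan (B - {b})"
      by (intro V.span_diff k V.span_scale u)
    moreover have "z - (t - fls_const k * b - fls_const k * u) = (z - t) + fls_const k * (b + u)"
      by (simp add: algebra_simps)
    ultimately show "\<exists>t\<in>kspan (B - {b}). z - t \<in> J"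
      using V.subspace_add[OF J t(2) V.subspace_scale[OF J bu]] by metis
  qed
qed

lemma spans_mod_imp_rel_dim:
  assumes J: "V.subspace J" and B: "finite B" "B \<subseteq> I" "spans_mod J B I"
  shows "\<exists>n \<le> card B. rel_dim I J n \<and> (n = card B \<longrightarrow> indep_mod J B)"
  using B
proof (induction "card B" arbitrary: B)
  case 0
  then have "B = {}" by simp
  then show ?case using 0 by (auto simp: rel_dim_def indep_mod_def)
next
  case (Suc n)
  show ?case
  proof (cases "indep_mod J B")
    case True
    then show ?thesis using Suc.prems by (auto simp: rel_dim_def)
  next
    case False
    obtain b where b: "b \<in> B" "\<And>I. spans_mod J B I \<Longrightarrow> spans_mod J (B - {b}) I"
      using not_indep_mod_shrink[OF J Suc.prems(1) False] by blast
    have "n = card (B - {b})" using Suc.hyps(2) b(1) Suc.prems(1) by simp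
    from Suc.hyps(1)[OF this] Suc.prems b(2) obtain m where "m \<le> card (B - {b})" "rel_dim I J m" by blast
    then show ?thesis using Suc.prems(1) b(1) \<open>n = card (B - {b})\<close> Suc.hyps(2) by (intro exI[of _ m]) auto
  qed
qed

lemma rel_dim_unique:
  assumes "V.subspace J" "rel_dim I J m" "rel_dim I J n"
  shows "m = n"
proof -
  have "m \<le> n" if mn: "rel_dim I J m" "rel_dim I J n" for m n
  proof -
    obtain B where B: "finite B" "card B = m" "B \<subseteq> I" "indep_mod J B" using mn(1) by (auto simp: rel_dim_def)
    obtain B' where B': "finite B'" "card B' = n" "spans_mod J B' I" using mn(2) by (auto simp: rel_dim_def)
    have "spans_mod J B' B" using B' B by (auto simp: spans_mod_def)
    from indep_mod_card_le[OF assms(1) B(1,4) B'(1) this] show ?thesis using B B' by simp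
  qed
  then show ?thesis using assms by (meson le_antisym)
qed

lemma rel_dim_le_spans:
  assumes J: "V.subspace J" and n: "rel_dim I J n" and B: "finite B" "spans_mod J B I"
  shows "n \<le> card B"
proof -
  obtain C where C: "finite C" "card C = n" "C \<subseteq> I" "indep_mod J C" using n by (auto simp: rel_dim_def)
  have "spans_mod J B C" using B C by (auto simp: spans_mod_def)
  from indep_mod_card_le[OF J C(1,4) B(1) this] show ?thesis using C by simp
qed

text \<open>A dependent family could be shortened, against the uniqueness of the dimension.\<close>

lemma rel_dim_spans_indep:
  assumes J: "V.subspace J" and n: "rel_dim I J n" and B: "finite B" "B \<subseteq> I" "spans_mod J B I" "card B \<le> n"
  shows "indep_mod J B"
proof -
  obtain m where m: "m \<le> card B" "rel_dim I J m" "m = card B \<longrightarrow> indep_mod J B"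
    using spans_mod_imp_rel_dim[OF J B(1,2,3)] by auto
  then have "m = n" using rel_dim_unique[OF J m(2) n] by simp
  then show ?thesis using m B(4) by simp
qed

text \<open>A basis of \<open>I/J\<close> and one of \<open>J/L\<close> together form a basis of \<open>I/L\<close>.\<close>

lemma rel_dim_trans:
  assumes L: "V.subspace L" and J: "V.subspace J" and sub: "L \<subseteq> J" "J \<subseteq> I"
    and m: "rel_dim I J m" and n: "rel_dim J L n"
  shows "rel_dim I L (m + n)"
proof -
  obtain B where B: "finite B" "card B = m" "B \<subseteq> I" "indep_mod J B" "spans_mod J B I"
    using m by (auto simp: rel_dim_def)
  obtain C where C: "finite C" "card C = n" "C \<subseteq> J" "indep_mod L C" "spans_mod L C J"
    using n by (auto simp: rel_dim_def)
  have "b \<notin> J" if "b \<in> B" for b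
  proof
    assume "b \<in> J"
    define a :: "'a fls \<Rightarrow> 'a" where "a = (\<lambda>z. 0)(b := 1)"
    have "(\<Sum>z\<in>B. fls_const (a z) * z) = (\<Sum>z\<in>{b}. z)"
      using that B(1) by (intro sum.mono_neutral_cong_right) (auto simp: a_def)
    then have "(\<Sum>z\<in>B. fls_const (a z) * z) \<in> J" using \<open>b \<in> J\<close> by simp
    then have "\<forall>z\<in>B. a z = 0" using B(4) unfolding indep_mod_def by blast
    then show False using that by (auto simp: a_def)
  qed
  then have disj: "B \<inter> C = {}" using C(3) by auto
  have "indep_mod L (B \<union> C)"
    unfolding indep_mod_def
  proof (intro allI impI)
    fix a assume a: "(\<Sum>b\<in>B \<union> C. fls_const (a b) * b) \<in> L"
    have s: "(\<Sum>b\<in>B \<union> C. fls_const (a b) * b) = (\<Sum>b\<in>B. fls_const (a b) * b) + (\<Sum>b\<in>C. fls_const (a b) * b)"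
      by (rule sum.union_disjoint[OF B(1) C(1) disj])
    have "(\<Sum>b\<in>C. fls_const (a b) * b) \<in> J"
      using C(3) by (intro V.subspace_sum[OF J] V.subspace_scale[OF J]) auto
    moreover have "(\<Sum>b\<in>B. fls_const (a b) * b) + (\<Sum>b\<in>C. fls_const (a b) * b) \<in> J"
      using a sub(1) unfolding s by (rule rev_subsetD)
    ultimately have "(\<Sum>b\<in>B. fls_const (a b) * b) + (\<Sum>b\<in>C. fls_const (a b) * b)
        - (\<Sum>b\<in>C. fls_const (a b) * b) \<in> J"
      by (intro V.subspace_diff[OF J])
    then have z: "\<forall>b\<in>B. a b = 0" using B(4) unfolding indep_mod_def add_diff_cancel_right' by blast
    then have "(\<Sum>b\<in>B. fls_const (a b) * b) = 0" by simp
    then have "(\<Sum>b\<in>C. fls_const (a b) * b) \<in> L" using a unfolding s by simp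
    then show "\<forall>b\<in>B \<union> C. a b = 0" using z C(4) by (auto simp: indep_mod_def)
  qed
  moreover have "spans_mod L (B \<union> C) I"
    unfolding spans_mod_def
  proof
    fix z assume "z \<in> I"
    then obtain t where t: "t \<in> kspan B" "z - t \<in> J" using B(5) by (auto simp: spans_mod_def)
    then obtain t' where t': "t' \<in> kspan C" "z - t - t' \<in> L" using C(5) by (auto simp: spans_mod_def)
    have "t + t' \<in> kspan (B \<union> C)"
      using t t' V.span_mono[of B "B \<union> C"] V.span_mono[of C "B \<union> C"] by (intro V.span_add) auto
    then show "\<exists>t\<in>kspan (B \<union> C). z - t \<in> L" using t'(2) by (metis diff_diff_eq)
  qed
  ultimately show ?thesis unfolding rel_dim_def
    using B C sub by (intro exI[of _ "B \<union> C"]) (auto simp: card_Un_disjoint[OF B(1) C(1) disj])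
qed

text \<open>Multiplication by \<open>w\<close> induces an isomorphism from \<open>I/J\<close> to \<open>I'/J'\<close>.\<close>

lemma rel_dim_mult:
  assumes J: "V.subspace J" and n: "rel_dim I J n"
    and into: "\<And>z. z \<in> I \<Longrightarrow> w * z \<in> I'" and ker: "\<And>z. z \<in> I \<Longrightarrow> w * z \<in> J' \<longleftrightarrow> z \<in> J"
    and J': "V.subspace J'" and I: "V.subspace I"
    and onto: "\<And>z. z \<in> I' \<Longrightarrow> \<exists>y\<in>I. z - w * y \<in> J'"
  shows "rel_dim I' J' n"
proof (cases "w = 0")
  case True
  then have "\<forall>z\<in>I. z \<in> J" using ker V.subspace_0[OF J'] by auto
  then have "spans_mod J {} I" using V.span_zero by (auto simp: spans_mod_def)
  then have "n = 0" using rel_dim_le_spans[OF J n, of "{}"] by simp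
  moreover have "spans_mod J' {} I'" using onto True V.span_zero by (force simp: spans_mod_def)
  ultimately show ?thesis unfolding rel_dim_def by (intro exI[of _ "{}"]) (auto simp: indep_mod_def)
next
  case False
  obtain B where B: "finite B" "card B = n" "B \<subseteq> I" "indep_mod J B" "spans_mod J B I"
    using n by (auto simp: rel_dim_def)
  have inj: "inj_on ((*) w) B" using False by (auto simp: inj_on_def)
  have img: "w * t \<in> kspan ((*) w ` B)" if "t \<in> kspan B" for t
    using that
  proof (induction rule: V.span_induct_alt)
    case (step k x y)
    have "fls_const k * (w * x) + w * y \<in> kspan ((*) w ` B)"
      using step(1) by (intro V.span_add[OF V.span_scale[OF V.span_base] step(2)]) auto
    then show ?case by (simp add: algebra_simps)
  qed (simp add: V.span_zero)
  have "indep_mod J' ((*) w ` B)"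
    unfolding indep_mod_def
  proof (intro allI impI)
    fix a assume "(\<Sum>b\<in>(*) w ` B. fls_const (a b) * b) \<in> J'"
    moreover have "(\<Sum>b\<in>(*) w ` B. fls_const (a b) * b) = w * (\<Sum>b\<in>B. fls_const (a (w * b)) * b)"
      unfolding sum.reindex[OF inj] comp_def sum_distrib_left by (simp only: ac_simps)
    moreover have "(\<Sum>b\<in>B. fls_const (a (w * b)) * b) \<in> I"
      using B(3) by (intro V.subspace_sum[OF I] V.subspace_scale[OF I]) auto
    ultimately have "(\<Sum>b\<in>B. fls_const (a (w * b)) * b) \<in> J" using ker by simp
    then show "\<forall>b\<in>(*) w ` B. a b = 0" using B(4) by (auto simp: indep_mod_def)
  qed
  moreover have "spans_mod J' ((*) w ` B) I'"
    unfolding spans_mod_def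
  proof
    fix z assume "z \<in> I'"
    then obtain y where y: "y \<in> I" "z - w * y \<in> J'" using onto by auto
    then obtain t where t: "t \<in> kspan B" "y - t \<in> J" using B(5) by (auto simp: spans_mod_def)
    have "kspan B \<subseteq> I" by (rule V.span_minimal[OF B(3) I])
    then have "y - t \<in> I" using y t V.subspace_diff[OF I] by auto
    then have "w * (y - t) \<in> J'" using ker t by simp
    from V.subspace_add[OF J' y(2) this] show "\<exists>t\<in>kspan ((*) w ` B). z - t \<in> J'"
      using img[OF t(1)] by (intro bexI[of _ "w * t"]) (auto simp: algebra_simps)
  qed
  ultimately show ?thesis unfolding rel_dim_def
    using B into by (intro exI[of _ "(*) w ` B"]) (auto simp: card_image[OF inj])
qed

context c34_equation
begin

definition S_ideal :: "'k fls set \<Rightarrow> bool" where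
  "S_ideal J \<longleftrightarrow> J \<subseteq> S \<and> 0 \<in> J \<and> (\<forall>a\<in>J. \<forall>b\<in>J. a + b \<in> J) \<and> (\<forall>a\<in>S. \<forall>b\<in>J. a * b \<in> J)"

lemma S_idealD:
  assumes "S_ideal J"
  shows "J \<subseteq> S" "0 \<in> J" "a \<in> J \<Longrightarrow> b \<in> J \<Longrightarrow> a + b \<in> J" "a \<in> S \<Longrightarrow> b \<in> J \<Longrightarrow> a * b \<in> J"
    "a \<in> J \<Longrightarrow> b \<in> S \<Longrightarrow> a * b \<in> J" "a \<in> J \<Longrightarrow> - a \<in> J" "a \<in> J \<Longrightarrow> b \<in> J \<Longrightarrow> a - b \<in> J" "a \<in> J \<Longrightarrow> a \<in> S"
proof -
  show *: "J \<subseteq> S" "0 \<in> J" "a \<in> S \<Longrightarrow> b \<in> J \<Longrightarrow> a * b \<in> J" and add: "\<And>a b. a \<in> J \<Longrightarrow> b \<in> J \<Longrightarrow> a + b \<in> J"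
    using assms by (auto simp: S_ideal_def)
  then show "a \<in> J \<Longrightarrow> a \<in> S" by auto
  show "a \<in> J \<Longrightarrow> b \<in> S \<Longrightarrow> a * b \<in> J" using assms by (simp add: S_ideal_def mult.commute[of a])
  have neg: "- a \<in> J" if "a \<in> J" for a
    using assms that S_closed(9)[OF S_closed(2)] by (metis S_ideal_def mult_minus1)
  then show "a \<in> J \<Longrightarrow> - a \<in> J" .
  show "a \<in> J \<Longrightarrow> b \<in> J \<Longrightarrow> a - b \<in> J" using add[of a "- b"] neg by simp
qed

lemma S_ideal_subspace: "S_ideal J \<Longrightarrow> V.subspace J"
  unfolding V.subspace_def by (auto intro: S_idealD)

lemma S_subspace: "V.subspace S"
  unfolding V.subspace_def by auto

lemma S_ideal_principal: "r \<in> S \<Longrightarrow> S_ideal ((*) r ` S)"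
  unfolding S_ideal_def
proof (intro conjI ballI)
  assume r: "r \<in> S"
  show "(*) r ` S \<subseteq> S" using r by auto
  show "0 \<in> (*) r ` S" by (rule image_eqI[of _ _ 0]) auto
  fix a b assume b: "b \<in> (*) r ` S"
  show "a + b \<in> (*) r ` S" if "a \<in> (*) r ` S" using b that by (auto simp flip: distrib_left)
  show "a * b \<in> (*) r ` S" if "a \<in> S" using b that by (auto simp: mult.left_commute)
qed

lemma mon_lincomb_subdegree:
  assumes G: "finite G" "G \<subseteq> pole_orders" and nz: "\<exists>g\<in>G. a g \<noteq> 0"
  defines "z \<equiv> \<Sum>g\<in>G. fls_const (a g) * mon g"
  shows "z \<noteq> 0" "- fls_subdegree z \<in> G"
proof -
  let ?H = "{g \<in> G. a g \<noteq> 0}"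
  define m where "m = Max ?H"
  have m: "m \<in> ?H" "\<And>g. g \<in> ?H \<Longrightarrow> g \<le> m" using G nz unfolding m_def by (auto intro!: Max_ge Max_in[of ?H, simplified])
  have z: "z = (\<Sum>g\<in>?H. fls_const (a g) * mon g)" unfolding z_def using G(1) by (intro sum.mono_neutral_right) auto
  have nth: "fls_nth z k = (\<Sum>g\<in>?H. a g * fls_nth (mon g) k)" for k unfolding z by (simp add: fls_nth_sum)
  have below: "fls_nth (mon g) k = 0" if "g \<in> ?H" "k < - g" for g k
    using that mon_deg(1)[of g] G(2) by (auto simp: has_degree_le_def)
  have "fls_nth z (- m) = (\<Sum>g\<in>{m}. a g * fls_nth (mon g) (- m))"
    unfolding nth
  proof (rule sum.mono_neutral_right)
    show "\<forall>i\<in>?H - {m}. a i * fls_nth (mon i) (- m) = 0" using below m(2) by force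
  qed (use G m in auto)
  also have "\<dots> \<noteq> 0" using m G(2) mon_deg(2)[of m] by auto
  finally have lead: "fls_nth z (- m) \<noteq> 0" .
  have "fls_subdegree z = - m"
  proof (rule fls_subdegree_eqI[OF lead])
    fix k assume "k < - m"
    then show "fls_nth z k = 0" unfolding nth using below m(2) by (intro sum.neutral) force
  qed
  then show "- fls_subdegree z \<in> G" using m by simp
  show "z \<noteq> 0" using lead by auto
qed

lemma inj_on_mon: "inj_on mon pole_orders"
proof (rule inj_onI)
  have "fls_subdegree (mon g) = - g" if "g \<in> pole_orders" for g
    using mon_deg[OF that] by (intro fls_subdegree_eqI) (auto simp: has_degree_le_def)
  then show "g = h" if "g \<in> pole_orders" "h \<in> pole_orders" "mon g = mon h" for g h
    using that by (metis minus_equation_iff)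
qed

text \<open>Below \<open>d + 6\<close> the semigroup has \<open>d + 3\<close> elements, since only 1, 2 and 5 are missing. Of these \<open>d\<close>, \<open>d + 3\<close> and
  \<open>d + 4\<close> are translates by \<open>d\<close>; from \<open>d + 6\<close> on every number is such a translate.\<close>

lemma pole_orders_count:
  assumes d: "d \<in> pole_orders"
  shows "finite {n \<in> pole_orders. n - d \<notin> pole_orders}" "int (card {n \<in> pole_orders. n - d \<notin> pole_orders}) = d"
proof -
  let ?G = "{n \<in> pole_orders. n - d \<notin> pole_orders}"
  have d0: "0 \<le> d" using d by (simp add: pole_orders_def)
  have add: "n + d \<in> pole_orders" if n: "n \<in> pole_orders" for n
  proof -
    obtain i j where "n = 3 * int i + 4 * int j" by (rule pole_orders_rep[OF n]) blast
    moreover obtain i' j' where "d = 3 * int i' + 4 * int j'" by (rule pole_orders_rep[OF d]) blast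
    ultimately have "n + d = 3 * int (i + i') + 4 * int (j + j')" by simp
    then show ?thesis unfolding pole_orders_def by (simp, presburger)
  qed
  have sub: "?G \<subseteq> {0..<d + 6}" using d0 by (auto simp: pole_orders_def)
  then show fin: "finite ?G" using finite_subset by blast
  have "{0..<d + 6} - {1, 2, 5} = ?G \<union> (\<lambda>n. n + d) ` {0, 3, 4}"
  proof (intro equalityI subsetI)
    fix n assume "n \<in> {0..<d + 6} - {1, 2, 5}"
    then have n: "n \<in> pole_orders" "n < d + 6" by (auto simp: pole_orders_def)
    show "n \<in> ?G \<union> (\<lambda>n. n + d) ` {0, 3, 4}"
    proof (cases "n - d \<in> pole_orders")
      case True
      then have "n - d \<in> {0, 3, 4}" using n(2) unfolding pole_orders_def by auto
      then show ?thesis by force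
    qed (use n in auto)
  next
    fix n assume "n \<in> ?G \<union> (\<lambda>n. n + d) ` {0, 3, 4}"
    then have "n \<in> pole_orders \<and> n < d + 6"
    proof
      assume "n \<in> (\<lambda>n. n + d) ` {0, 3, 4}"
      then obtain k where k: "k \<in> {0, 3, 4}" "n = k + d" by blast
      then have "k \<in> pole_orders" "k < 6" by (auto simp: pole_orders_def)
      then show ?thesis using add[of k] k(2) by simp
    next
      assume n: "n \<in> ?G"
      then have "n \<in> {0..<d + 6}" using sub by blast
      then show ?thesis using n by simp
    qed
    then show "n \<in> {0..<d + 6} - {1, 2, 5}" by (auto simp: pole_orders_def)
  qed
  moreover have "?G \<inter> (\<lambda>n. n + d) ` {0, 3, 4} = {}" by (auto simp: pole_orders_def)
  ultimately have "card ({0..<d + 6} - {1, 2, 5}) = card ?G + card ((\<lambda>n. n + d) ` {0, 3, 4})"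
    using fin by (simp add: card_Un_disjoint)
  moreover have "card ((\<lambda>n. n + d) ` {0, 3, 4}) = 3" by (subst card_image) (auto simp: inj_on_def)
  moreover have "card ({0..<d + 6} - {1, 2, 5}) = card {0..<d + 6} - card {1, 2, 5 :: int}"
    using d0 by (intro card_Diff_subset) auto
  ultimately show "int (card ?G) = d" using d0 by auto
qed

text \<open>The pole orders of \<open>r S\<close> are the translates of the semigroup by the order of \<open>r\<close>. So the monomials whose order
  is not such a translate form a basis of \<open>S / r S\<close>.\<close>

lemma rel_dim_principal:
  assumes r: "r \<in> S" "r \<noteq> 0"
  shows "rel_dim S ((*) r ` S) (nat (- fls_subdegree r))"
proof -
  define d where "d = - fls_subdegree r"
  have d: "d \<in> pole_orders" using S_subdegree[OF r] by (simp add: d_def)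
  let ?G = "{n \<in> pole_orders. n - d \<notin> pole_orders}"
  let ?B = "mon ` ?G" and ?J = "(*) r ` S"
  have inj: "inj_on mon ?G" by (rule inj_on_subset[OF inj_on_mon]) auto
  have J: "V.subspace ?J" by (rule S_ideal_subspace[OF S_ideal_principal[OF r(1)]])
  have "indep_mod ?J ?B"
    unfolding indep_mod_def
  proof (intro allI impI)
    fix a assume a: "(\<Sum>b\<in>?B. fls_const (a b) * b) \<in> ?J"
    have e: "(\<Sum>b\<in>?B. fls_const (a b) * b) = (\<Sum>g\<in>?G. fls_const (a (mon g)) * mon g)"
      by (simp add: sum.reindex[OF inj])
    show "\<forall>b\<in>?B. a b = 0"
    proof (rule ccontr)
      assume "\<not> (\<forall>b\<in>?B. a b = 0)"
      then have "\<exists>g\<in>?G. a (mon g) \<noteq> 0" by auto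
      from mon_lincomb_subdegree[OF pole_orders_count(1)[OF d] _ this]
      have z: "(\<Sum>b\<in>?B. fls_const (a b) * b) \<noteq> 0" "- fls_subdegree (\<Sum>b\<in>?B. fls_const (a b) * b) \<in> ?G"
        unfolding e by auto
      obtain s where s: "s \<in> S" "(\<Sum>b\<in>?B. fls_const (a b) * b) = r * s" using a by auto
      then have "s \<noteq> 0" using z(1) by auto
      then have "- fls_subdegree (r * s) - d \<in> pole_orders"
        using r s(1) S_subdegree[of s] by (simp add: d_def)
      then show False using z(2) unfolding s(2) by simp
    qed
  qed
  moreover have "spans_mod ?J ?B S"
    unfolding spans_mod_def
  proof
    fix z assume "z \<in> S"
    then obtain n where n: "z \<in> Fil (int n)" using S_Fil by blast
    let ?T = "{a + b | a b. a \<in> kspan ?B \<and> b \<in> ?J}"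
    have "\<exists>t\<in>?T. z - t \<in> Fil (- 1)"
    proof (rule Fil_descend[where n = "Suc n"])
      show "V.subspace ?T" using V.subspace_sums[OF V.subspace_span[of ?B] J] by simp
      show "z \<in> Fil (- 1 + int (Suc n))" using n by simp
      fix i assume i: "i \<in> pole_orders"
      show "\<exists>e\<in>?T \<inter> Fil i. fls_nth e (- i) \<noteq> 0"
      proof (cases "i - d \<in> pole_orders")
        case True
        have hr: "has_degree_le d r" using r by (simp add: has_degree_le_subdegree d_def)
        have "has_degree_le (d + (i - d)) (r * mon (i - d))"
          "fls_nth (r * mon (i - d)) (- (d + (i - d))) = fls_nth r (- d) * fls_nth (mon (i - d)) (- (i - d))"
          using has_degree_le_mult[OF hr mon_deg(1)[OF True]] by auto
        moreover have "d + (i - d) = i" by simp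
        moreover have "fls_nth r (- d) \<noteq> 0" using r by (simp add: d_def)
        ultimately have "r * mon (i - d) \<in> Fil i" "fls_nth (r * mon (i - d)) (- i) \<noteq> 0"
          using r mon_deg[OF True] by (auto simp: Fil_def)
        moreover have "0 + r * mon (i - d) \<in> ?T"
          using mon_deg(3)[OF True] V.span_zero[of ?B] by blast
        then have "r * mon (i - d) \<in> ?T" by simp
        ultimately show ?thesis by blast
      next
        case False
        then have "mon i \<in> kspan ?B" using i by (intro V.span_base) auto
        then have "mon i \<in> ?T" using V.subspace_0[OF J] by force
        then show ?thesis using mon_deg[OF i] by (intro bexI[of _ "mon i"]) (auto simp: Fil_def)
      qed
    qed
    then obtain a b where "a \<in> kspan ?B" "b \<in> ?J" "z = a + b" by (auto simp: Fil_neg)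
    then show "\<exists>t\<in>kspan ?B. z - t \<in> ?J" by (intro bexI[of _ a]) auto
  qed
  ultimately show ?thesis
    unfolding rel_dim_def using pole_orders_count[OF d]
    by (intro exI[of _ ?B]) (auto simp: card_image[OF inj] mon_deg simp flip: d_def)
qed

lemma rel_dim_exists:
  assumes J: "S_ideal J" "r \<in> J" "r \<noteq> 0"
  shows "\<exists>n. rel_dim S J n \<and> n \<le> nat (- fls_subdegree r)"
proof -
  have r: "r \<in> S" using J S_idealD by blast
  obtain B where B: "finite B" "card B = nat (- fls_subdegree r)" "B \<subseteq> S" "spans_mod ((*) r ` S) B S"
    using rel_dim_principal[OF r J(3)] by (auto simp: rel_dim_def)
  have "(*) r ` S \<subseteq> J" using J S_idealD(5) by blast
  then have "spans_mod J B S" using B(4) by (force simp: spans_mod_def)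
  from spans_mod_imp_rel_dim[OF S_ideal_subspace[OF J(1)] B(1,3) this] show ?thesis using B(2) by auto
qed

end

section \<open>Maximal ideals and uniformizers\<close>

lemma map_poly_pderiv_mult:
  fixes p q :: "'k::field poly poly"
  shows "map_poly pderiv (p * q) = map_poly pderiv p * q + p * map_poly pderiv q"
proof (rule poly_eqI)
  fix n
  have c: "coeff (map_poly pderiv r) n = pderiv (coeff r n)" for r :: "'k poly poly" and n
    by (rule coeff_map_poly) simp
  have s: "pderiv (\<Sum>i\<in>A. g i) = (\<Sum>i\<in>A. pderiv (g i))" for g :: "nat \<Rightarrow> 'k poly" and A
    by (induction A rule: infinite_finite_induct) (simp_all add: pderiv_add)
  show "coeff (map_poly pderiv (p * q)) n = coeff (map_poly pderiv p * q + p * map_poly pderiv q) n"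
    unfolding coeff_add coeff_mult c s sum.distrib[symmetric]
    by (intro sum.cong refl) (simp add: pderiv_mult algebra_simps)
qed

lemma map_poly_pderiv_add:
  fixes p q :: "'k::field poly poly"
  shows "map_poly pderiv (p + q) = map_poly pderiv p + map_poly pderiv q"
  by (rule poly_eqI) (simp add: coeff_map_poly pderiv_add)

context c34_equation
begin

definition pts :: "'k poly poly set set set" where "pts = {P. maximalideal P R}"
definition idl :: "'k poly poly set set \<Rightarrow> 'k fls set" where "idl P = {z \<in> S. el z \<in> P}"

lemma ideal_el:
  assumes "S_ideal J"
  shows "ideal (el ` J) R"
proof -
  interpret cring R by (rule cring_R)
  note J = S_idealD[OF assms]
  show ?thesis
  proof (rule idealI)
    show "ring R" by (rule ring_axioms)
    show "subgroup (el ` J) (add_monoid R)"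
    proof (rule add.subgroupI)
      show "el ` J \<subseteq> carrier R" using J(8) by blast
      show "el ` J \<noteq> {}" using J(2) by blast
      fix a b assume "a \<in> el ` J" "b \<in> el ` J"
      then obtain a' b' where ab: "a' \<in> J" "b' \<in> J" "a = el a'" "b = el b'" by blast
      show "\<ominus>\<^bsub>R\<^esub> a \<in> el ` J" using ab J(6,8) by (simp add: el_uminus)
      show "a \<oplus>\<^bsub>R\<^esub> b \<in> el ` J" using ab J(3,8) by (simp add: el_add)
    qed
    fix a x assume "a \<in> el ` J" "x \<in> carrier R"
    then obtain a' x' where ax: "a' \<in> J" "x' \<in> S" "a = el a'" "x = el x'" unfolding carrier_R by blast
    show "x \<otimes>\<^bsub>R\<^esub> a \<in> el ` J" using ax J(4,8) by (simp add: el_mult)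
    show "a \<otimes>\<^bsub>R\<^esub> x \<in> el ` J" using ax J(5,8) by (simp add: el_mult)
  qed
qed

lemma S_ideal_idl:
  assumes "ideal P R"
  shows "S_ideal (idl P)"
proof -
  interpret ideal P R by fact
  show ?thesis
    unfolding S_ideal_def idl_def
    using additive_subgroup.zero_closed[OF ideal.axioms(1)[OF assms]] a_closed I_l_closed by (auto simp: el_zero simp flip: el_add el_mult)
qed

lemma el_idl: "ideal P R \<Longrightarrow> el ` idl P = P"
  using ideal.Icarr[of P R] by (auto simp: idl_def carrier_R)

lemma idl_el: "S_ideal J \<Longrightarrow> idl (el ` J) = J"
  using S_idealD(8)[of J] by (auto simp: idl_def)

lemma pts_ideal: "P \<in> pts \<Longrightarrow> ideal P R"
  by (auto simp: pts_def maximalideal_def)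

lemma idl_S_ideal: "P \<in> pts \<Longrightarrow> S_ideal (idl P)"
  by (intro S_ideal_idl pts_ideal)

lemma idl_proper: "P \<in> pts \<Longrightarrow> 1 \<notin> idl P"
proof
  assume P: "P \<in> pts" "1 \<in> idl P"
  then have "S \<subseteq> idl P" using S_idealD(4)[OF idl_S_ideal[OF P(1)], of _ 1] by auto
  then have "idl P = S" by (auto simp: idl_def)
  then have "P = carrier R" using el_idl[OF pts_ideal[OF P(1)]] carrier_R by simp
  then show False using P(1) maximalideal.I_notcarr[of P R] by (auto simp: pts_def)
qed

text \<open>By maximality \<open>h\<close> and \<open>P\<close> generate the unit ideal.\<close>

lemma idl_inverse:
  assumes P: "P \<in> pts" and h: "h \<in> S" "h \<notin> idl P"
  shows "\<exists>k\<in>S. 1 - h * k \<in> idl P"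
proof -
  note I = S_idealD[OF idl_S_ideal[OF P]]
  let ?J = "{a * h + m | a m. a \<in> S \<and> m \<in> idl P}"
  have "S_ideal ?J"
    unfolding S_ideal_def
  proof (intro conjI ballI)
    show "?J \<subseteq> S" using h(1) I(8) by blast
    show "0 \<in> ?J" using I(2) by (auto intro!: exI[of _ 0])
    fix u v assume v: "v \<in> ?J"
    then obtain a m where am: "v = a * h + m" "a \<in> S" "m \<in> idl P" by blast
    show "u + v \<in> ?J" if u: "u \<in> ?J"
    proof -
      obtain a' m' where am': "u = a' * h + m'" "a' \<in> S" "m' \<in> idl P" using u by blast
      have "u + v = (a' + a) * h + (m' + m)" unfolding am(1) am'(1) by (simp add: algebra_simps)
      then show ?thesis using am am' I(3) by blast
    qed
    show "u * v \<in> ?J" if "u \<in> S"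
    proof -
      have "u * v = (u * a) * h + u * m" unfolding am(1) by (simp add: algebra_simps)
      then show ?thesis using am that I(4) by blast
    qed
  qed
  note J = ideal_el[OF this] idl_el[OF this]
  have sub: "idl P \<subseteq> ?J"
  proof
    fix m assume "m \<in> idl P"
    then have "0 * h + m \<in> ?J" by blast
    then show "m \<in> ?J" by simp
  qed
  then have "P \<subseteq> el ` ?J" using image_mono[OF sub, of el] unfolding el_idl[OF pts_ideal[OF P]] by simp
  moreover have "el ` ?J \<subseteq> carrier R" using ideal.Icarr[OF J(1)] by blast
  moreover have "el ` ?J \<noteq> P"
  proof
    assume "el ` ?J = P"
    then have "idl P = ?J" using J(2) by simp
    moreover have "1 * h + 0 \<in> ?J" using I(2) S_closed(2) by blast
    ultimately show False using h(2) by simp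
  qed
  moreover have "maximalideal P R" using P by (simp add: pts_def)
  note maximalideal.I_maximal[OF this J(1)]
  ultimately have "el ` ?J = carrier R" by blast
  then have "idl (el ` ?J) = S" by (auto simp: idl_def)
  then have "1 \<in> ?J" using J(2) by simp
  then obtain a m where am: "1 = a * h + m" "a \<in> S" "m \<in> idl P" by blast
  then have "1 - h * a = m" by (simp add: algebra_simps)
  then show ?thesis using am by blast
qed

lemma idl_prime:
  assumes P: "P \<in> pts" and ab: "a \<in> S" "b \<in> S" "a * b \<in> idl P"
  shows "a \<in> idl P \<or> b \<in> idl P"
proof (rule disjCI)
  note I = S_idealD[OF idl_S_ideal[OF P]]
  assume "b \<notin> idl P"
  then obtain k where k: "k \<in> S" "1 - b * k \<in> idl P" using idl_inverse[OF P ab(2)] by blast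
  have "a * (1 - b * k) + k * (a * b) \<in> idl P" by (rule I(3)[OF I(4)[OF ab(1) k(2)] I(4)[OF k(1) ab(3)]])
  then show "a \<in> idl P" by (simp add: algebra_simps)
qed

lemma S_ideal_in_pts:
  assumes J: "S_ideal J" "1 \<notin> J"
  shows "\<exists>P\<in>pts. J \<subseteq> idl P"
proof -
  let ?A = "{J'. S_ideal J' \<and> J \<subseteq> J' \<and> 1 \<notin> J'}"
  have "\<exists>M\<in>?A. \<forall>X\<in>?A. M \<subseteq> X \<longrightarrow> X = M"
  proof (rule subset_Zorn_nonempty)
    show "?A \<noteq> {}" using J by blast
    fix \<C> assume C: "\<C> \<noteq> {}" "subset.chain ?A \<C>"
    then have CA: "\<And>J'. J' \<in> \<C> \<Longrightarrow> S_ideal J' \<and> J \<subseteq> J' \<and> 1 \<notin> J'"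
      and lin: "\<And>J' J''. J' \<in> \<C> \<Longrightarrow> J'' \<in> \<C> \<Longrightarrow> J' \<subseteq> J'' \<or> J'' \<subseteq> J'"
      by (auto simp: subset_chain_def)
    have "S_ideal (\<Union>\<C>)"
      unfolding S_ideal_def
    proof (intro conjI ballI)
      show "\<Union>\<C> \<subseteq> S" using CA S_idealD(1) by blast
      show "0 \<in> \<Union>\<C>" using CA C(1) S_idealD(2) by blast
      fix a b assume b: "b \<in> \<Union>\<C>"
      then obtain B where B: "B \<in> \<C>" "b \<in> B" by blast
      show "a * b \<in> \<Union>\<C>" if "a \<in> S" using CA[OF B(1)] S_idealD(4)[of B a b] that B by blast
      show "a + b \<in> \<Union>\<C>" if a: "a \<in> \<Union>\<C>"
      proof -
        obtain D where D: "D \<in> \<C>" "a \<in> D" using a by blast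
        show ?thesis
        proof (cases "B \<subseteq> D")
          case True
          then have "a + b \<in> D" using CA[OF D(1)] S_idealD(3)[of D a b] B D by blast
          then show ?thesis using D(1) by blast
        next
          case False
          then have "a \<in> B" using lin[OF B(1) D(1)] D(2) by blast
          then have "a + b \<in> B" using CA[OF B(1)] S_idealD(3)[of B a b] B by blast
          then show ?thesis using B(1) by blast
        qed
      qed
    qed
    moreover have "J \<subseteq> \<Union>\<C>" "1 \<notin> \<Union>\<C>" using CA C(1) by blast+
    ultimately show "\<Union>\<C> \<in> ?A" by simp
  qed
  then obtain M where MA: "M \<in> ?A" and maxA: "\<forall>X\<in>?A. M \<subseteq> X \<longrightarrow> X = M" by (rule bexE)
  then have M: "S_ideal M" "J \<subseteq> M" "1 \<notin> M" by simp_all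
  have max: "X = M" if "S_ideal X" "J \<subseteq> X" "1 \<notin> X" "M \<subseteq> X" for X
    using maxA that by simp
  have "maximalideal (el ` M) R"
  proof (rule maximalidealI[OF ideal_el[OF M(1)]])
    show "carrier R \<noteq> el ` M"
    proof
      assume "carrier R = el ` M"
      then have "idl (el ` M) = S" by (auto simp: idl_def)
      then show False using M(3) idl_el[OF M(1)] by auto
    qed
    fix Q assume Q: "ideal Q R" "el ` M \<subseteq> Q" "Q \<subseteq> carrier R"
    have sub: "M \<subseteq> idl Q" using Q(2) S_idealD(8)[OF M(1)] by (auto simp: idl_def)
    show "Q = el ` M \<or> Q = carrier R"
    proof (cases "1 \<in> idl Q")
      case True
      then have "S \<subseteq> idl Q" using S_idealD(4)[OF S_ideal_idl[OF Q(1)], of _ 1] by auto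
      then have "idl Q = S" by (auto simp: idl_def)
      then have "Q = carrier R" using el_idl[OF Q(1)] carrier_R by simp
      then show ?thesis ..
    next
      case False
      have "idl Q = M" by (rule max[OF S_ideal_idl[OF Q(1)] subset_trans[OF M(2) sub] False sub])
      then show ?thesis using el_idl[OF Q(1)] by simp
    qed
  qed
  then have "el ` M \<in> pts" by (simp add: pts_def)
  moreover have "J \<subseteq> idl (el ` M)" using idl_el[OF M(1)] M(2) by simp
  ultimately show ?thesis by blast
qed

lemma idl_nonzero:
  assumes P: "P \<in> pts"
  shows "\<exists>r\<in>idl P. r \<noteq> 0"
proof (cases "X \<in> idl P")
  case True
  then show ?thesis using X_nonzero by blast
next
  case False
  then obtain k where k: "k \<in> S" "1 - X * k \<in> idl P" using idl_inverse[OF P S_closed(3)] by blast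
  have "1 - X * k \<noteq> 0"
  proof
    assume "1 - X * k = 0"
    then have e: "X * k = 1" by simp
    then have k0: "k \<noteq> 0" by auto
    have "fls_subdegree (X * k) = -3 + fls_subdegree k" using k0 X_nonzero by (simp add: subdegree_X)
    then have "- fls_subdegree k = -3" unfolding e by simp
    then show False using S_subdegree[OF k(1) k0] by (simp add: pole_orders_def)
  qed
  then show ?thesis using k(2) by blast
qed

lemma ev_x_monom: "ev_x (monom k i) = fls_const k * X ^ i"
proof -
  have "monom k i = [:k:] * [:0, 1:] ^ i" by (simp add: monom_altdef)
  moreover have "ev_x [:0, 1:] = X" by (simp add: ev_x_pCons)
  ultimately show ?thesis by (simp only: ev_x.hom_mult ev_x.hom_power ev_x_const)
qed

lemma inj_X_power: "inj ((^) X)"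
proof (rule injI)
  fix i j assume "X ^ i = X ^ j"
  then have "fls_subdegree (X ^ i) = fls_subdegree (X ^ j)" by simp
  then show "i = j" by (simp add: fls_subdegree_pow subdegree_X)
qed

text \<open>\<open>S / P\<close> has finite dimension, so the powers of \<open>x\<close> are dependent modulo \<open>P\<close>.\<close>

lemma idl_contains_x_poly:
  assumes P: "P \<in> pts"
  shows "\<exists>a. a \<noteq> 0 \<and> ev_x a \<in> idl P"
proof -
  obtain r where r: "r \<in> idl P" "r \<noteq> 0" using idl_nonzero[OF P] by blast
  obtain n where n: "rel_dim S (idl P) n" using rel_dim_exists[OF idl_S_ideal[OF P] r] by blast
  obtain B where B: "finite B" "card B = n" "spans_mod (idl P) B S" using n by (auto simp: rel_dim_def)
  let ?C = "(^) X ` {..n}"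
  have inj: "inj_on ((^) X) {..n}" using inj_X_power by (rule inj_on_subset) simp
  have "spans_mod (idl P) B ?C" using B(3) by (auto simp: spans_mod_def)
  then have "\<not> indep_mod (idl P) ?C"
    using indep_mod_card_le[OF S_ideal_subspace[OF idl_S_ideal[OF P]] _ _ B(1), of ?C] card_image[OF inj] B(2) by auto
  then obtain a b where a: "(\<Sum>b\<in>?C. fls_const (a b) * b) \<in> idl P" "b \<in> ?C" "a b \<noteq> 0"
    unfolding indep_mod_def by blast
  define q where "q = (\<Sum>i\<le>n. monom (a (X ^ i)) i)"
  have "ev_x q = (\<Sum>i\<le>n. fls_const (a (X ^ i)) * X ^ i)"
    by (simp add: q_def ev_x.hom_sum ev_x_monom)
  also have "\<dots> = (\<Sum>b\<in>?C. fls_const (a b) * b)" unfolding sum.reindex[OF inj] comp_def ..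
  finally have "ev_x q \<in> idl P" using a(1) by simp
  moreover obtain i where i: "i \<le> n" "b = X ^ i" using a(2) by auto
  then have "coeff q i \<noteq> 0" using a(3) by (simp add: q_def coeff_sum)
  then have "q \<noteq> 0" by auto
  ultimately show ?thesis by blast
qed

text \<open>An element of least degree generates the intersection of the maximal ideal with \<open>K[x]\<close>.\<close>

lemma idl_x_generator:
  assumes P: "P \<in> pts"
  obtains p where "p \<noteq> 0" "degree p > 0" "\<And>a. ev_x a \<in> idl P \<longleftrightarrow> p dvd a"
proof -
  note I = S_idealD[OF idl_S_ideal[OF P]]
  have S: "ev_x a \<in> S" for a using S_closed(10)[of "[:a:]"] by (simp add: ev_const)
  define n where "n = (LEAST n. \<exists>a. a \<noteq> 0 \<and> ev_x a \<in> idl P \<and> degree a = n)"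
  have "\<exists>n a. a \<noteq> 0 \<and> ev_x a \<in> idl P \<and> degree a = n" using idl_contains_x_poly[OF P] by blast
  from LeastI_ex[OF this] obtain p where p: "p \<noteq> 0" "ev_x p \<in> idl P" "degree p = n" unfolding n_def by blast
  have min: "n \<le> degree a" if "a \<noteq> 0" "ev_x a \<in> idl P" for a
    unfolding n_def by (rule Least_le) (use that in blast)
  have dvd: "ev_x a \<in> idl P \<longleftrightarrow> p dvd a" for a
  proof
    assume a: "ev_x a \<in> idl P"
    have "a mod p = a - p * (a div p)" by (simp add: minus_mult_div_eq_mod)
    then have "ev_x (a mod p) = ev_x a - ev_x p * ev_x (a div p)" by (simp add: ev_x.hom_minus ev_x.hom_mult)
    then have "ev_x (a mod p) \<in> idl P" using I(7)[OF a I(5)[OF p(2) S]] by simp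
    then have "a mod p = 0" using min[of "a mod p"] degree_mod_less[OF p(1), of a] p(3) by fastforce
    then show "p dvd a" by (simp add: dvd_eq_mod_eq_0)
  next
    assume "p dvd a"
    then obtain b where "a = p * b" by (auto simp: dvd_def)
    then show "ev_x a \<in> idl P" using I(5)[OF p(2) S] by (simp add: ev_x.hom_mult)
  qed
  have "\<not> p dvd 1" using dvd[of 1] idl_proper[OF P] by simp
  then have "degree p > 0" using p(1) is_unit_iff_degree by blast
  then show ?thesis using that p(1) dvd by blast
qed

text \<open>An element of least degree in the ideal of \<open>K[x]\<close> generated by \<open>l\<close> and \<open>p\<close> divides both. As \<open>P\<close> is prime and does
  not contain this divisor, the cofactor of \<open>p\<close> is a multiple of \<open>p\<close>, and the divisor is a unit.\<close>

lemma idl_x_bezout: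
  assumes P: "P \<in> pts" and p: "p \<noteq> 0" "\<And>a. ev_x a \<in> idl P \<longleftrightarrow> p dvd a" and l: "\<not> p dvd l"
  shows "\<exists>a b. a * l + b * p = 1"
proof -
  have S: "ev_x a \<in> S" for a using S_closed(10)[of "[:a:]"] by (simp add: ev_const)
  define n where "n = (LEAST n. \<exists>a b. a * l + b * p \<noteq> 0 \<and> degree (a * l + b * p) = n)"
  have "\<exists>n a b. a * l + b * p \<noteq> 0 \<and> degree (a * l + b * p) = n"
    using p(1) by (intro exI[of _ "degree p"] exI[of _ 0] exI[of _ 1]) simp
  from LeastI_ex[OF this] obtain a b where ab: "a * l + b * p \<noteq> 0" "degree (a * l + b * p) = n"
    unfolding n_def by blast
  define d where "d = a * l + b * p"
  have min: "n \<le> degree (a * l + b * p)" if "a * l + b * p \<noteq> 0" for a b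
    unfolding n_def by (rule Least_le) (use that in blast)
  have dvd: "d dvd u * l + v * p" for u v
  proof -
    let ?z = "u * l + v * p"
    have "?z mod d = ?z - d * (?z div d)" by (simp add: minus_mult_div_eq_mod)
    also have "\<dots> = (u - a * (?z div d)) * l + (v - b * (?z div d)) * p"
      unfolding d_def by (simp add: algebra_simps)
    finally have e: "?z mod d = (u - a * (?z div d)) * l + (v - b * (?z div d)) * p" .
    have "?z mod d = 0"
    proof (rule ccontr)
      assume nz: "?z mod d \<noteq> 0"
      then have "n \<le> degree (?z mod d)" unfolding e by (rule min)
      moreover have "d \<noteq> 0" using ab(1) by (simp add: d_def)
      then have "degree (?z mod d) < degree d" using degree_mod_less[of d ?z] nz by blast
      ultimately show False using ab(2) by (simp add: d_def)
    qed
    then show ?thesis by (simp add: dvd_eq_mod_eq_0)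
  qed
  have dl: "d dvd l" using dvd[of 1 0] by simp
  obtain e where e: "p = d * e" using dvd[of 0 1] by (auto simp: dvd_def)
  have "ev_x d \<notin> idl P" using p(2)[of d] dl l dvd_trans by blast
  moreover have "ev_x d * ev_x e \<in> idl P" using p(2)[of p] e by (simp add: ev_x.hom_mult)
  ultimately have "ev_x e \<in> idl P" using idl_prime[OF P S S] by blast
  then have "p dvd e" using p(2) by simp
  moreover have "e \<noteq> 0" using e p(1) by auto
  ultimately have "degree d + degree e \<le> degree e" using dvd_imp_degree_le[of p e] e p(1) by (simp add: degree_mult_eq)
  then have "d dvd 1" using ab(1) is_unit_iff_degree[of d] by (simp add: d_def)
  then obtain u where "1 = d * u" by (auto simp: dvd_def)
  then have "(u * a) * l + (u * b) * p = 1" by (simp add: d_def algebra_simps)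
  then show ?thesis by blast
qed

text \<open>The generator \<open>p\<close> of the intersection with \<open>K[x]\<close> is the first one. The second one, \<open>q\<close>, is made monic in \<open>y\<close> by
  a Bezout relation from a member of least degree in \<open>y\<close> whose leading coefficient \<open>p\<close> does not divide. The
  degree of any further member is then lowered by subtracting a multiple of \<open>p\<close> or of \<open>q\<close>.\<close>

lemma idl_two_generators:
  assumes P: "P \<in> pts"
  obtains p q where "ev p \<in> idl P" "ev q \<in> idl P" "\<And>m. ev m \<in> idl P \<Longrightarrow> \<exists>\<alpha> \<beta>. m = p * \<alpha> + q * \<beta>"
proof -
  note I = S_idealD[OF idl_S_ideal[OF P]]
  obtain p where p: "p \<noteq> 0" "degree p > 0" "\<And>a. ev_x a \<in> idl P \<longleftrightarrow> p dvd a" by (rule idl_x_generator[OF P]) (rule that)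
  let ?p = "[:p:]"
  have evp: "ev ?p \<in> idl P" using p(3)[of p] by (simp add: ev_const)
  define n where "n = (LEAST n. \<exists>g. ev g \<in> idl P \<and> degree g = n \<and> \<not> p dvd coeff g (degree g))"
  have "\<not> p dvd 1" using p(1,2) is_unit_iff_degree[OF p(1)] by simp
  moreover have "coeff (curve_eq c) (degree (curve_eq c)) = 1" by (simp add: curve_eq_pCons)
  ultimately have "\<exists>n g. ev g \<in> idl P \<and> degree g = n \<and> \<not> p dvd coeff g (degree g)"
    using I(2) by (intro exI[of _ "degree (curve_eq c)"] exI[of _ "curve_eq c"]) (simp add: ev_curve_eq)
  from LeastI_ex[OF this, folded n_def] obtain g
    where g0: "ev g \<in> idl P \<and> degree g = n \<and> \<not> p dvd coeff g (degree g)" by (rule exE)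
  then have g: "ev g \<in> idl P" "degree g = n" "\<not> p dvd coeff g n" by auto
  have min: "n \<le> degree g" if "ev g \<in> idl P" "\<not> p dvd coeff g (degree g)" for g
    unfolding n_def by (rule Least_le) (use that in blast)
  obtain a b where ab: "a * coeff g n + b * p = 1" using idl_x_bezout[OF P p(1,3) g(3)] by blast
  define q where "q = [:a:] * g + ?p * monom b n"
  have qn: "coeff q n = 1" using ab by (simp add: q_def mult.commute)
  have qhi: "coeff q i = 0" if "n < i" for i using that g(2) by (simp add: q_def coeff_eq_0)
  have evq: "ev q \<in> idl P"
    unfolding q_def ev.hom_add ev.hom_mult by (intro I(3) I(4)[OF _ g(1)] I(5)[OF evp]) simp_all
  have gen: "\<exists>\<alpha> \<beta>. m = ?p * \<alpha> + q * \<beta>" if "ev m \<in> idl P" "\<forall>i\<ge>N. coeff m i = 0" for m N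
    using that
  proof (induction N arbitrary: m)
    case 0
    then have "m = 0" by (simp add: poly_eq_iff)
    then show ?case by (intro exI[of _ 0]) simp
  next
    case (Suc N)
    show ?case
    proof (cases "p dvd coeff m N")
      case True
      then obtain e where e: "coeff m N = p * e" by (auto simp: dvd_def)
      let ?m = "m - ?p * monom e N"
      have "ev ?m \<in> idl P"
        unfolding ev.hom_minus ev.hom_mult by (intro I(7)[OF Suc.prems(1)] I(5)[OF evp]) simp
      moreover have "coeff ?m i = 0" if "N \<le> i" for i
        using Suc.prems(2) e that by (cases "i = N") simp_all
      ultimately obtain \<alpha> \<beta> where "?m = ?p * \<alpha> + q * \<beta>" using Suc.IH by blast
      then have "m = ?p * (\<alpha> + monom e N) + q * \<beta>" by (simp add: algebra_simps)
      then show ?thesis by blast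
    next
      case False
      then have "coeff m N \<noteq> 0" by auto
      then have "degree m = N" using Suc.prems(2) by (intro antisym degree_le le_degree) auto
      then have nN: "n \<le> N" using min[OF Suc.prems(1)] False by simp
      let ?t = "monom (coeff m N) (N - n)"
      let ?m = "m - ?t * q"
      have "ev ?m \<in> idl P"
        unfolding ev.hom_minus ev.hom_mult by (intro I(7)[OF Suc.prems(1)] I(4)[OF _ evq]) simp
      moreover have "coeff ?m i = 0" if "N \<le> i" for i
      proof (cases "i = N")
        case True
        then show ?thesis using nN qn by (simp add: coeff_monom_mult)
      next
        case False
        then have "n < i - (N - n)" using that nN by auto
        then show ?thesis using Suc.prems(2) that False qhi by (simp add: coeff_monom_mult)
      qed
      ultimately obtain \<alpha> \<beta> where "?m = ?p * \<alpha> + q * \<beta>" using Suc.IH by blast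
      then have "m = ?p * \<alpha> + q * (\<beta> + ?t)" by (simp add: algebra_simps)
      then show ?thesis by blast
    qed
  qed
  show ?thesis
  proof (rule that[OF evp evq])
    fix m assume "ev m \<in> idl P"
    then show "\<exists>\<alpha> \<beta>. m = ?p * \<alpha> + q * \<beta>" using gen[of m "Suc (degree m)"] by (simp add: coeff_eq_0)
  qed
qed

end

locale c34 = c34_equation c for c :: "nat \<Rightarrow> nat \<Rightarrow> 'k::field" +
  assumes smooth: "C34_curve c"
begin

text \<open>Write the curve equation as \<open>p \<alpha> + q \<beta>\<close> in terms of two generators of the maximal ideal. If both \<open>\<alpha>\<close>
  and \<open>\<beta>\<close> were in the ideal, both partial derivatives would be, against smoothness. So one of them is a
  local unit and one of the generators is superfluous locally.\<close>

lemma uniformizer_exists: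
  assumes P: "P \<in> pts"
  shows "\<exists>\<pi>\<in>idl P. \<exists>h\<in>S - idl P. \<forall>m\<in>idl P. \<exists>s\<in>S. h * m = \<pi> * s"
proof -
  note I = S_idealD[OF idl_S_ideal[OF P]]
  obtain p q where p: "ev p \<in> idl P" and q: "ev q \<in> idl P" and gen: "\<And>m. ev m \<in> idl P \<Longrightarrow> \<exists>\<alpha> \<beta>. m = p * \<alpha> + q * \<beta>"
    by (rule idl_two_generators[OF P]) (rule that)
  let ?f = "curve_eq c"
  have "ev ?f \<in> idl P" using I(2) by (simp add: ev_curve_eq)
  from gen[OF this] obtain \<alpha> \<beta> where f: "?f = p * \<alpha> + q * \<beta>" by blast
  have rel: "ev p * ev \<alpha> + ev q * ev \<beta> = 0" using ev_curve_eq unfolding f by (simp add: ev.hom_add ev.hom_mult)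
  have "\<not> (ev \<alpha> \<in> idl P \<and> ev \<beta> \<in> idl P)"
  proof
    assume ab: "ev \<alpha> \<in> idl P \<and> ev \<beta> \<in> idl P"
    have D: "ev (d ?f) \<in> idl P" if "d ?f = d p * \<alpha> + p * d \<alpha> + (d q * \<beta> + q * d \<beta>)" for d
      unfolding that ev.hom_add ev.hom_mult using ab by (intro I(3) I(4)[of "ev (d p)"] I(4)[of "ev (d q)"] I(5)[OF p] I(5)[OF q]) auto
    have "ev (map_poly pderiv ?f) \<in> idl P"
      by (rule D) (simp add: f map_poly_pderiv_add map_poly_pderiv_mult)
    moreover have "ev (pderiv ?f) \<in> idl P"
      by (rule D) (simp add: f pderiv_add pderiv_mult algebra_simps)
    ultimately show False using smooth P unfolding C34_curve_def by (auto simp: pts_def cls_el idl_def)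
  qed
  then consider "ev \<beta> \<notin> idl P" | "ev \<alpha> \<notin> idl P" by blast
  then show ?thesis
  proof cases
    case 1
    have "\<exists>s\<in>S. ev \<beta> * m = ev p * s" if m: "m \<in> idl P" for m
    proof -
      obtain m' where m': "m = ev m'" using I(8)[OF m] by (auto simp: S_def)
      obtain a b where ab: "m' = p * a + q * b" using gen[of m'] m m' by blast
      have "ev \<beta> * m = ev p * (ev \<beta> * ev a) + (ev q * ev \<beta>) * ev b"
        unfolding m' ab ev.hom_add ev.hom_mult by (simp add: algebra_simps)
      also have "ev q * ev \<beta> = - (ev p * ev \<alpha>)" using rel by (simp add: eq_neg_iff_add_eq_0 add.commute)
      finally have "ev \<beta> * m = ev p * (ev \<beta> * ev a - ev \<alpha> * ev b)" by (simp add: algebra_simps)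
      then show ?thesis by blast
    qed
    then show ?thesis using p 1 by blast
  next
    case 2
    have "\<exists>s\<in>S. ev \<alpha> * m = ev q * s" if m: "m \<in> idl P" for m
    proof -
      obtain m' where m': "m = ev m'" using I(8)[OF m] by (auto simp: S_def)
      obtain a b where ab: "m' = p * a + q * b" using gen[of m'] m m' by blast
      have "ev \<alpha> * m = (ev p * ev \<alpha>) * ev a + ev q * (ev \<alpha> * ev b)"
        unfolding m' ab ev.hom_add ev.hom_mult by (simp add: algebra_simps)
      also have "ev p * ev \<alpha> = - (ev q * ev \<beta>)" using rel by (simp add: eq_neg_iff_add_eq_0)
      finally have "ev \<alpha> * m = ev q * (ev \<alpha> * ev b - ev \<beta> * ev a)" by (simp add: algebra_simps)
      then show ?thesis by blast
    qed
    then show ?thesis using q 2 by blast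
  qed
qed

end

section \<open>Vanishing orders\<close>

context c34
begin

definition unif :: "'k poly poly set set \<Rightarrow> 'k fls" where
  "unif P = (SOME \<pi>. \<pi> \<in> idl P \<and> (\<exists>h\<in>S - idl P. \<forall>m\<in>idl P. \<exists>s\<in>S. h * m = \<pi> * s))"

lemma unif:
  assumes "P \<in> pts"
  shows "unif P \<in> idl P" "\<exists>h\<in>S - idl P. \<forall>m\<in>idl P. \<exists>s\<in>S. h * m = unif P * s"
proof -
  have "\<exists>\<pi>. \<pi> \<in> idl P \<and> (\<exists>h\<in>S - idl P. \<forall>m\<in>idl P. \<exists>s\<in>S. h * m = \<pi> * s)"
    using uniformizer_exists[OF assms] by (simp only: Bex_def)
  from someI_ex[OF this] show "unif P \<in> idl P" "\<exists>h\<in>S - idl P. \<forall>m\<in>idl P. \<exists>s\<in>S. h * m = unif P * s"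
    unfolding unif_def[symmetric] by simp_all
qed

text \<open>The order of vanishing at \<open>P\<close> is at least, respectively exactly, \<open>n\<close>. This is read off in the local ring at
  \<open>P\<close>, where \<open>h\<close> is the denominator.\<close>

definition vge :: "'k poly poly set set \<Rightarrow> nat \<Rightarrow> 'k fls \<Rightarrow> bool" where
  "vge P n z \<longleftrightarrow> (\<exists>h\<in>S - idl P. \<exists>s\<in>S. h * z = unif P ^ n * s)"

definition vex :: "'k poly poly set set \<Rightarrow> nat \<Rightarrow> 'k fls \<Rightarrow> bool" where
  "vex P n z \<longleftrightarrow> (\<exists>h\<in>S - idl P. \<exists>s\<in>S - idl P. h * z = unif P ^ n * s)"

lemma unif_S: "P \<in> pts \<Longrightarrow> unif P \<in> S"
  using unif(1) by (auto simp: idl_def)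

lemma unif_nonzero: "P \<in> pts \<Longrightarrow> unif P \<noteq> 0"
proof
  assume P: "P \<in> pts" and 0: "unif P = 0"
  obtain r where r: "r \<in> idl P" "r \<noteq> 0" using idl_nonzero[OF P] by blast
  obtain h where h: "h \<in> S - idl P" "\<forall>m\<in>idl P. \<exists>s\<in>S. h * m = unif P * s" using unif(2)[OF P] by blast
  then have "h * r = 0" using r(1) 0 by auto
  then have "h = 0" using r(2) by simp
  then show False using h(1) S_idealD(2)[OF idl_S_ideal[OF P]] by simp
qed

lemma unit_mult: "P \<in> pts \<Longrightarrow> a \<in> S - idl P \<Longrightarrow> b \<in> S - idl P \<Longrightarrow> a * b \<in> S - idl P"
  using idl_prime[of P a b] by auto

lemma unit_one: "P \<in> pts \<Longrightarrow> 1 \<in> S - idl P"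
  using idl_proper by auto

lemma vge_0: "P \<in> pts \<Longrightarrow> z \<in> S \<Longrightarrow> vge P 0 z"
  unfolding vge_def by (intro bexI[OF _ unit_one] bexI[of _ z]) auto

lemma vge_zero: "P \<in> pts \<Longrightarrow> vge P n 0"
  unfolding vge_def by (intro bexI[OF _ unit_one] bexI[of _ 0]) auto

lemma vge_mono:
  assumes P: "P \<in> pts" and "vge P n z" "m \<le> n"
  shows "vge P m z"
proof -
  obtain h s where hs: "h \<in> S - idl P" "s \<in> S" "h * z = unif P ^ n * s" using assms(2) by (auto simp: vge_def)
  have "h * z = unif P ^ m * (unif P ^ (n - m) * s)"
    using hs(3) assms(3) by (simp flip: mult.assoc power_add)
  then show ?thesis unfolding vge_def using hs unif_S[OF P] by blast
qed

lemma vge_add: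
  assumes P: "P \<in> pts" and "vge P n y" "vge P n z"
  shows "vge P n (y + z)"
proof -
  obtain h s where hs: "h \<in> S - idl P" "s \<in> S" "h * y = unif P ^ n * s" using assms(2) by (auto simp: vge_def)
  obtain h' s' where hs': "h' \<in> S - idl P" "s' \<in> S" "h' * z = unif P ^ n * s'" using assms(3) by (auto simp: vge_def)
  have "(h * h') * (y + z) = h' * (h * y) + h * (h' * z)" by (simp add: algebra_simps)
  also have "\<dots> = unif P ^ n * (h' * s + h * s')" unfolding hs(3) hs'(3) by (simp add: algebra_simps)
  finally have "(h * h') * (y + z) = unif P ^ n * (h' * s + h * s')" .
  moreover have "h' * s + h * s' \<in> S" using hs hs' by auto
  ultimately show ?thesis unfolding vge_def using unit_mult[OF P hs(1) hs'(1)] by blast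
qed

lemma frac_mult:
  fixes h h' y z u s s' :: "'a::comm_ring_1"
  assumes "h * y = u ^ m * s" "h' * z = u ^ n * s'"
  shows "(h * h') * (y * z) = u ^ (m + n) * (s * s')"
proof -
  have "(h * h') * (y * z) = (h * y) * (h' * z)" by (simp add: ac_simps)
  also have "\<dots> = u ^ (m + n) * (s * s')" unfolding assms power_add by (simp add: ac_simps)
  finally show ?thesis .
qed

lemma vge_mult:
  assumes P: "P \<in> pts" and "vge P m y" "vge P n z"
  shows "vge P (m + n) (y * z)"
proof -
  obtain h s where hs: "h \<in> S - idl P" "s \<in> S" "h * y = unif P ^ m * s" using assms(2) by (auto simp: vge_def)
  obtain h' s' where hs': "h' \<in> S - idl P" "s' \<in> S" "h' * z = unif P ^ n * s'" using assms(3) by (auto simp: vge_def)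
  show ?thesis unfolding vge_def
    using frac_mult[OF hs(3) hs'(3)] unit_mult[OF P hs(1) hs'(1)] S_closed(8)[OF hs(2) hs'(2)] by blast
qed

lemma vge_mult_S: "P \<in> pts \<Longrightarrow> w \<in> S \<Longrightarrow> vge P n z \<Longrightarrow> vge P n (w * z)"
  using vge_mult[OF _ vge_0] by fastforce

lemma vex_mult:
  assumes P: "P \<in> pts" and "vex P m y" "vex P n z"
  shows "vex P (m + n) (y * z)"
proof -
  obtain h s where hs: "h \<in> S - idl P" "s \<in> S - idl P" "h * y = unif P ^ m * s" using assms(2) by (auto simp: vex_def)
  obtain h' s' where hs': "h' \<in> S - idl P" "s' \<in> S - idl P" "h' * z = unif P ^ n * s'" using assms(3) by (auto simp: vex_def)
  show ?thesis unfolding vex_def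
    using frac_mult[OF hs(3) hs'(3)] unit_mult[OF P hs(1) hs'(1)] unit_mult[OF P hs(2) hs'(2)] by blast
qed

lemma vge_1_iff:
  assumes P: "P \<in> pts" and z: "z \<in> S"
  shows "vge P 1 z \<longleftrightarrow> z \<in> idl P"
proof
  assume "vge P 1 z"
  then obtain h s where hs: "h \<in> S - idl P" "s \<in> S" "h * z = unif P * s" by (auto simp: vge_def)
  then have "h * z \<in> idl P" using S_idealD(5)[OF idl_S_ideal[OF P] unif(1)[OF P]] by simp
  then show "z \<in> idl P" using idl_prime[OF P _ z, of h] hs(1) by blast
next
  assume "z \<in> idl P"
  then show "vge P 1 z" using unif(2)[OF P] unfolding vge_def power_one_right by blast
qed

lemma vex_unit: "P \<in> pts \<Longrightarrow> z \<in> S - idl P \<Longrightarrow> vex P 0 z"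
  unfolding vex_def by (intro bexI[OF _ unit_one] bexI[of _ z]) auto

lemma vex_unif: "P \<in> pts \<Longrightarrow> vex P n (unif P ^ n)"
  unfolding vex_def by (intro bexI[of _ 1]) (auto dest: unit_one)

lemma vex_imp_vge: "vex P n z \<Longrightarrow> vge P n z"
  unfolding vex_def vge_def by blast

lemma vge_cases:
  assumes P: "P \<in> pts" and "vge P n z"
  shows "vex P n z \<or> vge P (Suc n) z"
proof -
  obtain h s where hs: "h \<in> S - idl P" "s \<in> S" "h * z = unif P ^ n * s" using assms(2) by (auto simp: vge_def)
  show ?thesis
  proof (cases "s \<in> idl P")
    case False
    then show ?thesis using hs unfolding vex_def by blast
  next
    case True
    then have "vge P 1 s" using vge_1_iff[OF P hs(2)] by simp
    then obtain h' s' where hs': "h' \<in> S - idl P" "s' \<in> S" "h' * s = unif P * s'" by (auto simp: vge_def)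
    have "(h' * h) * z = unif P ^ Suc n * s'"
    proof -
      have "(h' * h) * z = h' * (h * z)" by (simp add: ac_simps)
      also have "\<dots> = unif P ^ n * (h' * s)" unfolding hs(3) by (simp add: ac_simps)
      finally show ?thesis unfolding hs'(3) by (simp add: ac_simps)
    qed
    then show ?thesis using unit_mult[OF P hs'(1) hs(1)] hs'(2) unfolding vge_def by blast
  qed
qed

lemma vex_vge_iff:
  assumes P: "P \<in> pts" and z: "vex P n z"
  shows "vge P m z \<longleftrightarrow> m \<le> n"
proof
  assume m: "vge P m z"
  show "m \<le> n"
  proof (rule ccontr)
    assume "\<not> m \<le> n"
    then obtain d where d: "m = Suc (n + d)" using less_imp_Suc_add not_le by blast
    obtain h s where hs: "h \<in> S - idl P" "s \<in> S - idl P" "h * z = unif P ^ n * s" using z by (auto simp: vex_def)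
    obtain h' s' where hs': "h' \<in> S - idl P" "s' \<in> S" "h' * z = unif P ^ m * s'" using m by (auto simp: vge_def)
    have "unif P ^ n * (h' * s) = h' * (h * z)" unfolding hs(3) by (simp add: ac_simps)
    also have "\<dots> = h * (h' * z)" by (simp add: ac_simps)
    also have "\<dots> = unif P ^ n * (unif P * (unif P ^ d * h * s'))" unfolding hs'(3) d by (simp add: power_add ac_simps)
    finally have "h' * s = unif P * (unif P ^ d * h * s')" using unif_nonzero[OF P] by simp
    moreover have "unif P * (unif P ^ d * h * s') \<in> idl P"
      using S_idealD(5)[OF idl_S_ideal[OF P] unif(1)[OF P]] hs(1) hs'(2) unif_S[OF P] by auto
    ultimately show False using unit_mult[OF P hs'(1) hs(2)] by simp
  qed
next
  assume "m \<le> n"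
  then show "vge P m z" using vge_mono[OF P vex_imp_vge[OF z]] by simp
qed

subsection \<open>Powers of maximal ideals\<close>

abbreviation pw where "pw P n \<equiv> P [^]\<^bsub>ideals_set R\<^esub> (n :: nat)"

lemma pw_0: "pw P 0 = carrier R" by (simp add: nat_pow_def ideals_set_def)
lemma pw_Suc: "pw P (Suc n) = pw P n \<cdot>\<^bsub>R\<^esub> P" by (simp add: nat_pow_def ideals_set_def)

lemma idl_pw_0: "idl (pw P 0) = S"
  unfolding idl_def pw_0 by auto

lemma pw_ideal: "P \<in> pts \<Longrightarrow> ideal (pw P n) R"
proof (induction n)
  case 0
  interpret cring R by (rule cring_R)
  show ?case unfolding pw_0 by (rule oneideal)
next
  case (Suc n)
  interpret cring R by (rule cring_R)
  show ?case unfolding pw_Suc by (rule ideal_prod_is_ideal[OF Suc.IH[OF Suc.prems] pts_ideal[OF Suc.prems]])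
qed

lemma idl_pw_mult:
  assumes P: "P \<in> pts" and "a \<in> idl (pw P n)" "b \<in> idl P"
  shows "a * b \<in> idl (pw P (Suc n))"
proof -
  have ab: "a \<in> S" "el a \<in> pw P n" "b \<in> S" "el b \<in> P" using assms by (auto simp: idl_def)
  from ideal_prod.prod[OF ab(2,4), of R] have "el a \<otimes>\<^bsub>R\<^esub> el b \<in> pw P (Suc n)" unfolding pw_Suc .
  then show ?thesis using ab by (simp add: idl_def el_mult)
qed

lemma pw_imp_vge:
  assumes P: "P \<in> pts"
  shows "r \<in> pw P n \<Longrightarrow> \<exists>z\<in>S. r = el z \<and> vge P n z"
proof (induction n arbitrary: r)
  case 0
  then show ?case using vge_0[OF P] unfolding pw_0 carrier_R by blast
next
  case (Suc n)
  show ?case using Suc.prems unfolding pw_Suc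
  proof (induction r rule: ideal_prod.induct)
    case (prod i j)
    obtain a where a: "a \<in> S" "i = el a" "vge P n a" using Suc.IH[OF prod(1)] by blast
    obtain b where b: "b \<in> idl P" "j = el b" using prod(2) el_idl[OF pts_ideal[OF P]] by blast
    then have bS: "b \<in> S" by (simp add: idl_def)
    have "vge P (n + 1) (a * b)" using vge_mult[OF P a(3)] vge_1_iff[OF P bS] b(1) by blast
    then show ?case using a b bS by (intro bexI[of _ "a * b"]) (auto simp: el_mult)
  next
    case (sum s1 s2)
    then obtain a b where "a \<in> S" "s1 = el a" "vge P (Suc n) a" "b \<in> S" "s2 = el b" "vge P (Suc n) b" by blast
    then show ?case using vge_add[OF P] by (intro bexI[of _ "a + b"]) (auto simp: el_add)
  qed
qed

text \<open>The converse holds because \<open>P^n\<close> is primary: an element outside \<open>P\<close> is invertible modulo \<open>P^n\<close>.\<close>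

lemma vge_imp_pw:
  assumes P: "P \<in> pts" and z: "z \<in> S" "vge P n z"
  shows "el z \<in> pw P n"
proof -
  obtain h s where hs: "h \<in> S - idl P" "s \<in> S" "h * z = unif P ^ n * s" using z(2) by (auto simp: vge_def)
  note Q = S_idealD[OF S_ideal_idl[OF pw_ideal[OF P]]]
  have u: "unif P ^ j \<in> idl (pw P j)" for j
  proof (induction j)
    case 0
    then show ?case unfolding idl_pw_0 by simp
  next
    case (Suc j)
    then show ?case using idl_pw_mult[OF P Suc unif(1)[OF P]] by (simp only: power_Suc2)
  qed
  have inv: "\<exists>k\<in>S. 1 - h * k \<in> idl (pw P j)" for j
  proof (induction j)
    case 0
    show ?case unfolding idl_pw_0 by (intro bexI[of _ 0]) auto
  next
    case (Suc j)
    then obtain k where k: "k \<in> S" "1 - h * k \<in> idl (pw P j)" by blast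
    obtain l where l: "l \<in> S" "1 - h * l \<in> idl P" using idl_inverse[OF P, of h] hs(1) by blast
    have "(1 - h * k) * (1 - h * l) = 1 - h * (k + l - h * k * l)" by (simp add: algebra_simps)
    moreover have "k + l - h * k * l \<in> S" using k l hs(1) by auto
    ultimately show ?case using idl_pw_mult[OF P k(2) l(2)] by auto
  qed
  obtain k where k: "k \<in> S" "1 - h * k \<in> idl (pw P n)" using inv by blast
  have "z * (1 - h * k) + (k * s) * unif P ^ n = z"
  proof -
    have "(k * s) * unif P ^ n = k * (h * z)" unfolding hs(3) by (simp add: ac_simps)
    then show ?thesis by (simp add: algebra_simps)
  qed
  moreover have "z * (1 - h * k) + (k * s) * unif P ^ n \<in> idl (pw P n)"
    by (rule Q(3)[OF Q(4)[OF z(1) k(2)] Q(4)[OF S_closed(8)[OF k(1) hs(2)] u]])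
  ultimately show ?thesis by (simp add: idl_def)
qed

lemma pw_iff_vge: "P \<in> pts \<Longrightarrow> z \<in> S \<Longrightarrow> el z \<in> pw P n \<longleftrightarrow> vge P n z"
  using pw_imp_vge[of P "el z" n] vge_imp_pw[of P z n] by auto

section \<open>Effective divisors\<close>

text \<open>The ideal \<open>I_D\<close> of the effective divisor \<open>D\<close> with the multiplicities \<open>\<delta>\<close>.\<close>

definition ID :: "('k poly poly set set \<Rightarrow> nat) \<Rightarrow> 'k fls set" where
  "ID \<delta> = {z \<in> S. \<forall>P\<in>pts. vge P (\<delta> P) z}"

definition rdeg :: "'k poly poly set set \<Rightarrow> nat" where
  "rdeg P = (THE n. rel_dim S (idl P) n)"

definition supp :: "('k poly poly set set \<Rightarrow> nat) \<Rightarrow> 'k poly poly set set set" where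
  "supp \<delta> = {P \<in> pts. \<delta> P \<noteq> 0}"

definition edeg :: "('k poly poly set set \<Rightarrow> nat) \<Rightarrow> nat" where
  "edeg \<delta> = (\<Sum>P\<in>supp \<delta>. \<delta> P * rdeg P)"

lemma ID_S_ideal: "S_ideal (ID \<delta>)"
  unfolding S_ideal_def ID_def by (auto intro: vge_zero vge_add vge_mult_S)

lemma ID_mono: "(\<And>P. P \<in> pts \<Longrightarrow> \<delta> P \<le> \<epsilon> P) \<Longrightarrow> ID \<epsilon> \<subseteq> ID \<delta>"
  unfolding ID_def using vge_mono by blast

lemma rdeg: "P \<in> pts \<Longrightarrow> rel_dim S (idl P) (rdeg P)"
proof -
  assume P: "P \<in> pts"
  obtain r where "r \<in> idl P" "r \<noteq> 0" using idl_nonzero[OF P] by blast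
  from rel_dim_exists[OF idl_S_ideal[OF P] this] obtain n where n: "rel_dim S (idl P) n" by blast
  have "rdeg P = n" unfolding rdeg_def
    by (rule the_equality[where P = "rel_dim S (idl P)", OF n])
      (rule rel_dim_unique[OF S_ideal_subspace[OF idl_S_ideal[OF P]] _ n])
  then show ?thesis using n by simp
qed

lemma rdeg_pos: "P \<in> pts \<Longrightarrow> 0 < rdeg P"
proof (rule ccontr)
  assume P: "P \<in> pts" and "\<not> 0 < rdeg P"
  then have "rel_dim S (idl P) 0" using rdeg by fastforce
  then obtain B where B: "finite B" "card B = 0" "spans_mod (idl P) B S" by (auto simp: rel_dim_def)
  then have "B = {}" by simp
  then have "\<exists>t\<in>kspan {}. 1 - t \<in> idl P" using B(3) unfolding spans_mod_def by auto
  then show False using idl_proper[OF P] by (simp add: V.span_empty)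
qed

lemma edeg_eq_sum:
  assumes "finite A" "supp \<delta> \<subseteq> A" "A \<subseteq> pts"
  shows "edeg \<delta> = (\<Sum>P\<in>A. \<delta> P * rdeg P)"
  unfolding edeg_def by (rule sum.mono_neutral_left[OF assms(1,2)]) (use assms(3) in \<open>auto simp: supp_def\<close>)

lemma idl_not_subset:
  assumes "P \<in> pts" "Q \<in> pts" "P \<noteq> Q"
  shows "\<exists>g\<in>idl Q. g \<notin> idl P"
proof (rule ccontr)
  assume "\<not> (\<exists>g\<in>idl Q. g \<notin> idl P)"
  then have sub: "idl Q \<subseteq> idl P" by blast
  have "idl P \<subseteq> idl Q"
  proof
    fix h assume h: "h \<in> idl P"
    show "h \<in> idl Q"
    proof (rule ccontr)
      assume "h \<notin> idl Q"
      moreover have "h \<in> S" using h by (simp add: idl_def)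
      ultimately obtain k where k: "k \<in> S" "1 - h * k \<in> idl Q" using idl_inverse[OF assms(2)] by blast
      note I = S_idealD[OF idl_S_ideal[OF assms(1)]]
      have "(1 - h * k) + h * k \<in> idl P" by (rule I(3)[OF subsetD[OF sub k(2)] I(5)[OF h k(1)]])
      then show False using idl_proper[OF assms(1)] by simp
    qed
  qed
  then have "idl P = idl Q" using sub by blast
  then have "el ` idl P = el ` idl Q" by (rule arg_cong)
  then have "P = Q" unfolding el_idl[OF pts_ideal[OF assms(1)]] el_idl[OF pts_ideal[OF assms(2)]] .
  then show False using assms(3) by simp
qed

lemma vge_power: "P \<in> pts \<Longrightarrow> vge P 1 g \<Longrightarrow> vge P n (g ^ n)"
proof (induction n)
  case 0
  then show ?case using vge_0[of P 1] by simp
next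
  case (Suc n)
  then show ?case using vge_mult[of P 1 g n "g ^ n"] by simp
qed

lemma avoid_point:
  assumes P: "P \<in> pts" and A: "finite A" "A \<subseteq> pts" "P \<notin> A"
  shows "\<exists>w\<in>S - idl P. \<forall>Q\<in>A. vge Q (\<delta> Q) w"
  using A
proof (induction A rule: finite_induct)
  case empty
  then show ?case using unit_one[OF P] by blast
next
  case (insert Q A)
  then obtain w where w: "w \<in> S - idl P" "\<forall>Q\<in>A. vge Q (\<delta> Q) w" by auto
  have Q: "Q \<in> pts" "P \<noteq> Q" using insert by auto
  obtain g where g: "g \<in> idl Q" "g \<notin> idl P" using idl_not_subset[OF P Q] by blast
  have gS: "g \<in> S" using g by (simp add: idl_def)
  have gP: "g ^ n \<in> S - idl P" for n
    by (induction n) (use unit_one[OF P] unit_mult[OF P, of g] gS g(2) in auto)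
  have "vge Q (\<delta> Q) (g ^ \<delta> Q)" using vge_power[OF Q(1)] vge_1_iff[OF Q(1) gS] g(1) by simp
  then have "vge Q (\<delta> Q) (w * g ^ \<delta> Q)" using vge_mult_S[OF Q(1)] w(1) by simp
  moreover have "vge Q' (\<delta> Q') (w * g ^ \<delta> Q)" if "Q' \<in> A" for Q'
    using vge_mult_S[of Q' "g ^ \<delta> Q" "\<delta> Q'" w] w(2) that insert.prems gS by (auto simp: mult.commute)
  ultimately show ?case using unit_mult[OF P w(1) gP] by (intro bexI[of _ "w * g ^ \<delta> Q"]) auto
qed

text \<open>A power of the uniformizer at \<open>P\<close> has the order that is wanted at \<open>P\<close>; multiplication by a function that does
  not vanish at \<open>P\<close> corrects the other points.\<close>

lemma exact_element:
  assumes P: "P \<in> pts" and fin: "finite (supp \<delta>)"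
  shows "\<exists>w\<in>ID \<delta>. vex P (\<delta> P) w"
proof -
  obtain g where g: "g \<in> S - idl P" "\<forall>Q\<in>supp \<delta> - {P}. vge Q (\<delta> Q) g"
    using avoid_point[OF P, of "supp \<delta> - {P}" \<delta>] fin by (auto simp: supp_def)
  let ?w = "g * unif P ^ \<delta> P"
  have S: "?w \<in> S" using g(1) unif_S[OF P] by auto
  have ex: "vex P (\<delta> P) ?w" using vex_mult[OF P vex_unit[OF P g(1)] vex_unif[OF P]] by simp
  have "vge Q (\<delta> Q) ?w" if Q: "Q \<in> pts" for Q
  proof (cases "Q = P")
    case True
    then show ?thesis using vex_imp_vge[OF ex] by simp
  next
    case False
    then have "vge Q (\<delta> Q) g" using g vge_0[OF Q, of g] Q by (cases "\<delta> Q = 0") (auto simp: supp_def)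
    then show ?thesis using vge_mult_S[OF Q, of "unif P ^ \<delta> P"] unif_S[OF P] by (simp add: mult.commute)
  qed
  then show ?thesis using S ex unfolding ID_def by blast
qed

text \<open>Multiplication by an element of exact order \<open>\<delta> P\<close> at \<open>P\<close> identifies \<open>S / P\<close> with \<open>I\<^sub>\<delta> / I\<^bsub>\<delta> + P\<^esub>\<close>.\<close>

lemma rel_dim_add_point:
  assumes P: "P \<in> pts" and fin: "finite (supp \<delta>)"
  shows "rel_dim (ID \<delta>) (ID (\<delta>(P := Suc (\<delta> P)))) (rdeg P)"
proof -
  let ?\<delta> = "\<delta>(P := Suc (\<delta> P))" and ?n = "\<delta> P"
  obtain w where w: "w \<in> ID \<delta>" "vex P ?n w" using exact_element[OF P fin] by blast
  note I = S_idealD[OF ID_S_ideal]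
  have mem: "z \<in> ID ?\<delta> \<longleftrightarrow> z \<in> ID \<delta> \<and> vge P (Suc ?n) z" for z
    using vge_mono[OF P, of "Suc ?n" z ?n] P by (auto simp: ID_def)
  show ?thesis
  proof (rule rel_dim_mult[OF S_ideal_subspace[OF idl_S_ideal[OF P]] rdeg[OF P], where w = w])
    fix z assume z: "z \<in> S"
    show wz: "w * z \<in> ID \<delta>" by (rule I(5)[OF w(1) z])
    show "w * z \<in> ID ?\<delta> \<longleftrightarrow> z \<in> idl P"
    proof
      assume "w * z \<in> ID ?\<delta>"
      then have v: "vge P (Suc ?n) (w * z)" using mem by simp
      show "z \<in> idl P"
      proof (rule ccontr)
        assume "z \<notin> idl P"
        then have "vex P ?n (w * z)" using vex_mult[OF P w(2) vex_unit[OF P]] z by simp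
        then show False using vex_vge_iff[OF P] v by fastforce
      qed
    next
      assume "z \<in> idl P"
      then have "vge P (?n + 1) (w * z)" using vge_mult[OF P vex_imp_vge[OF w(2)]] vge_1_iff[OF P z] by blast
      then show "w * z \<in> ID ?\<delta>" using mem wz by simp
    qed
  next
    fix z' assume z': "z' \<in> ID \<delta>"
    then have "vge P ?n z'" using P by (simp add: ID_def)
    then obtain h' s' where hs': "h' \<in> S - idl P" "s' \<in> S" "h' * z' = unif P ^ ?n * s'" by (auto simp: vge_def)
    obtain h s where hs: "h \<in> S - idl P" "s \<in> S - idl P" "h * w = unif P ^ ?n * s" using w(2) by (auto simp: vex_def)
    obtain i where i: "i \<in> S" "1 - (s * h') * i \<in> idl P"
      using idl_inverse[OF P, of "s * h'"] unit_mult[OF P hs(2) hs'(1)] by blast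
    \<comment> \<open>Locally \<open>w\<close> and \<open>z'\<close> are \<open>s/h\<close> and \<open>s'/h'\<close> times the same power of the uniformizer, and \<open>?k\<close> is their quotient
      modulo \<open>P\<close>, where \<open>i\<close> inverts \<open>s h'\<close>.\<close>
    let ?k = "i * h * s'"
    have kS: "?k \<in> S" using i hs hs' by auto
    have d: "z' - w * ?k \<in> ID \<delta>" by (rule I(7)[OF z' I(5)[OF w(1) kS]])
    have "(h * h') * (z' - w * ?k) = h * (h' * z') - h' * ?k * (h * w)" by (simp add: algebra_simps)
    also have "\<dots> = unif P ^ ?n * ((h * s') * (1 - (s * h') * i))" unfolding hs(3) hs'(3) by (simp add: algebra_simps)
    finally have e: "(h * h') * (z' - w * ?k) = unif P ^ ?n * ((h * s') * (1 - (s * h') * i))" .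
    have "(h * s') * (1 - (s * h') * i) \<in> idl P"
      using S_idealD(4)[OF idl_S_ideal[OF P] _ i(2)] hs hs' by blast
    then have "vge P 1 ((h * s') * (1 - (s * h') * i))" using vge_1_iff[OF P] S_idealD(8)[OF idl_S_ideal[OF P]] by blast
    then obtain h2 s2 where hs2: "h2 \<in> S - idl P" "s2 \<in> S" "h2 * ((h * s') * (1 - (s * h') * i)) = unif P * s2"
      unfolding vge_def power_one_right by blast
    have "(h2 * (h * h')) * (z' - w * ?k) = h2 * ((h * h') * (z' - w * ?k))" by (simp only: ac_simps)
    also have "\<dots> = unif P ^ ?n * (h2 * ((h * s') * (1 - (s * h') * i)))" unfolding e by (simp only: ac_simps)
    also have "\<dots> = unif P ^ Suc ?n * s2" unfolding hs2(3) by (simp add: ac_simps)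
    finally have "vge P (Suc ?n) (z' - w * ?k)"
      using unit_mult[OF P hs2(1) unit_mult[OF P hs(1) hs'(1)]] hs2(2) unfolding vge_def by blast
    then show "\<exists>y\<in>S. z' - w * y \<in> ID ?\<delta>" using d kS mem by blast
  qed (rule S_ideal_subspace[OF ID_S_ideal] S_subspace)+
qed

text \<open>Induction on the number of points counted with multiplicity; each step raises the multiplicity of one point.\<close>

lemma rel_dim_ID:
  assumes "finite (supp \<delta>)"
  shows "rel_dim S (ID \<delta>) (edeg \<delta>)"
proof -
  have "\<forall>\<delta>. finite (supp \<delta>) \<longrightarrow> (\<Sum>P\<in>supp \<delta>. \<delta> P) = n \<longrightarrow> rel_dim S (ID \<delta>) (edeg \<delta>)" for n
  proof (induction n)
    case 0
    show ?case
    proof (intro allI impI)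
      fix \<delta> :: "'k poly poly set set \<Rightarrow> nat" assume f: "finite (supp \<delta>)" and s: "(\<Sum>P\<in>supp \<delta>. \<delta> P) = 0"
      have "supp \<delta> = {}" using f s by (auto simp: supp_def)
      then have "ID \<delta> = S" "edeg \<delta> = 0" using vge_0 by (auto simp: ID_def edeg_def supp_def)
      then show "rel_dim S (ID \<delta>) (edeg \<delta>)"
        unfolding rel_dim_def by (intro exI[of _ "{}"]) (auto simp: indep_mod_def spans_mod_def V.span_empty)
    qed
  next
    case (Suc n)
    show ?case
    proof (intro allI impI)
      fix \<delta> :: "'k poly poly set set \<Rightarrow> nat" assume f: "finite (supp \<delta>)" and s: "(\<Sum>P\<in>supp \<delta>. \<delta> P) = Suc n"
      then have "supp \<delta> \<noteq> {}" by auto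
      then obtain P where P: "P \<in> supp \<delta>" by blast
      then have Pp: "P \<in> pts" "\<delta> P \<noteq> 0" by (auto simp: supp_def)
      let ?e = "\<delta>(P := \<delta> P - 1)"
      have sub: "supp ?e \<subseteq> supp \<delta>" by (auto simp: supp_def)
      then have fe: "finite (supp ?e)" using f finite_subset by blast
      have "(\<Sum>Q\<in>supp ?e. ?e Q) = (\<Sum>Q\<in>supp \<delta>. ?e Q)" by (rule sum.mono_neutral_left[OF f sub]) (auto simp: supp_def)
      also have "\<dots> = (\<delta> P - 1) + (\<Sum>Q\<in>supp \<delta> - {P}. \<delta> Q)" using f P by (subst sum.remove[OF f P]) simp
      finally have "(\<Sum>Q\<in>supp ?e. ?e Q) = n" using s Pp(2) sum.remove[OF f P, of \<delta>] by simp
      then have e: "rel_dim S (ID ?e) (edeg ?e)" using Suc fe by blast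
      have up: "?e(P := Suc (?e P)) = \<delta>" using Pp(2) by (auto simp: fun_eq_iff)
      have d: "rel_dim (ID ?e) (ID \<delta>) (rdeg P)" using rel_dim_add_point[OF Pp(1) fe] unfolding up .
      have "ID \<delta> \<subseteq> ID ?e" by (rule ID_mono) simp
      then have "rel_dim S (ID \<delta>) (edeg ?e + rdeg P)"
        by (rule rel_dim_trans[OF S_ideal_subspace[OF ID_S_ideal] S_ideal_subspace[OF ID_S_ideal] _ S_idealD(1)[OF ID_S_ideal] e d])
      moreover have "edeg \<delta> = edeg ?e + rdeg P"
      proof -
        have A: "supp \<delta> \<subseteq> pts" by (auto simp: supp_def)
        have "edeg ?e = (\<Sum>Q\<in>supp \<delta>. ?e Q * rdeg Q)" by (rule edeg_eq_sum[OF f sub A])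
        also have "\<dots> = (\<delta> P - 1) * rdeg P + (\<Sum>Q\<in>supp \<delta> - {P}. \<delta> Q * rdeg Q)" by (subst sum.remove[OF f P]) simp
        finally have 1: "edeg ?e = (\<delta> P - 1) * rdeg P + (\<Sum>Q\<in>supp \<delta> - {P}. \<delta> Q * rdeg Q)" .
        have 2: "edeg \<delta> = \<delta> P * rdeg P + (\<Sum>Q\<in>supp \<delta> - {P}. \<delta> Q * rdeg Q)"
          unfolding edeg_def by (rule sum.remove[OF f P])
        have 3: "(k - 1) * rdeg P + rdeg P = k * rdeg P" if "k \<noteq> 0" for k using that by (cases k) simp_all
        show ?thesis unfolding 1 2 using 3[OF Pp(2)] by linarith
      qed
      ultimately show "rel_dim S (ID \<delta>) (edeg \<delta>)" by simp
    qed
  qed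
  then show ?thesis using assms by blast
qed

section \<open>The divisor of a function\<close>

text \<open>The ideal \<open>ID \<delta>\<close> contains \<open>z S\<close>, whose codimension is the pole order of \<open>z\<close>.\<close>

lemma edeg_le_degree:
  assumes "finite (supp \<delta>)" "z \<in> ID \<delta>" "z \<noteq> 0"
  shows "edeg \<delta> \<le> nat (- fls_subdegree z)"
proof -
  obtain n where n: "rel_dim S (ID \<delta>) n" "n \<le> nat (- fls_subdegree z)"
    using rel_dim_exists[OF ID_S_ideal assms(2,3)] by blast
  then show ?thesis using rel_dim_unique[OF S_ideal_subspace[OF ID_S_ideal] rel_dim_ID[OF assms(1)] n(1)] by simp
qed

text \<open>A function vanishing to every order at \<open>P\<close> would vanish on divisors of unbounded degree.\<close>

lemma vex_exists:
  assumes P: "P \<in> pts" and z: "z \<in> S" "z \<noteq> 0"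
  shows "\<exists>n. vex P n z"
proof (rule ccontr)
  assume no: "\<nexists>n. vex P n z"
  have all: "vge P n z" for n
  proof (induction n)
    case 0 then show ?case by (rule vge_0[OF P z(1)])
  next
    case (Suc n) then show ?case using vge_cases[OF P] no by blast
  qed
  let ?N = "Suc (nat (- fls_subdegree z))"
  let ?d = "(\<lambda>_. 0)(P := ?N)"
  have s: "supp ?d = {P}" using P by (auto simp: supp_def)
  have "z \<in> ID ?d" using z all vge_0 by (auto simp: ID_def)
  then have "edeg ?d \<le> nat (- fls_subdegree z)" using edeg_le_degree[of ?d z] z s by simp
  moreover have "edeg ?d = ?N * rdeg P" by (simp add: edeg_def s)
  moreover have "?N * 1 \<le> ?N * rdeg P" using rdeg_pos[OF P] by (intro mult_le_mono2) simp
  ultimately show False by simp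
qed

definition vord :: "'k poly poly set set \<Rightarrow> 'k fls \<Rightarrow> nat" where
  "vord P z = (THE n. vex P n z)"

lemma vex_iff_vord:
  assumes "P \<in> pts" "z \<in> S" "z \<noteq> 0"
  shows "vex P n z \<longleftrightarrow> n = vord P z"
proof -
  obtain m where m: "vex P m z" using vex_exists[OF assms] by blast
  have uniq: "n = m" if "vex P n z" for n
    using vex_vge_iff[OF assms(1) m] vex_vge_iff[OF assms(1) that] by (metis dual_order.refl le_antisym)
  then have "vord P z = m" unfolding vord_def using m by blast
  then show ?thesis using m uniq by blast
qed

lemma vge_iff_vord: "P \<in> pts \<Longrightarrow> z \<in> S \<Longrightarrow> z \<noteq> 0 \<Longrightarrow> vge P n z \<longleftrightarrow> n \<le> vord P z"
  using vex_vge_iff vex_iff_vord by blast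

lemma vord_mult:
  assumes "P \<in> pts" "a \<in> S" "a \<noteq> 0" "b \<in> S" "b \<noteq> 0"
  shows "vord P (a * b) = vord P a + vord P b"
  using vex_mult[OF assms(1), of "vord P a" a "vord P b" b] assms vex_iff_vord[of P "a * b"] vex_iff_vord[of P a] vex_iff_vord[of P b]
  by simp

lemma ID_iff_vord: "z \<in> S \<Longrightarrow> z \<noteq> 0 \<Longrightarrow> z \<in> ID \<delta> \<longleftrightarrow> (\<forall>P\<in>pts. \<delta> P \<le> vord P z)"
  by (simp add: ID_def vge_iff_vord)

abbreviation dv :: "'k fls \<Rightarrow> 'k poly poly set set \<Rightarrow> nat" where "dv z \<equiv> \<lambda>P. vord P z"

lemma finite_supp_dv:
  assumes z: "z \<in> S" "z \<noteq> 0"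
  shows "finite (supp (dv z))"
proof (rule ccontr)
  assume "infinite (supp (dv z))"
  then obtain A where A: "finite A" "card A = Suc (nat (- fls_subdegree z))" "A \<subseteq> supp (dv z)"
    using infinite_arbitrarily_large by blast
  let ?d = "\<lambda>P. if P \<in> A then 1 else 0 :: nat"
  have Ap: "A \<subseteq> pts" using A(3) by (auto simp: supp_def)
  have s: "supp ?d = A" using Ap by (auto simp: supp_def)
  have "z \<in> ID ?d" unfolding ID_iff_vord[OF z] using A(3) by (auto simp: supp_def)
  then have "edeg ?d \<le> nat (- fls_subdegree z)" using edeg_le_degree[of ?d z] z s A(1) by simp
  moreover have "(\<Sum>P\<in>A. 1) \<le> (\<Sum>P\<in>A. ?d P * rdeg P)"
    using Ap rdeg_pos by (intro sum_mono) (auto simp: Suc_leI)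
  then have "card A \<le> edeg ?d" unfolding edeg_def s by simp
  ultimately show False using A(2) by simp
qed

text \<open>Divisibility by \<open>z\<close> can be tested locally: the \<open>k\<close> with \<open>k y \<in> z S\<close> form an ideal which, when \<open>y\<close> has the
  required orders, lies in no maximal ideal.\<close>

lemma ID_dv:
  assumes z: "z \<in> S" "z \<noteq> 0"
  shows "ID (dv z) = (*) z ` S"
proof
  have "z \<in> ID (dv z)" using ID_iff_vord[OF z] by simp
  then show "(*) z ` S \<subseteq> ID (dv z)" using S_idealD(5)[OF ID_S_ideal] by blast
  show "ID (dv z) \<subseteq> (*) z ` S"
  proof
    fix y assume y: "y \<in> ID (dv z)"
    let ?J = "{k \<in> S. \<exists>s\<in>S. k * y = z * s}"
    have "S_ideal ?J"
      unfolding S_ideal_def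
    proof (intro conjI ballI)
      show "?J \<subseteq> S" by blast
      show "0 \<in> ?J" by (auto intro!: bexI[of _ 0])
      fix a b assume b: "b \<in> ?J"
      then obtain s where s: "b \<in> S" "s \<in> S" "b * y = z * s" by blast
      show "a * b \<in> ?J" if "a \<in> S"
        using s that by (auto intro!: bexI[of _ "a * s"] simp: mult.assoc mult.left_commute)
      show "a + b \<in> ?J" if a: "a \<in> ?J"
      proof -
        obtain s' where s': "a \<in> S" "s' \<in> S" "a * y = z * s'" using a by blast
        then show ?thesis using s by (auto intro!: bexI[of _ "s' + s"] simp: algebra_simps)
      qed
    qed
    moreover have "\<not> ?J \<subseteq> idl P" if P: "P \<in> pts" for P
    proof
      assume J: "?J \<subseteq> idl P"
      have "vge P (vord P z) y" using y P by (simp add: ID_def)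
      then obtain h' s' where hs': "h' \<in> S - idl P" "s' \<in> S" "h' * y = unif P ^ vord P z * s'" by (auto simp: vge_def)
      have "vex P (vord P z) z" using vex_iff_vord[OF P z] by simp
      then obtain h s where hs: "h \<in> S - idl P" "s \<in> S - idl P" "h * z = unif P ^ vord P z * s" by (auto simp: vex_def)
      have "(s * h') * y = s * (h' * y)" by (simp add: ac_simps)
      also have "\<dots> = (h * z) * s'" unfolding hs(3) hs'(3) by (simp add: ac_simps)
      finally have "(s * h') * y = z * (h * s')" by (simp add: ac_simps)
      then have "s * h' \<in> ?J" using hs hs' by blast
      then show False using J unit_mult[OF P hs(2) hs'(1)] by blast
    qed
    ultimately have "1 \<in> ?J" using S_ideal_in_pts by blast
    then show "y \<in> (*) z ` S" by auto
  qed
qed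

text \<open>A function has as many zeros as poles, because both numbers are the codimension of \<open>z S\<close>.\<close>

lemma edeg_dv:
  assumes z: "z \<in> S" "z \<noteq> 0"
  shows "int (edeg (dv z)) = - fls_subdegree z"
proof -
  have "rel_dim S (ID (dv z)) (nat (- fls_subdegree z))" unfolding ID_dv[OF z] by (rule rel_dim_principal[OF z])
  from rel_dim_unique[OF S_ideal_subspace[OF ID_S_ideal] rel_dim_ID[OF finite_supp_dv[OF z]] this]
  show ?thesis using S_subdegree[OF z] by (simp add: pole_orders_def)
qed

end

section \<open>Residue degrees\<close>

context c34
begin

text \<open>Induction along \<open>bs\<close>: by independence modulo \<open>P\<close> each member extends the span by a line.\<close>

lemma residue_dimension:
  assumes P: "P \<in> pts" and bs: "distinct bs" "set bs \<subseteq> S" "indep_mod (idl P) (set bs)"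
  defines "\<phi> \<equiv> \<lambda>z. P +>\<^bsub>R\<^esub> el z"
  shows "ring.dimension (R Quot P) (length bs) (\<phi> ` range fls_const) (\<phi> ` kspan (set bs))"
proof -
  note id = pts_ideal[OF P]
  interpret Q: ring "R Quot P" by (rule ideal.quotient_is_ring[OF id])
  note hom = ideal.rcos_ring_hom[OF id]
  have mult: "\<phi> a \<otimes>\<^bsub>R Quot P\<^esub> \<phi> b = \<phi> (a * b)" if "a \<in> S" "b \<in> S" for a b
    unfolding \<phi>_def by (simp only: ring_hom_mult[OF hom el_carrier[OF that(1)] el_carrier[OF that(2)], symmetric] el_mult[OF that])
  have add: "\<phi> a \<oplus>\<^bsub>R Quot P\<^esub> \<phi> b = \<phi> (a + b)" if "a \<in> S" "b \<in> S" for a b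
    unfolding \<phi>_def by (simp only: ring_hom_add[OF hom el_carrier[OF that(1)] el_carrier[OF that(2)], symmetric] el_add[OF that])
  have carr: "\<phi> a \<in> carrier (R Quot P)" if "a \<in> S" for a
    using ring_hom_closed[OF hom] that by (simp add: \<phi>_def)
  interpret R: cring R by (rule cring_R)
  have eq: "\<phi> a = \<phi> b \<longleftrightarrow> a - b \<in> idl P" if "a \<in> S" "b \<in> S" for a b
    using R.quotient_eq_iff_same_a_r_cos[OF id, of "el a" "el b"] that by (simp add: \<phi>_def el_minus idl_def)
  have zero: "\<zero>\<^bsub>R Quot P\<^esub> = \<phi> 0"
    using R.a_rcos_zero[OF id, of "el 0"] additive_subgroup.zero_closed[OF ideal.axioms(1)[OF id]]
    unfolding \<phi>_def el_zero by (simp add: FactRing_def)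
  have spanS: "kspan A \<subseteq> S" if "A \<subseteq> S" for A using S_span[OF that] .
  show ?thesis using bs
  proof (induction bs)
    case Nil
    then show ?case using Q.zero_dim[of "\<phi> ` range fls_const"] by (simp add: V.span_empty zero)
  next
    case (Cons b bs)
    have b: "b \<in> S" "b \<notin> set bs" "set bs \<subseteq> S" using Cons.prems by auto
    have sub: "indep_mod (idl P) (set bs)"
      unfolding indep_mod_def
    proof (intro allI impI)
      fix a assume a: "(\<Sum>x\<in>set bs. fls_const (a x) * x) \<in> idl P"
      have "(\<Sum>x\<in>set (b # bs). fls_const ((a(b := 0)) x) * x) = (\<Sum>x\<in>set bs. fls_const (a x) * x)"
        using b(2) by (auto intro!: sum.cong)
      then have "(\<Sum>x\<in>set (b # bs). fls_const ((a(b := 0)) x) * x) \<in> idl P" using a by simp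
      then have "\<forall>x\<in>set (b # bs). (a(b := 0)) x = 0" using Cons.prems(3) unfolding indep_mod_def by blast
      then show "\<forall>x\<in>set bs. a x = 0" using b(2) by (metis fun_upd_apply list.set_intros(2))
    qed
    have IH: "Q.dimension (length bs) (\<phi> ` range fls_const) (\<phi> ` kspan (set bs))"
      using Cons.IH Cons.prems sub by simp
    have notin: "\<phi> b \<notin> \<phi> ` kspan (set bs)"
    proof
      assume "\<phi> b \<in> \<phi> ` kspan (set bs)"
      then obtain t where t: "t \<in> kspan (set bs)" "\<phi> b = \<phi> t" by blast
      then have bt: "b - t \<in> idl P" using eq[of b t] b spanS[OF b(3)] by blast
      obtain u where u: "t = (\<Sum>x\<in>set bs. fls_const (u x) * x)" using t(1) by (auto simp: V.span_finite)
      let ?a = "(\<lambda>x. - u x)(b := 1)"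
      have "(\<Sum>x\<in>set (b # bs). fls_const (?a x) * x) = b + (\<Sum>x\<in>set bs. fls_const (- u x) * x)"
      proof -
        have "(\<Sum>x\<in>set bs. fls_const (?a x) * x) = (\<Sum>x\<in>set bs. fls_const (- u x) * x)"
          using b(2) by (intro sum.cong) auto
        then show ?thesis using b(2) by simp
      qed
      also have "\<dots> = b - t" unfolding u by (simp add: sum_negf)
      finally have "(\<Sum>x\<in>set (b # bs). fls_const (?a x) * x) \<in> idl P" using bt by simp
      then have "\<forall>x\<in>set (b # bs). ?a x = 0" using Cons.prems(3) unfolding indep_mod_def by blast
      then show False by simp
    qed
    have "Q.line_extension (\<phi> ` range fls_const) (\<phi> b) (\<phi> ` kspan (set bs)) = \<phi> ` kspan (set (b # bs))"
    proof (intro equalityI subsetI)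
      fix z assume "z \<in> Q.line_extension (\<phi> ` range fls_const) (\<phi> b) (\<phi> ` kspan (set bs))"
      then obtain k t where kt: "t \<in> kspan (set bs)" "z = \<phi> (fls_const k) \<otimes>\<^bsub>R Quot P\<^esub> \<phi> b \<oplus>\<^bsub>R Quot P\<^esub> \<phi> t"
        unfolding Q.line_extension_mem_iff by blast
      have tS: "t \<in> S" using kt(1) spanS[OF b(3)] by blast
      have "z = \<phi> (fls_const k * b + t)" unfolding kt(2) using b(1) tS by (simp add: mult add)
      moreover have "fls_const k * b + t \<in> kspan (set (b # bs))"
        using kt(1) V.span_mono[of "set bs" "set (b # bs)"]
        by (intro V.span_add[OF V.span_scale[OF V.span_base]]) auto
      ultimately show "z \<in> \<phi> ` kspan (set (b # bs))" by blast
    next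
      fix z assume "z \<in> \<phi> ` kspan (set (b # bs))"
      then obtain w where w: "w \<in> kspan (insert b (set bs))" "z = \<phi> w" by auto
      then obtain k where k: "w - fls_const k * b \<in> kspan (set bs)" using V.span_breakdown_eq by blast
      have tS: "w - fls_const k * b \<in> S" using k spanS[OF b(3)] by blast
      have "z = \<phi> (fls_const k * b + (w - fls_const k * b))" unfolding w(2) by simp
      also have "\<dots> = \<phi> (fls_const k) \<otimes>\<^bsub>R Quot P\<^esub> \<phi> b \<oplus>\<^bsub>R Quot P\<^esub> \<phi> (w - fls_const k * b)"
        using add[OF _ tS, of "fls_const k * b"] mult[of "fls_const k" b] b(1) by simp
      finally show "z \<in> Q.line_extension (\<phi> ` range fls_const) (\<phi> b) (\<phi> ` kspan (set bs))"
        unfolding Q.line_extension_mem_iff using k by blast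
    qed
    then show ?case using Q.Suc_dim[OF carr[OF b(1)] notin IH] by simp
  qed
qed

lemma residue_degree_eq:
  assumes P: "P \<in> pts"
  shows "residue_degree c P = rdeg P"
proof -
  note id = pts_ideal[OF P]
  let ?Q = "R Quot P"
  define \<phi> where "\<phi> = (\<lambda>z. P +>\<^bsub>R\<^esub> el z)"
  have mx: "maximalideal P R" using P by (simp add: pts_def)
  interpret R: cring R by (rule cring_R)
  interpret Q: field ?Q by (rule maximalideal.quotient_is_field[OF mx cring_R])
  note hom = ideal.rcos_ring_hom[OF id]
  have mult: "\<phi> a \<otimes>\<^bsub>?Q\<^esub> \<phi> b = \<phi> (a * b)" if "a \<in> S" "b \<in> S" for a b
    unfolding \<phi>_def by (simp only: ring_hom_mult[OF hom el_carrier[OF that(1)] el_carrier[OF that(2)], symmetric] el_mult[OF that])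
  have add: "\<phi> a \<oplus>\<^bsub>?Q\<^esub> \<phi> b = \<phi> (a + b)" if "a \<in> S" "b \<in> S" for a b
    unfolding \<phi>_def by (simp only: ring_hom_add[OF hom el_carrier[OF that(1)] el_carrier[OF that(2)], symmetric] el_add[OF that])
  have carr: "\<phi> a \<in> carrier ?Q" if "a \<in> S" for a
    using ring_hom_closed[OF hom] that by (simp add: \<phi>_def)
  have one: "\<phi> 1 = \<one>\<^bsub>?Q\<^esub>" using ring_hom_one[OF hom] by (simp add: \<phi>_def el_one)
  have zero: "\<phi> 0 = \<zero>\<^bsub>?Q\<^esub>"
  proof -
    have "\<phi> 0 \<oplus>\<^bsub>?Q\<^esub> \<phi> 0 = \<phi> 0" using add[of 0 0] by simp
    then show ?thesis using carr[of 0] by simp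
  qed
  have eq: "\<phi> a = \<phi> b \<longleftrightarrow> a - b \<in> idl P" if "a \<in> S" "b \<in> S" for a b
    using R.quotient_eq_iff_same_a_r_cos[OF id, of "el a" "el b"] that by (simp add: \<phi>_def el_minus idl_def)
  have carrier: "carrier ?Q = \<phi> ` S"
    by (auto simp: FactRing_def A_RCOSETS_def' \<phi>_def carrier_R)
  let ?K = "\<phi> ` range fls_const"
  have K: "subfield ?K ?Q"
  proof (rule Q.subfieldI')
    show "subring ?K ?Q"
    proof (rule Q.subringI)
      show "?K \<subseteq> carrier ?Q" using carr by auto
      show "\<one>\<^bsub>?Q\<^esub> \<in> ?K" unfolding one[symmetric] by (metis fls_const_1 imageI rangeI)
      fix u v assume "u \<in> ?K" "v \<in> ?K"
      then obtain a b where ab: "u = \<phi> (fls_const a)" "v = \<phi> (fls_const b)" by blast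
      have "u \<otimes>\<^bsub>?Q\<^esub> v = \<phi> (fls_const (a * b))"
        unfolding ab mult[OF S_closed(5) S_closed(5)] fls_const_mult_const ..
      then show "u \<otimes>\<^bsub>?Q\<^esub> v \<in> ?K" by blast
      have "u \<oplus>\<^bsub>?Q\<^esub> v = \<phi> (fls_const (a + b))"
        unfolding ab add[OF S_closed(5) S_closed(5)] fls_plus_const ..
      then show "u \<oplus>\<^bsub>?Q\<^esub> v \<in> ?K" by blast
    next
      fix u assume "u \<in> ?K"
      then obtain a where a: "u = \<phi> (fls_const a)" by blast
      have "\<phi> (fls_const (- a)) \<oplus>\<^bsub>?Q\<^esub> u = \<zero>\<^bsub>?Q\<^esub>"
        unfolding a add[OF S_closed(5) S_closed(5)] fls_plus_const by (simp add: zero)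
      then have "\<ominus>\<^bsub>?Q\<^esub> u = \<phi> (fls_const (- a))" unfolding a by (intro Q.minus_equality carr) auto
      then show "\<ominus>\<^bsub>?Q\<^esub> u \<in> ?K" by blast
    qed
    fix u assume u: "u \<in> ?K - {\<zero>\<^bsub>?Q\<^esub>}"
    then obtain a where a: "u = \<phi> (fls_const a)" by blast
    have "a \<noteq> 0"
    proof
      assume "a = 0"
      then have "u = \<phi> 0" using a by (simp only: fls_const_0)
      then show False using u zero by (metis Diff_iff singletonI)
    qed
    then have "a * inverse a = 1" by simp
    then have "u \<otimes>\<^bsub>?Q\<^esub> \<phi> (fls_const (inverse a)) = \<one>\<^bsub>?Q\<^esub>"
      unfolding a mult[OF S_closed(5) S_closed(5)] fls_const_mult_const by (simp only: fls_const_1 one)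
    then have "inv\<^bsub>?Q\<^esub> u = \<phi> (fls_const (inverse a))"
      unfolding a by (rule Q.comm_inv_char[OF carr[OF S_closed(5)] carr[OF S_closed(5)]])
    then show "inv\<^bsub>?Q\<^esub> u \<in> ?K" by blast
  qed
  obtain B where B: "finite B" "card B = rdeg P" "B \<subseteq> S" "indep_mod (idl P) B" "spans_mod (idl P) B S"
    using rdeg[OF P] by (auto simp: rel_dim_def)
  obtain bs where bs: "set bs = B" "distinct bs" using finite_distinct_list[OF B(1)] by blast
  have len: "length bs = rdeg P" using bs B(2) distinct_card by fastforce
  have full: "\<phi> ` kspan B = carrier ?Q"
  proof -
    have "\<phi> z \<in> \<phi> ` kspan B" if z: "z \<in> S" for z
    proof -
      obtain t where t: "t \<in> kspan B" "z - t \<in> idl P" using B(5) z by (auto simp: spans_mod_def)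
      then have "\<phi> z = \<phi> t" using eq[OF z] S_span[OF B(3)] by blast
      then show ?thesis using t(1) by blast
    qed
    then show ?thesis unfolding carrier using S_span[OF B(3)] by blast
  qed
  have dim: "Q.dimension (rdeg P) ?K (carrier ?Q)"
    using residue_dimension[OF P bs(2)] B(3,4) unfolding bs(1) len full[symmetric] \<phi>_def by blast
  have "range (\<lambda>k. P +>\<^bsub>R\<^esub> cls c (cst k)) = ?K"
    by (simp add: \<phi>_def image_image cls_el ev_cst)
  then have "residue_degree c P = (THE n. Q.dimension n ?K (carrier ?Q))"
    unfolding residue_degree_def by simp
  also have "\<dots> = rdeg P" by (rule the_equality[where P = "\<lambda>n. Q.dimension n ?K (carrier ?Q)", OF dim]) (rule Q.dimension_is_inj[OF K _ dim])
  finally show ?thesis .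
qed

section \<open>Divisors on the projective curve\<close>

lemma lookup_affine_div:
  assumes z: "z \<in> S" "z \<noteq> 0"
  shows "Poly_Mapping.lookup (affine_div c (el z)) q =
    (case q of None \<Rightarrow> 0 | Some P \<Rightarrow> if P \<in> pts then int (vord P z) else 0)"
proof -
  let ?f = "\<lambda>q. case q of None \<Rightarrow> 0 | Some P \<Rightarrow> if maximalideal P R then int (vanishing_order c P (el z)) else 0"
  have v: "vanishing_order c P (el z) = vord P z" if P: "P \<in> pts" for P
    unfolding vanishing_order_def pw_iff_vge[OF P z(1)] vge_iff_vord[OF P z] by (rule Greatest_equality) auto
  have f: "?f = (\<lambda>q. case q of None \<Rightarrow> 0 | Some P \<Rightarrow> if P \<in> pts then int (vord P z) else 0)"
    using v by (auto simp: fun_eq_iff pts_def split: option.splits)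
  have "{q. ?f q \<noteq> 0} \<subseteq> Some ` supp (dv z)"
    unfolding f by (auto simp: supp_def split: option.splits if_splits)
  then have "finite {q. ?f q \<noteq> 0}" using finite_supp_dv[OF z] finite_subset by blast
  then show ?thesis unfolding affine_div_def by (simp add: f)
qed

definition coef :: "'k divisor \<Rightarrow> 'k poly poly set set \<Rightarrow> nat" where
  "coef D P = nat (Poly_Mapping.lookup D (Some P))"

lemma lookup_good:
  assumes "good c D"
  shows "Poly_Mapping.lookup D q = (case q of None \<Rightarrow> 0 | Some P \<Rightarrow> if P \<in> pts then int (coef D P) else 0)"
proof (cases q)
  case None
  then show ?thesis using assms by (simp add: good_def)
next
  case (Some P)
  show ?thesis
  proof (cases "P \<in> pts")
    case True
    then show ?thesis using assms Some by (simp add: good_def coef_def)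
  next
    case False
    then have "Some P \<notin> Poly_Mapping.keys D" using assms by (auto simp: good_def points_def pts_def)
    then show ?thesis using Some False by (simp add: in_keys_iff)
  qed
qed

lemma goodI:
  assumes "\<And>q. Poly_Mapping.lookup D q = (case q of None \<Rightarrow> 0 | Some P \<Rightarrow> if P \<in> pts then int (\<delta> P) else 0)"
  shows "good c D" "\<And>P. P \<in> pts \<Longrightarrow> coef D P = \<delta> P"
proof -
  have "Poly_Mapping.keys D \<subseteq> points c"
  proof
    fix q assume "q \<in> Poly_Mapping.keys D"
    then show "q \<in> points c" using assms[of q]
      by (auto simp: in_keys_iff points_def pts_def split: option.splits if_splits)
  qed
  then show "good c D" using assms by (auto simp: good_def split: option.splits)
  show "\<And>P. P \<in> pts \<Longrightarrow> coef D P = \<delta> P" by (simp add: coef_def assms)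
qed

lemma good_keys:
  assumes "good c D"
  shows "Poly_Mapping.keys D = Some ` supp (coef D)"
proof (rule Set.set_eqI)
  fix q
  show "q \<in> Poly_Mapping.keys D \<longleftrightarrow> q \<in> Some ` supp (coef D)"
    unfolding in_keys_iff lookup_good[OF assms] by (cases q) (auto simp: supp_def)
qed

lemma finite_supp_coef: "good c D \<Longrightarrow> finite (supp (coef D))"
  using good_keys[of D] finite_keys[of D] by (metis finite_imageD inj_Some inj_on_subset subset_UNIV)

lemma divdeg_good:
  assumes "good c D"
  shows "divdeg c D = int (edeg (coef D))"
proof -
  have "divdeg c D = (\<Sum>P\<in>supp (coef D). Poly_Mapping.lookup D (Some P) * int (point_degree c (Some P)))"
    unfolding divdeg_def good_keys[OF assms] by (subst sum.reindex) auto
  also have "\<dots> = (\<Sum>P\<in>supp (coef D). int (coef D P * rdeg P))"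
    by (intro sum.cong refl)
      (auto simp: lookup_good[OF assms] supp_def point_degree_def residue_degree_eq)
  finally show ?thesis by (simp add: edeg_def)
qed

lemma edeg_cong: "(\<And>P. P \<in> pts \<Longrightarrow> \<delta> P = \<epsilon> P) \<Longrightarrow> edeg \<delta> = edeg \<epsilon>"
proof -
  assume e: "\<And>P. P \<in> pts \<Longrightarrow> \<delta> P = \<epsilon> P"
  then have "supp \<delta> = supp \<epsilon>" by (auto simp: supp_def)
  then show ?thesis unfolding edeg_def using e by (auto simp: supp_def intro!: sum.cong)
qed

lemma edeg_add:
  assumes "finite (supp \<delta>)" "finite (supp \<epsilon>)"
  shows "edeg (\<lambda>P. \<delta> P + \<epsilon> P) = edeg \<delta> + edeg \<epsilon>" "finite (supp (\<lambda>P. \<delta> P + \<epsilon> P))"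
proof -
  let ?A = "supp \<delta> \<union> supp \<epsilon>"
  have A: "finite ?A" "?A \<subseteq> pts" using assms by (auto simp: supp_def)
  have s: "supp (\<lambda>P. \<delta> P + \<epsilon> P) \<subseteq> ?A" by (auto simp: supp_def)
  show "finite (supp (\<lambda>P. \<delta> P + \<epsilon> P))" using finite_subset[OF s A(1)] .
  have "edeg (\<lambda>P. \<delta> P + \<epsilon> P) = (\<Sum>P\<in>?A. (\<delta> P + \<epsilon> P) * rdeg P)" by (rule edeg_eq_sum[OF A(1) s A(2)])
  also have "\<dots> = (\<Sum>P\<in>?A. \<delta> P * rdeg P) + (\<Sum>P\<in>?A. \<epsilon> P * rdeg P)" by (simp add: distrib_right sum.distrib)
  also have "\<dots> = edeg \<delta> + edeg \<epsilon>" using edeg_eq_sum[OF A(1) _ A(2), of \<delta>] edeg_eq_sum[OF A(1) _ A(2), of \<epsilon>] by simp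
  finally show "edeg (\<lambda>P. \<delta> P + \<epsilon> P) = edeg \<delta> + edeg \<epsilon>" .
qed

lemma I_div_eq:
  assumes D: "good c D"
  shows "I_div c D = el ` ID (coef D)"
proof -
  have "el z \<in> I_div c D \<longleftrightarrow> z \<in> ID (coef D)" if z: "z \<in> S" for z
  proof (cases "z = 0")
    case True
    then show ?thesis using S_idealD(2)[OF ID_S_ideal] by (simp add: I_div_def el_zero)
  next
    case False
    have "el z \<in> I_div c D \<longleftrightarrow> (\<forall>q. Poly_Mapping.lookup D q \<le> Poly_Mapping.lookup (affine_div c (el z)) q)"
      using z False by (simp add: I_div_def el_zero)
    also have "\<dots> \<longleftrightarrow> (\<forall>P\<in>pts. coef D P \<le> vord P z)"
      unfolding lookup_good[OF D] lookup_affine_div[OF z False] by (auto split: option.splits)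
    finally show ?thesis using ID_iff_vord[OF z False] by simp
  qed
  moreover have "I_div c D \<subseteq> el ` S" by (auto simp: I_div_def carrier_R)
  moreover have "ID (coef D) \<subseteq> S" by (auto simp: ID_def)
  ultimately show ?thesis by blast
qed

lemma WD_iff: "good c D \<Longrightarrow> z \<in> S \<Longrightarrow> el z \<in> WD c N D \<longleftrightarrow> z \<in> Fil (int N) \<and> z \<in> ID (coef D)"
  unfolding WD_def I_div_eq W_eq by (auto simp: Fil_def ID_def)

lemma W_iff: "z \<in> S \<Longrightarrow> el z \<in> W c N \<longleftrightarrow> z \<in> Fil (int N)"
  unfolding W_eq by (auto simp: Fil_def)

lemma WD_E: "r \<in> WD c N D \<Longrightarrow> \<exists>z\<in>S. r = el z"
  by (auto simp: WD_def W_def carrier_R)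

subsection \<open>Divisor classes\<close>

lemma poly_mapping_int_eqI: "(\<And>q. Poly_Mapping.lookup D q = Poly_Mapping.lookup E q) \<Longrightarrow> D = (E :: 'k divisor)"
  by (rule poly_mapping_eqI)

lemma full_div_mult:
  assumes "a \<in> S" "a \<noteq> 0" "b \<in> S" "b \<noteq> 0"
  shows "full_div c (el (a * b)) = full_div c (el a) + full_div c (el b)"
proof (rule poly_mapping_int_eqI)
  fix q
  have ab: "a * b \<in> S" "a * b \<noteq> 0" using assms by auto
  have "int (fdeg c (el (a * b))) = int (fdeg c (el a)) + int (fdeg c (el b))"
    using assms by (simp add: fdeg_el)
  then show "Poly_Mapping.lookup (full_div c (el (a * b))) q = Poly_Mapping.lookup (full_div c (el a) + full_div c (el b)) q"
    unfolding full_div_def lookup_minus lookup_add lookup_frag_cmul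
      lookup_affine_div[OF ab] lookup_affine_div[OF assms(1,2)] lookup_affine_div[OF assms(3,4)]
    using assms by (auto simp: vord_mult algebra_simps split: option.splits)
qed

lemma principal_divisors_iff:
  "E \<in> principal_divisors c \<longleftrightarrow> (\<exists>a\<in>S - {0}. \<exists>b\<in>S - {0}. E = full_div c (el a) - full_div c (el b))"
proof -
  have e: "carrier R - {\<zero>\<^bsub>R\<^esub>} = el ` (S - {0})" unfolding carrier_R el_zero by auto
  show ?thesis unfolding principal_divisors_def e by blast
qed

lemma principal_divisors_add:
  assumes "E \<in> principal_divisors c" "E' \<in> principal_divisors c"
  shows "E + E' \<in> principal_divisors c"
proof -
  obtain a b where ab: "a \<in> S - {0}" "b \<in> S - {0}" "E = full_div c (el a) - full_div c (el b)"
    using assms(1) principal_divisors_iff by blast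
  obtain a' b' where ab': "a' \<in> S - {0}" "b' \<in> S - {0}" "E' = full_div c (el a') - full_div c (el b')"
    using assms(2) principal_divisors_iff by blast
  have "E + E' = full_div c (el (a * a')) - full_div c (el (b * b'))"
    unfolding ab(3) ab'(3) using ab ab' by (simp add: full_div_mult)
  moreover have "a * a' \<in> S - {0}" "b * b' \<in> S - {0}" using ab ab' by auto
  ultimately show ?thesis unfolding principal_divisors_iff by blast
qed

lemma principal_divisors_neg: "E \<in> principal_divisors c \<Longrightarrow> - E \<in> principal_divisors c"
  unfolding principal_divisors_iff by (metis minus_diff_eq)

lemma principal_divisors_zero: "0 \<in> principal_divisors c"
  unfolding principal_divisors_iff by (intro bexI[of _ 1]) auto

lemma jac_class_coset: "jac_class c D = (\<lambda>h. h + (D - frag_cmul 3 (frag_of None))) ` principal_divisors c"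
  unfolding jac_class_def r_coset_def by (auto simp: Div0_def free_Abelian_group_def)

text \<open>The product of two cosets contains the sum of their representatives, so the difference \<open>G\<close> only has to be
  principal.\<close>

lemma jac_class_sum:
  assumes "E = D + D' - frag_cmul 3 (frag_of None) + G" "G \<in> principal_divisors c"
  shows "jac_class c E = jac_class c D \<otimes>\<^bsub>Pic0 c\<^esub> jac_class c D'"
proof -
  let ?o = "frag_cmul 3 (frag_of None) :: 'k divisor"
  have m: "A \<otimes>\<^bsub>Pic0 c\<^esub> B = {a + b | a b. a \<in> A \<and> b \<in> B}" for A B
    by (auto simp: Pic0_def FactGroup_def set_mult_def Div0_def free_Abelian_group_def)
  have e: "E - ?o = (D - ?o) + (D' - ?o) + G" unfolding assms(1) by (simp add: algebra_simps)
  show ?thesis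
    unfolding m jac_class_coset e
  proof (intro equalityI subsetI)
    fix z assume "z \<in> (\<lambda>h. h + ((D - ?o) + (D' - ?o) + G)) ` principal_divisors c"
    then obtain h where h: "h \<in> principal_divisors c" "z = h + ((D - ?o) + (D' - ?o) + G)" by blast
    have "z = ((h + G) + (D - ?o)) + (0 + (D' - ?o))" unfolding h(2) by (simp add: algebra_simps)
    then show "z \<in> {a + b |a b. a \<in> (\<lambda>h. h + (D - ?o)) ` principal_divisors c \<and> b \<in> (\<lambda>h. h + (D' - ?o)) ` principal_divisors c}"
      using principal_divisors_add[OF h(1) assms(2)] principal_divisors_zero by blast
  next
    fix z assume "z \<in> {a + b |a b. a \<in> (\<lambda>h. h + (D - ?o)) ` principal_divisors c \<and> b \<in> (\<lambda>h. h + (D' - ?o)) ` principal_divisors c}"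
    then obtain h h' where h: "h \<in> principal_divisors c" "h' \<in> principal_divisors c" "z = (h + (D - ?o)) + (h' + (D' - ?o))"
      by blast
    have "z = ((h + h') + (- G)) + ((D - ?o) + (D' - ?o) + G)" unfolding h(3) by (simp add: algebra_simps)
    then show "z \<in> (\<lambda>h. h + ((D - ?o) + (D' - ?o) + G)) ` principal_divisors c"
      using principal_divisors_add[OF principal_divisors_add[OF h(1,2)] principal_divisors_neg[OF assms(2)]] by blast
  qed
qed

subsection \<open>Sums of subspaces\<close>

lemma el_set_mult: "f \<in> S \<Longrightarrow> A \<subseteq> S \<Longrightarrow> el f <#\<^bsub>R\<^esub> (el ` A) = el ` ((*) f ` A)"
  unfolding l_coset_def by (auto simp: el_mult subset_iff)

lemma el_set_add: "A \<subseteq> S \<Longrightarrow> B \<subseteq> S \<Longrightarrow> (el ` A) <+>\<^bsub>R\<^esub> (el ` B) = el ` {a + b | a b. a \<in> A \<and> b \<in> B}"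
proof -
  assume AB: "A \<subseteq> S" "B \<subseteq> S"
  have e: "el a \<oplus>\<^bsub>R\<^esub> el b = el (a + b)" if "a \<in> A" "b \<in> B" for a b using that AB el_add by blast
  show ?thesis unfolding set_add_def'
  proof (intro equalityI subsetI)
    fix z assume "z \<in> (\<Union>h\<in>el ` A. \<Union>k\<in>el ` B. {h \<oplus>\<^bsub>R\<^esub> k})"
    then obtain a b where "a \<in> A" "b \<in> B" "z = el a \<oplus>\<^bsub>R\<^esub> el b" by blast
    then show "z \<in> el ` {a + b |a b. a \<in> A \<and> b \<in> B}" using e by blast
  next
    fix z assume "z \<in> el ` {a + b |a b. a \<in> A \<and> b \<in> B}"
    then obtain a b where "a \<in> A" "b \<in> B" "z = el a \<oplus>\<^bsub>R\<^esub> el b" using e by auto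
    then show "z \<in> (\<Union>h\<in>el ` A. \<Union>k\<in>el ` B. {h \<oplus>\<^bsub>R\<^esub> k})" by blast
  qed
qed

end

section \<open>Leading terms\<close>

context c34
begin

abbreviation K where "K \<equiv> fls_const"

definition has_lead :: "int \<Rightarrow> 'k fls \<Rightarrow> bool" where
  "has_lead n z \<longleftrightarrow> z \<in> Fil n \<and> fls_nth z (- n) \<noteq> 0"

lemma Fil_S: "z \<in> Fil n \<Longrightarrow> z \<in> S" by (simp add: Fil_def)

lemma has_lead_mult: "has_lead m a \<Longrightarrow> has_lead n b \<Longrightarrow> has_lead (m + n) (a * b)"
  unfolding has_lead_def using Fil_mult has_degree_le_mult(2)[of m a n b] by (auto simp: Fil_def)

lemma has_lead_add: "has_lead n a \<Longrightarrow> b \<in> Fil (n - 1) \<Longrightarrow> has_lead n (a + b)"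
  unfolding has_lead_def Fil_pred by auto

lemma has_lead_scale: "has_lead n a \<Longrightarrow> k \<noteq> 0 \<Longrightarrow> has_lead n (K k * a)"
  unfolding has_lead_def by auto

lemma has_lead_XY: "has_lead (3 * int i + 4 * int j) (X ^ i * Y ^ j)"
  using XY_deg[of i j] by (simp add: has_lead_def Fil_def)

lemma has_lead_mon: "n \<in> pole_orders \<Longrightarrow> has_lead n (mon n)"
  using mon_deg[of n] by (simp add: has_lead_def Fil_def)

lemma has_lead_base:
  "has_lead 0 1" "has_lead 3 X" "has_lead 4 Y" "has_lead 6 (X\<^sup>2)" "has_lead 7 (X * Y)" "has_lead 8 (Y\<^sup>2)"
  using has_lead_XY[of 0 0] has_lead_XY[of 1 0] has_lead_XY[of 0 1] has_lead_XY[of 2 0] has_lead_XY[of 1 1] has_lead_XY[of 0 2]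
  by simp_all

lemma has_lead_Fil: "has_lead n z \<Longrightarrow> n \<le> m \<Longrightarrow> z \<in> Fil m"
  using Fil_mono by (auto simp: has_lead_def)

lemma has_lead_subdegree: "has_lead n z \<Longrightarrow> z \<noteq> 0 \<and> fls_subdegree z = - n"
  unfolding has_lead_def by (auto simp: Fil_def has_degree_le_def intro!: fls_subdegree_eqI)

lemma subdegree_has_lead: "z \<in> S \<Longrightarrow> z \<noteq> 0 \<Longrightarrow> has_lead (- fls_subdegree z) z"
  by (simp add: has_lead_def Fil_def has_degree_le_subdegree)

lemma Fil_step:
  assumes "has_lead n m" "z \<in> Fil n"
  shows "\<exists>k. z - K k * m \<in> Fil (n - 1)"
proof -
  let ?k = "fls_nth z (- n) / fls_nth m (- n)"
  have "z - K ?k * m \<in> Fil (n - 1)"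
    unfolding Fil_pred using assms by (auto simp: has_lead_def)
  then show ?thesis by blast
qed

lemma Fil_0: "z \<in> Fil 0 \<Longrightarrow> \<exists>k. z = K k"
proof -
  assume "z \<in> Fil 0"
  from Fil_step[OF has_lead_base(1) this] obtain k where "z - K k * 1 \<in> Fil (-1)" by auto
  then show ?thesis unfolding Fil_neg by auto
qed

lemma Fil_4:
  assumes "z \<in> Fil 4"
  shows "\<exists>d e f. z = K d * Y + K e * X + K f"
proof -
  obtain d where d: "z - K d * Y \<in> Fil 3" using Fil_step[OF has_lead_base(3) assms] by auto
  obtain e where e: "z - K d * Y - K e * X \<in> Fil 2" using Fil_step[OF has_lead_base(2) d] by auto
  have "Fil 2 = Fil 1" "Fil 1 = Fil 0" using Fil_gap[of 2] Fil_gap[of 1] by (simp_all add: pole_orders_def)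
  then have "z - K d * Y - K e * X \<in> Fil 0" using e by simp
  from Fil_0[OF this] obtain f where "z - K d * Y - K e * X = K f" ..
  then have "z = K d * Y + K e * X + K f" by (simp add: algebra_simps)
  then show ?thesis by blast
qed

lemma Fil_4_I: "K d * Y + K e * X + K f \<in> Fil 4"
proof -
  have "Y \<in> Fil 4" "X \<in> Fil 4" "1 \<in> Fil 4" using has_lead_base has_lead_Fil by auto
  then have "K d * Y + K e * X + K f * 1 \<in> Fil 4" by (intro Fil_lincomb)
  then show ?thesis by simp
qed

text \<open>Elimination of leading terms, where the ideal supplies every pole order above \<open>N\<close>.\<close>

lemma ideal_plus_Fil:
  assumes J: "S_ideal J" and lead: "\<And>i. N < i \<Longrightarrow> i \<in> pole_orders \<Longrightarrow> \<exists>e\<in>J. has_lead i e" and z: "z \<in> S" "0 \<le> N"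
  shows "\<exists>j\<in>J. z - j \<in> Fil N"
proof -
  obtain n where "z \<in> Fil (int n)" using S_Fil[OF z(1)] by blast
  then have n: "z \<in> Fil (N + int n)" using Fil_mono[of "int n" "N + int n"] z(2) by auto
  show ?thesis
  proof (rule Fil_descend[OF S_ideal_subspace[OF J] _ n])
    fix i assume "N < i" "i \<in> pole_orders"
    then obtain e where "e \<in> J" "has_lead i e" using lead by blast
    then show "\<exists>e\<in>J \<inter> Fil i. fls_nth e (- i) \<noteq> 0" by (auto simp: has_lead_def)
  qed
qed

lemma finite_mons: "finite (mons N)" "card (mons N) \<le> card {n \<in> pole_orders. n \<le> N}"
proof -
  have "{n \<in> pole_orders. n \<le> N} \<subseteq> {0..N}" by (auto simp: pole_orders_def)
  then have f: "finite {n \<in> pole_orders. n \<le> N}" using finite_subset by blast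
  then show "finite (mons N)" by (simp add: mons_def)
  show "card (mons N) \<le> card {n \<in> pole_orders. n \<le> N}" unfolding mons_def by (rule card_image_le[OF f])
qed

text \<open>Modulo \<open>ID \<delta>\<close> the ring is spanned by the monomials in \<open>Fil N\<close>, so their number bounds the codimension. In the
  case of equality they form a basis of the quotient, and then \<open>Fil N\<close> meets the ideal trivially.\<close>

lemma edeg_bound:
  assumes fin: "finite (supp \<delta>)" and cov: "\<And>z. z \<in> S \<Longrightarrow> \<exists>j\<in>ID \<delta>. z - j \<in> Fil N"
    and card: "card {n \<in> pole_orders. n \<le> N} \<le> d"
  shows "edeg \<delta> \<le> d" "edeg \<delta> = d \<Longrightarrow> z \<in> Fil N \<Longrightarrow> z \<in> ID \<delta> \<Longrightarrow> z = 0"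
proof -
  note J = S_ideal_subspace[OF ID_S_ideal]
  have cardm: "card (mons N) \<le> d" using finite_mons(2) card by (rule le_trans)
  have sp: "spans_mod (ID \<delta>) (mons N) S"
    unfolding spans_mod_def Fil_eq_kspan[symmetric]
  proof
    fix z assume "z \<in> S"
    then obtain j where j: "j \<in> ID \<delta>" "z - j \<in> Fil N" using cov by blast
    then show "\<exists>t\<in>Fil N. z - t \<in> ID \<delta>" by (intro bexI[of _ "z - j"]) auto
  qed
  show "edeg \<delta> \<le> d" using rel_dim_le_spans[OF J rel_dim_ID[OF fin] finite_mons(1) sp] cardm by simp
  assume d: "edeg \<delta> = d" and z: "z \<in> Fil N" "z \<in> ID \<delta>"
  have "mons N \<subseteq> S" using mon_deg(3) by (auto simp: mons_def)
  then have ind: "indep_mod (ID \<delta>) (mons N)"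
    using rel_dim_spans_indep[OF J rel_dim_ID[OF fin] finite_mons(1) _ sp] cardm d by simp
  obtain u where u: "z = (\<Sum>x\<in>mons N. K (u x) * x)"
    using z(1) unfolding Fil_eq_kspan V.span_finite[OF finite_mons(1)] by blast
  then have "\<forall>x\<in>mons N. u x = 0" using ind z(2) unfolding indep_mod_def by blast
  then show "z = 0" unfolding u by simp
qed

lemma card_pole_orders_5: "card {n \<in> pole_orders. n \<le> 5} \<le> 3"
proof -
  have "{n \<in> pole_orders. n \<le> 5} \<subseteq> {0, 3, 4}" by (auto simp: pole_orders_def)
  from card_mono[OF _ this] show ?thesis by simp
qed

lemma card_pole_orders_8: "card {n \<in> pole_orders. n \<le> 8} \<le> 6"
proof -
  have "{n \<in> pole_orders. n \<le> 8} \<subseteq> {0, 3, 4, 6, 7, 8}" by (auto simp: pole_orders_def)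
  from card_mono[OF _ this] show ?thesis by simp
qed

section \<open>The two generators of a typical ideal\<close>

definition Fp :: "'k \<Rightarrow> 'k \<Rightarrow> 'k \<Rightarrow> 'k fls" where "Fp a b e = X\<^sup>2 + K a * Y + K b * X + K e"
definition Gp :: "'k \<Rightarrow> 'k \<Rightarrow> 'k \<Rightarrow> 'k fls" where "Gp a b e = X * Y + K a * Y + K b * X + K e"

lemma lead_Fp: "has_lead 6 (Fp a b e)" and lead_Gp: "has_lead 7 (Gp d e f)"
proof -
  have "K a * Y + K b * X + K e \<in> Fil (6 - 1)" "K d * Y + K e * X + K f \<in> Fil (7 - 1)"
    using subsetD[OF Fil_mono[of 4 5] Fil_4_I] subsetD[OF Fil_mono[of 4 6] Fil_4_I] by simp_all
  then show "has_lead 6 (Fp a b e)" "has_lead 7 (Gp d e f)"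
    using has_lead_add[OF has_lead_base(4)] has_lead_add[OF has_lead_base(5)]
    unfolding Fp_def Gp_def by (simp_all add: add.assoc)
qed

lemma Fp_S [simp, intro]: "Fp a b e \<in> S" and Gp_S [simp, intro]: "Gp a b e \<in> S"
  using lead_Fp lead_Gp by (auto simp: has_lead_def Fil_def)

text \<open>The terms \<open>x^2 y\<close> cancel, and \<open>a y^2\<close> becomes the leading term.\<close>

lemma lead_H:
  assumes "a \<noteq> 0"
  shows "has_lead 8 (Y * Fp a b e - X * Gp d e' f)"
proof -
  have "Y * Fp a b e - X * Gp d e' f = K a * Y\<^sup>2 + (K (b - d) * (X * Y) + K e * Y - K e' * X\<^sup>2 - K f * X)"
    by (simp add: Fp_def Gp_def algebra_simps power2_eq_square flip: fls_minus_const)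
  moreover have "X * Y \<in> Fil 7" "Y \<in> Fil 7" "X\<^sup>2 \<in> Fil 7" "X \<in> Fil 7"
    using has_lead_base by (auto intro: has_lead_Fil)
  then have "K (b - d) * (X * Y) + K e * Y - K e' * X\<^sup>2 - K f * X \<in> Fil (8 - 1)" by auto
  ultimately show ?thesis using has_lead_add[OF has_lead_scale[OF has_lead_base(6) assms]] by simp
qed

text \<open>The orders 7 and 11 come from \<open>G\<close> and \<open>y G\<close>, the order 8 from \<open>y F - x G\<close>, all others from multiples of \<open>F\<close> by
  monomials.\<close>

lemma FG_leads:
  fixes a b e d e' f :: 'k
  assumes a: "a \<noteq> 0" and i: "5 < i" "i \<le> 14"
  defines "F \<equiv> Fp a b e" and "G \<equiv> Gp d e' f"
  shows "\<exists>u v. u \<in> Fil (max 4 (i - 6)) \<and> v \<in> Fil 4 \<and> has_lead i (F * u + G * v)"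
proof -
  note F = lead_Fp[of a b e, folded F_def] and G = lead_Gp[of d e' f, folded G_def]
  have z: "0 \<in> Fil n" for n by auto
  have b: "1 \<in> Fil 4" "Y \<in> Fil 4" "X \<in> Fil 4"
    using has_lead_Fil[OF has_lead_base(1), of 4] has_lead_Fil[OF has_lead_base(3), of 4] has_lead_Fil[OF has_lead_base(2), of 4]
    by simp_all
  then have b': "- X \<in> Fil 4" by (intro Fil_lincomb)
  have m: "has_lead n (F * w) \<and> w \<in> Fil (n - 6)" if "has_lead (n - 6) w" for n w
    using has_lead_mult[OF F that] that by (simp add: has_lead_def)
  have eF: "\<exists>u v. u \<in> Fil (max 4 (n - 6)) \<and> v \<in> Fil 4 \<and> has_lead n (F * u + G * v)" if "has_lead (n - 6) w" "6 \<le> n" for n w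
    using m[OF that(1)] z Fil_mono[of "n - 6" "max 4 (n - 6)"] by (intro exI[of _ w] exI[of _ 0]) auto
  have "i = 6 \<or> i = 7 \<or> i = 8 \<or> i = 9 \<or> i = 10 \<or> i = 11 \<or> i = 12 \<or> i = 13 \<or> i = 14"
    using i by linarith
  then consider "i = 7" | "i = 8" | "i = 11" | "i \<in> {6, 9, 10, 12, 13, 14}" by blast
  then show ?thesis
  proof cases
    case 1
    then show ?thesis using G b z by (intro exI[of _ 0] exI[of _ 1]) auto
  next
    case 2
    have "has_lead 8 (F * Y + G * (- X))" using lead_H[OF a, of b e d e' f] by (simp add: F_def G_def mult.commute)
    then show ?thesis using b b' 2 by (intro exI[of _ Y] exI[of _ "- X"]) auto
  next
    case 3
    then show ?thesis using has_lead_mult[OF G has_lead_base(3)] b z by (intro exI[of _ 0] exI[of _ Y]) auto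
  next
    case 4
    then have "i - 6 \<in> pole_orders" by (auto simp: pole_orders_def)
    then show ?thesis using eF[OF has_lead_mon] i by simp
  qed
qed

text \<open>Elimination that keeps the cofactors of \<open>F\<close> and \<open>G\<close> small.\<close>

lemma FG_span:
  assumes a: "a \<noteq> 0" and n: "5 + int n \<le> 14" "max 4 (int n - 1) \<le> m" "4 \<le> l" and z: "z \<in> Fil (5 + int n)"
  shows "\<exists>u v. u \<in> Fil m \<and> v \<in> Fil l \<and> z - (Fp a b e * u + Gp d e' f * v) \<in> Fil 5"
proof -
  let ?F = "Fp a b e" and ?G = "Gp d e' f"
  let ?T = "{?F * u + ?G * v | u v. u \<in> Fil m \<and> v \<in> Fil l}"
  have "\<exists>t\<in>?T. z - t \<in> Fil 5"
  proof (rule Fil_descend[OF _ _ z])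
    show "V.subspace ?T"
      unfolding V.subspace_def
    proof (intro conjI ballI allI)
      show "0 \<in> ?T" by (auto intro!: exI[of _ 0])
      fix x assume "x \<in> ?T"
      then obtain u v where x: "x = ?F * u + ?G * v" "u \<in> Fil m" "v \<in> Fil l" by blast
      show "K k * x \<in> ?T" for k
      proof -
        have "K k * x = ?F * (K k * u) + ?G * (K k * v)" unfolding x(1) by (simp add: algebra_simps)
        then show ?thesis using x Fil_lincomb(5) by blast
      qed
      fix y assume "y \<in> ?T"
      then obtain u' v' where y: "y = ?F * u' + ?G * v'" "u' \<in> Fil m" "v' \<in> Fil l" by blast
      have "x + y = ?F * (u + u') + ?G * (v + v')" unfolding x(1) y(1) by (simp add: algebra_simps)
      then show "x + y \<in> ?T" using x y Fil_lincomb(2) by blast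
    qed
    fix i assume i: "5 < i" "i \<le> 5 + int n" "i \<in> pole_orders"
    then have "i \<le> 14" using n(1) by simp
    from FG_leads[OF a i(1) this] obtain u v
      where uv: "u \<in> Fil (max 4 (i - 6))" "v \<in> Fil 4" "has_lead i (?F * u + ?G * v)" by blast
    have "max 4 (i - 6) \<le> m" using i(2) n(2) by simp
    then have "u \<in> Fil m" "v \<in> Fil l" using uv(1,2) Fil_mono n(3) by blast+
    then show "\<exists>e\<in>?T \<inter> Fil i. fls_nth e (- i) \<noteq> 0"
      using uv(3) unfolding has_lead_def by blast
  qed
  then show ?thesis by blast
qed

lemma FG_ideal:
  assumes a: "a \<noteq> 0" and J: "S_ideal J" "Fp a b e \<in> J" "Gp d e' f \<in> J" and z: "z \<in> S"
  shows "\<exists>j\<in>J. z - j \<in> Fil 5"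
proof (rule ideal_plus_Fil[OF J(1) _ z])
  fix i assume i: "5 < i" "i \<in> pole_orders"
  note I = S_idealD[OF J(1)]
  show "\<exists>e\<in>J. has_lead i e"
  proof (cases "i \<le> 14")
    case True
    from FG_leads[OF a i(1) True] obtain u v
      where uv: "u \<in> Fil (max 4 (i - 6))" "v \<in> Fil 4" "has_lead i (Fp a b e * u + Gp d e' f * v)" by blast
    have "Fp a b e * u + Gp d e' f * v \<in> J"
      by (intro I(3) I(5)[OF J(2)] I(5)[OF J(3)] Fil_S[OF uv(1)] Fil_S[OF uv(2)])
    then show ?thesis using uv(3) by blast
  next
    case False
    then have "i - 6 \<in> pole_orders" by (auto simp: pole_orders_def)
    from has_lead_mult[OF lead_Fp has_lead_mon[OF this], of a b e] have "has_lead i (Fp a b e * mon (i - 6))" by simp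
    moreover have "Fp a b e * mon (i - 6) \<in> J" using I(5)[OF J(2) mon_deg(3)[OF \<open>i - 6 \<in> pole_orders\<close>]] .
    ultimately show ?thesis by blast
  qed
qed simp

text \<open>Every pole order above 5 occurs in an ideal that contains \<open>F\<close> and \<open>G\<close> (\<open>FG_ideal\<close>), and \<open>Fil 5\<close> has dimension 3.\<close>

lemma FG_edeg:
  assumes a: "a \<noteq> 0" and J: "Fp a b e \<in> ID \<delta>" "Gp d e' f \<in> ID \<delta>" and fin: "finite (supp \<delta>)"
  shows "edeg \<delta> \<le> 3" "edeg \<delta> = 3 \<Longrightarrow> z \<in> Fil 5 \<Longrightarrow> z \<in> ID \<delta> \<Longrightarrow> z = 0"
  using edeg_bound[OF fin FG_ideal[OF a ID_S_ideal J] card_pole_orders_5] by auto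

section \<open>Two functions generating the ideal of a divisor of degree 6\<close>

lemma lead_s: "s - X ^ 3 \<in> Fil 8 \<Longrightarrow> has_lead 9 s"
  using has_lead_add[OF has_lead_XY[of 3 0], of "s - X ^ 3"] by simp

lemma lead_t: "t - X\<^sup>2 * Y \<in> Fil 8 \<Longrightarrow> has_lead 10 t"
  using has_lead_add[OF has_lead_XY[of 2 1], of "t - X\<^sup>2 * Y"] Fil_mono[of 8 9] by auto

text \<open>The orders above 8 are those of \<open>s S\<close> together with 10, 11 and 14, which are supplied by \<open>t\<close>, the given combination
  and \<open>y t\<close>. The dimension of \<open>Fil 8\<close> is 6.\<close>

lemma st_edeg:
  assumes s: "s - X ^ 3 \<in> Fil 8" "s \<in> ID \<delta>" and t: "t - X\<^sup>2 * Y \<in> Fil 8" "t \<in> ID \<delta>"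
    and pq: "p \<in> S" "q \<in> S" "has_lead 11 (s * p + t * q)" and fin: "finite (supp \<delta>)"
  shows "edeg \<delta> \<le> 6" "edeg \<delta> = 6 \<Longrightarrow> z \<in> Fil 8 \<Longrightarrow> z \<in> ID \<delta> \<Longrightarrow> z = 0"
proof -
  note I = S_idealD[OF ID_S_ideal]
  have e: "s * p + t * q \<in> ID \<delta>" "has_lead 11 (s * p + t * q)"
    using I(3)[OF I(5)[OF s(2) pq(1)] I(5)[OF t(2) pq(2)]] pq(3) by blast+
  have cov: "\<exists>j\<in>ID \<delta>. z - j \<in> Fil 8" if "z \<in> S" for z
  proof (rule ideal_plus_Fil[OF ID_S_ideal _ that])
    fix i assume i: "8 < i" "i \<in> pole_orders"
    show "\<exists>e\<in>ID \<delta>. has_lead i e"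
    proof (cases "i - 9 \<in> pole_orders")
      case True
      from has_lead_mult[OF lead_s[OF s(1)] has_lead_mon[OF True]] have "has_lead i (s * mon (i - 9))" by simp
      then show ?thesis using I(5)[OF s(2) mon_deg(3)[OF True]] by blast
    next
      case False
      then have "i = 10 \<or> i = 11 \<or> i = 14" using i unfolding pole_orders_def by auto
      moreover have "has_lead 14 (t * Y)" using has_lead_mult[OF lead_t[OF t(1)] has_lead_base(3)] by simp
      moreover have "t * Y \<in> ID \<delta>" using I(5)[OF t(2)] by simp
      ultimately show ?thesis using lead_t[OF t(1)] t(2) e by blast
    qed
  qed simp
  show "edeg \<delta> \<le> 6" "edeg \<delta> = 6 \<Longrightarrow> z \<in> Fil 8 \<Longrightarrow> z \<in> ID \<delta> \<Longrightarrow> z = 0"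
    using edeg_bound[OF fin cov card_pole_orders_8] by auto
qed

text \<open>Where \<open>f\<close> vanishes beyond \<open>\<delta>\<close>, the function \<open>g\<close> does not, as \<open>\<delta>\<close> has the maximal degree. Hence at such a
  point the relation \<open>z g = f h\<close> gives \<open>z\<close> the zeros of \<open>f\<close> beyond \<open>\<delta>\<close>.\<close>

lemma residual_member:
  assumes fin: "finite (supp \<delta>)" and f: "f \<in> ID \<delta>" "f \<noteq> 0" and g: "g \<in> ID \<delta>"
    and max: "\<And>\<epsilon>. finite (supp \<epsilon>) \<Longrightarrow> f \<in> ID \<epsilon> \<Longrightarrow> g \<in> ID \<epsilon> \<Longrightarrow> edeg \<epsilon> \<le> edeg \<delta>"
    and z: "z \<in> S" and h: "h \<in> S" and rel: "z * g = f * h"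
  shows "z \<in> ID (\<lambda>P. vord P f - \<delta> P)"
proof (cases "z = 0")
  case True
  then show ?thesis using S_idealD(2)[OF ID_S_ideal] by simp
next
  case False
  have S: "f \<in> S" "g \<in> S" using f g by (auto simp: ID_def)
  show ?thesis
    unfolding ID_iff_vord[OF z False]
  proof
    fix P assume P: "P \<in> pts"
    show "vord P f - \<delta> P \<le> vord P z"
    proof (cases "\<delta> P < vord P f")
      case True
      let ?e = "\<delta>(P := Suc (\<delta> P))"
      have se: "supp ?e \<subseteq> insert P (supp \<delta>)" by (auto simp: supp_def)
      have fe: "finite (supp ?e)" by (rule finite_subset[OF se]) (use fin in simp)
      have "edeg ?e = edeg \<delta> + rdeg P"
      proof -
        have A: "finite (insert P (supp \<delta>))" "insert P (supp \<delta>) \<subseteq> pts" using fin P by (auto simp: supp_def)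
        have "edeg ?e = (\<Sum>Q\<in>insert P (supp \<delta>). ?e Q * rdeg Q)" by (rule edeg_eq_sum[OF A(1) se A(2)])
        also have "\<dots> = (\<Sum>Q\<in>insert P (supp \<delta>). \<delta> Q * rdeg Q) + rdeg P"
          using sum.remove[OF A(1), of P "\<lambda>Q. ?e Q * rdeg Q"] sum.remove[OF A(1), of P "\<lambda>Q. \<delta> Q * rdeg Q"] by simp
        also have "(\<Sum>Q\<in>insert P (supp \<delta>). \<delta> Q * rdeg Q) = edeg \<delta>"
          by (rule edeg_eq_sum[OF A(1) _ A(2), symmetric]) blast
        finally show ?thesis .
      qed
      then have big: "edeg \<delta> < edeg ?e" using rdeg_pos[OF P] by simp
      have "f \<in> ID ?e" using f(1) True unfolding ID_iff_vord[OF S(1) f(2)] by auto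
      then have ge: "g \<notin> ID ?e" using max[OF fe] big by fastforce
      then have g0: "g \<noteq> 0" using S_idealD(2)[OF ID_S_ideal] by auto
      have vg: "vord P g \<le> \<delta> P"
      proof (rule ccontr)
        assume "\<not> vord P g \<le> \<delta> P"
        then have "g \<in> ID ?e" using g unfolding ID_iff_vord[OF S(2) g0] by auto
        then show False using ge by simp
      qed
      have "h \<noteq> 0" using rel False g0 by auto
      then have "vord P z + vord P g = vord P f + vord P h"
        using vord_mult[OF P z False S(2) g0] vord_mult[OF P S(1) f(2) h] unfolding rel by simp
      then show ?thesis using vg by simp
    qed simp
  qed
qed

lemma edeg_diff:
  assumes z: "z \<in> S" "z \<noteq> 0" "z \<in> ID \<delta>" and fin: "finite (supp \<delta>)"
  shows "finite (supp (\<lambda>P. vord P z - \<delta> P))" "int (edeg (\<lambda>P. vord P z - \<delta> P)) = - fls_subdegree z - int (edeg \<delta>)"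
proof -
  let ?e = "\<lambda>P. vord P z - \<delta> P"
  have "supp ?e \<subseteq> supp (dv z)" by (auto simp: supp_def)
  then show fe: "finite (supp ?e)" using finite_supp_dv[OF z(1,2)] finite_subset by blast
  have "edeg (dv z) = edeg (\<lambda>P. ?e P + \<delta> P)"
    by (rule edeg_cong) (use z(3) in \<open>simp add: ID_iff_vord[OF z(1,2)]\<close>)
  then show "int (edeg ?e) = - fls_subdegree z - int (edeg \<delta>)"
    using edeg_add(1)[OF fe fin] edeg_dv[OF z(1,2)] by simp
qed

text \<open>\<open>x y G\<close> has pole order 14, so \<open>FG_span\<close> eliminates it by \<open>F\<close> and \<open>G\<close>; the cofactor of \<open>G\<close> contributes only the
  lower terms of the new \<open>G\<close>.\<close>

lemma complement_exists:
  assumes a: "a \<noteq> 0"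
  shows "\<exists>d1 e1 f1. \<exists>H\<in>Fil 8. Gp d1 e1 f1 * Gp d e' f + Fp a b e * H \<in> Fil 5"
proof -
  let ?F = "Fp a b e" and ?G = "Gp d e' f"
  have "X * Y * ?G \<in> Fil (5 + int 9)"
    using has_lead_mult[OF has_lead_base(5) lead_Gp] by (simp add: has_lead_def)
  from FG_span[OF a _ _ _ this, where m = 8 and l = 4 and b = b and e = e and d = d and e' = e' and f = f]
  obtain u v where uv: "u \<in> Fil 8" "v \<in> Fil 4" "X * Y * ?G - (?F * u + ?G * v) \<in> Fil 5" by auto
  obtain d' e1 f' where v: "v = K d' * Y + K e1 * X + K f'" using Fil_4[OF uv(2)] by blast
  have g: "Gp (- d') (- e1) (- f') = X * Y - v" unfolding v Gp_def by simp
  have "Gp (- d') (- e1) (- f') * ?G + ?F * (- u) = X * Y * ?G - (?F * u + ?G * v)"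
    unfolding g by (simp add: algebra_simps)
  then show ?thesis using uv by (metis Fil_lincomb(4))
qed

text \<open>The combination lies in \<open>Fil 5\<close> and in \<open>ID \<delta>\<close>, so it vanishes; the resulting relation between \<open>F\<close> and \<open>G\<close> puts
  \<open>G1\<close> into the ideal of the rest of the divisor of \<open>F\<close>.\<close>

lemma complement_member:
  assumes a: "a \<noteq> 0" and J: "Fp a b e \<in> ID \<delta>" "Gp d e' f \<in> ID \<delta>" and fin: "finite (supp \<delta>)" and deg: "edeg \<delta> = 3"
    and H: "H \<in> S" and G1: "G1 \<in> S" and rel: "G1 * Gp d e' f + Fp a b e * H \<in> Fil 5"
  shows "G1 * Gp d e' f + Fp a b e * H = 0" "G1 \<in> ID (\<lambda>P. vord P (Fp a b e) - \<delta> P)"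
proof -
  note I = S_idealD[OF ID_S_ideal]
  have "G1 * Gp d e' f + Fp a b e * H \<in> ID \<delta>" by (rule I(3)[OF I(4)[OF G1 J(2)] I(5)[OF J(1) H]])
  then show z: "G1 * Gp d e' f + Fp a b e * H = 0" using FG_edeg(2)[OF a J fin deg rel] by blast
  have F0: "Fp a b e \<noteq> 0" using has_lead_subdegree[OF lead_Fp] by blast
  show "G1 \<in> ID (\<lambda>P. vord P (Fp a b e) - \<delta> P)"
  proof (rule residual_member[OF fin J(1) F0 J(2) _ G1])
    show "edeg \<epsilon> \<le> edeg \<delta>" if "finite (supp \<epsilon>)" "Fp a b e \<in> ID \<epsilon>" "Gp d e' f \<in> ID \<epsilon>" for \<epsilon>
      using FG_edeg(1)[OF a that(2,3,1)] deg by simp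
    show "- H \<in> S" using H by simp
    show "G1 * Gp d e' f = Fp a b e * (- H)" using z by (simp add: eq_neg_iff_add_eq_0)
  qed
qed

text \<open>For \<open>z = F\<close> and \<open>z = G\<close> the difference \<open>z t - s h\<close> lies in \<open>Fil 8\<close> and in \<open>ID \<delta>\<close>, so it is 0.
  Therefore \<open>F\<close> and \<open>G\<close> lie in the ideal of \<open>\<eta>\<close>, the divisor of \<open>s\<close> without \<open>\<delta>\<close>, which has degree \<open>9 - 6 = 3\<close>. The
  result \<open>\<epsilon>\<close> is the divisor of \<open>F\<close> without \<open>\<eta>\<close>, and \<open>complement_member\<close> applies to \<open>\<eta>\<close>.\<close>

lemma output_divisor:
  assumes s: "s - X ^ 3 \<in> Fil 8" "s \<in> ID \<delta>" and t: "t - X\<^sup>2 * Y \<in> Fil 8" "t \<in> ID \<delta>"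
    and pq: "p \<in> S" "q \<in> S" "has_lead 11 (s * p + t * q)" and fin: "finite (supp \<delta>)" and deg: "edeg \<delta> = 6"
    and a: "a \<noteq> 0" and F: "h \<in> S" "Fp a b e * t - s * h \<in> Fil 8" and G: "h' \<in> S" "Gp d e' f * t - s * h' \<in> Fil 8"
    and H: "H \<in> S" and G1: "G1 \<in> S" "G1 * Gp d e' f + Fp a b e * H \<in> Fil 5"
  defines "\<eta> \<equiv> \<lambda>P. vord P s - \<delta> P"
  defines "\<epsilon> \<equiv> \<lambda>P. vord P (Fp a b e) - \<eta> P"
  shows "\<And>P. P \<in> pts \<Longrightarrow> \<delta> P \<le> vord P s" "\<And>P. P \<in> pts \<Longrightarrow> \<eta> P \<le> vord P (Fp a b e)"
    "edeg \<epsilon> = 3" "Fp a b e \<in> ID \<epsilon>" "G1 \<in> ID \<epsilon>"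
proof -
  note I = S_idealD[OF ID_S_ideal]
  note ls = has_lead_subdegree[OF lead_s[OF s(1)]] and lF = has_lead_subdegree[OF lead_Fp[of a b e]]
  have sS: "s \<in> S" and tS: "t \<in> S" using I(8) s(2) t(2) by blast+
  have zero: "z = 0" if "z \<in> Fil 8" "z \<in> ID \<delta>" for z using st_edeg(2)[OF s t pq fin deg that] .
  have res: "z \<in> ID \<eta>" if z: "z \<in> S" "y \<in> S" "z * t - s * y \<in> Fil 8" for z y
  proof -
    have "z * t - s * y \<in> ID \<delta>" by (rule I(7)[OF I(4)[OF z(1) t(2)] I(5)[OF s(2) z(2)]])
    then have "z * t = s * y" using zero[OF z(3)] by simp
    then have rel: "z * t = s * y" .
    have max: "edeg \<epsilon> \<le> edeg \<delta>" if "finite (supp \<epsilon>)" "s \<in> ID \<epsilon>" "t \<in> ID \<epsilon>" for \<epsilon>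
      using st_edeg(1)[OF s(1) that(2) t(1) that(3) pq that(1)] deg by simp
    show ?thesis unfolding \<eta>_def
      by (rule residual_member[OF fin s(2) conjunct1[OF ls] t(2) max z(1,2) rel])
  qed
  show "\<And>P. P \<in> pts \<Longrightarrow> \<delta> P \<le> vord P s" using s(2) unfolding ID_iff_vord[OF sS conjunct1[OF ls]] by blast
  have FE: "Fp a b e \<in> ID \<eta>" and GE: "Gp d e' f \<in> ID \<eta>" using res[OF _ F] res[OF _ G] by auto
  then show "\<And>P. P \<in> pts \<Longrightarrow> \<eta> P \<le> vord P (Fp a b e)"
    unfolding ID_iff_vord[OF Fp_S conjunct1[OF lF]] by blast
  have e1: "finite (supp \<eta>)" "edeg \<eta> = 3"
    using edeg_diff[OF sS conjunct1[OF ls] s(2) fin] ls deg unfolding \<eta>_def by simp_all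
  show "edeg \<epsilon> = 3"
    using edeg_diff(2)[OF Fp_S conjunct1[OF lF] FE e1(1)] lF e1(2) unfolding \<epsilon>_def by simp
  show "Fp a b e \<in> ID \<epsilon>" unfolding \<epsilon>_def ID_iff_vord[OF Fp_S conjunct1[OF lF]] by simp
  show "G1 \<in> ID \<epsilon>" unfolding \<epsilon>_def by (rule complement_member(2)[OF a FE GE e1 H G1])
qed

end

text \<open>From here on \<open>$\<close> selects the entries of a vector only.\<close>

no_notation fps_nth (infixl \<open>$\<close> 75)

section \<open>Linear algebra with three rows\<close>

lemma mat_kernel_of_cols:
  fixes ws :: "'a::field vec list"
  assumes "length ws = n" "set ws \<subseteq> carrier_vec 3"
  shows "v \<in> mat_kernel (mat_of_cols 3 ws) \<longleftrightarrow> v \<in> carrier_vec n \<and> (\<forall>i<3. (\<Sum>j<n. v $ j * (ws ! j) $ i) = 0)"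
proof -
  let ?M = "mat_of_cols 3 ws"
  have M: "?M \<in> carrier_mat 3 n" using assms(1) by auto
  have idx: "(?M *\<^sub>v v) $ i = (\<Sum>j<n. v $ j * (ws ! j) $ i)" if "i < 3" "v \<in> carrier_vec n" for i
    using that assms(1) M
    by (auto simp: scalar_prod_def mat_of_cols_index atLeast0LessThan mult.commute intro!: sum.cong)
  show ?thesis
  proof
    assume "v \<in> mat_kernel ?M"
    then have v: "v \<in> carrier_vec n" "?M *\<^sub>v v = 0\<^sub>v 3" using mat_kernelD[OF M] by blast+
    then show "v \<in> carrier_vec n \<and> (\<forall>i<3. (\<Sum>j<n. v $ j * (ws ! j) $ i) = 0)"
      using idx[OF _ v(1)] index_zero_vec(1) by metis
  next
    assume v: "v \<in> carrier_vec n \<and> (\<forall>i<3. (\<Sum>j<n. v $ j * (ws ! j) $ i) = 0)"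
    have "?M *\<^sub>v v = 0\<^sub>v 3"
    proof (rule eq_vecI)
      fix i assume "i < dim_vec (0\<^sub>v 3 :: 'a vec)"
      then have "i < 3" by simp
      then show "(?M *\<^sub>v v) $ i = 0\<^sub>v 3 $ i" using idx v by simp
    qed simp
    then show "v \<in> mat_kernel ?M" using v mat_kernelI[OF M] by blast
  qed
qed

lemma det_solve:
  fixes A :: "'a::field mat"
  assumes A: "A \<in> carrier_mat n n" "det A \<noteq> 0" and b: "b \<in> carrier_vec n"
  shows "\<exists>v\<in>carrier_vec n. A *\<^sub>v v = b"
proof -
  have "A \<in> Units (ring_mat TYPE('a) n undefined)" by (rule det_non_zero_imp_unit[OF A])
  then obtain B where B: "B \<in> carrier_mat n n" "A * B = 1\<^sub>m n"
    unfolding Units_def by (auto simp: ring_mat_simps)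
  have "A *\<^sub>v (B *\<^sub>v b) = b" using A B b by (simp flip: assoc_mult_mat_vec)
  moreover have "B *\<^sub>v b \<in> carrier_vec n" using B b by simp
  ultimately show ?thesis by blast
qed

lemma sum_lessThan_5: "(\<Sum>j<5. f j) = f 0 + f 1 + f 2 + f 3 + f (4::nat)" for f :: "nat \<Rightarrow> 'a::comm_monoid_add"
  by (simp add: eval_nat_numeral)

lemma vec_of_list_5: "vec_of_list [a, b, c, d, e] \<in> carrier_vec 5"
  "vec_of_list [a, b, c, d, e] $ 0 = a" "vec_of_list [a, b, c, d, e] $ 1 = b" "vec_of_list [a, b, c, d, e] $ 2 = c"
  "vec_of_list [a, b, c, d, e] $ 3 = d" "vec_of_list [a, b, c, d, e] $ 4 = e"
  by (simp_all add: carrier_vecI vec_of_list_index del: vec_of_list_Cons)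

context c34
begin

lemma finsum_el:
  assumes "finite A" "\<And>i. i \<in> A \<Longrightarrow> f i \<in> S"
  shows "finsum R (\<lambda>i. el (f i)) A = el (\<Sum>i\<in>A. f i)"
proof -
  interpret cring R by (rule cring_R)
  show ?thesis using assms
  proof (induction A rule: finite_induct)
    case empty
    then show ?case by (simp add: el_zero)
  next
    case (insert x A)
    have "finsum R (\<lambda>i. el (f i)) (insert x A) = el (f x) \<oplus>\<^bsub>R\<^esub> finsum R (\<lambda>i. el (f i)) A"
      using insert.hyps insert.prems by (intro finsum_insert) auto
    also have "\<dots> = el (f x + (\<Sum>i\<in>A. f i))"
      using insert.IH insert.prems by (simp add: el_add S_sum)
    finally show ?case using insert.hyps by simp
  qed
qed

lemma lin_comb_el:
  assumes "length zs = 5" "set zs \<subseteq> S"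
  shows "lin_comb c v (map el zs) = el (\<Sum>j<5. K (v $ j) * zs ! j)"
proof -
  interpret cring R by (rule cring_R)
  have zS: "zs ! j \<in> S" if "j < 5" for j using that assms by auto
  have "lin_comb c v (map el zs) = finsum R (\<lambda>j. el (K (v $ j) * zs ! j)) {..<5}"
    unfolding lin_comb_def length_map assms(1)
    by (rule finsum_cong') (use zS assms(1) in \<open>auto simp: cls_el ev_cst el_mult\<close>)
  also have "\<dots> = el (\<Sum>j<5. K (v $ j) * zs ! j)" by (rule finsum_el) (use zS in auto)
  finally show ?thesis .
qed

subsection \<open>Coordinates modulo a divisor\<close>

definition low :: "'k vec \<Rightarrow> 'k fls" where "low v = K (v $ 0) + K (v $ 1) * X + K (v $ 2) * Y"

lemma low_Fil: "low v \<in> Fil 5"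
  using subsetD[OF Fil_mono[of 4 5] Fil_4_I[of "v $ 2" "v $ 1" "v $ 0"]] by (simp add: low_def algebra_simps)

lemma low_sum:
  "(\<Sum>j\<in>A. K (a j) * low (w j)) =
   K (\<Sum>j\<in>A. a j * w j $ 0) + K (\<Sum>j\<in>A. a j * w j $ 1) * X + K (\<Sum>j\<in>A. a j * w j $ 2) * Y"
  by (induction A rule: infinite_finite_induct)
    (simp_all add: low_def algebra_simps flip: fls_plus_const fls_const_mult_const)

lemma low_eq_0: "v \<in> carrier_vec 3 \<Longrightarrow> w \<in> carrier_vec 3 \<Longrightarrow> low v = low w \<Longrightarrow> v = w"
proof -
  assume vw: "v \<in> carrier_vec 3" "w \<in> carrier_vec 3" "low v = low w"
  have z: "k0 = 0 \<and> k1 = 0 \<and> k2 = 0" if e: "K k0 + K k1 * X + K k2 * Y = 0" for k0 k1 k2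
  proof -
    have "ev [:[:k0, k1:], [:k2:], 0:] = 0" using e by (simp add: ev_pCons ev_x_pCons ev_x_const algebra_simps)
    from ev_y_quadratic[OF this] show ?thesis by simp
  qed
  have "K (v $ 0 - w $ 0) + K (v $ 1 - w $ 1) * X + K (v $ 2 - w $ 2) * Y = low v - low w"
    by (simp add: low_def algebra_simps flip: fls_minus_const)
  then have c: "v $ 0 = w $ 0" "v $ 1 = w $ 1" "v $ 2 = w $ 2"
    using z[of "v $ 0 - w $ 0" "v $ 1 - w $ 1" "v $ 2 - w $ 2"] vw(3) by simp_all
  show "v = w"
  proof (rule eq_vecI)
    fix i assume "i < dim_vec w"
    then have "i = 0 \<or> i = 1 \<or> i = 2" using vw(2) by auto
    then show "v $ i = w $ i" using c by auto
  qed (use vw in auto)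
qed

lemma Fil_5_low: "z \<in> Fil 5 \<Longrightarrow> \<exists>v\<in>carrier_vec 3. z = low v"
proof -
  assume "z \<in> Fil 5"
  then have "z \<in> Fil 4" using Fil_gap[of 5] by (simp add: pole_orders_def)
  then obtain d e f where z: "z = K d * Y + K e * X + K f" using Fil_4 by blast
  have "z = low (vec_of_list [f, e, d])" unfolding z low_def by (simp add: vec_of_list_index del: vec_of_list_Cons)
  then show ?thesis by (intro bexI[of _ "vec_of_list [f, e, d]"]) (auto simp: carrier_vecI)
qed

text \<open>What the computations modulo a divisor of degree 3 need to know about it and its two functions.\<close>

definition rep3 :: "'k divisor \<Rightarrow> 'k \<Rightarrow> 'k \<Rightarrow> 'k \<Rightarrow> 'k \<Rightarrow> 'k \<Rightarrow> 'k \<Rightarrow> bool" where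
  "rep3 D a b e d e' f \<longleftrightarrow> good c D \<and> divdeg c D = 3 \<and> a \<noteq> 0 \<and>
     Fp a b e \<in> ID (coef D) \<and> Gp d e' f \<in> ID (coef D)"

lemma rep3_edeg: "rep3 D a b e d e' f \<Longrightarrow> edeg (coef D) = 3 \<and> finite (supp (coef D))"
  using divdeg_good[of D] finite_supp_coef[of D] by (simp add: rep3_def)

lemma rep3_cover: "rep3 D a b e d e' f \<Longrightarrow> z \<in> S \<Longrightarrow> \<exists>j\<in>ID (coef D). z - j \<in> Fil 5"
  using FG_ideal[OF _ ID_S_ideal] unfolding rep3_def by blast

lemma rep3_zero: "rep3 D a b e d e' f \<Longrightarrow> z \<in> Fil 5 \<Longrightarrow> z \<in> ID (coef D) \<Longrightarrow> z = 0"
  using FG_edeg(2)[of a b e "coef D" d e' f z] rep3_edeg[of D a b e d e' f] unfolding rep3_def by blast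

text \<open>\<open>Fil 5\<close> is a complement of the ideal of \<open>D\<close>, so the coordinates exist and are unique.\<close>

lemma image_mod_D:
  assumes r: "rep3 D a b e d e' f" and z: "z \<in> Fil (int N)" and N: "5 \<le> N"
  shows "image_mod_D c N D (el z) \<in> carrier_vec 3 \<and> z - low (image_mod_D c N D (el z)) \<in> ID (coef D)"
proof -
  note I = S_idealD[OF ID_S_ideal]
  have g: "good c D" using r by (simp add: rep3_def)
  have zS: "z \<in> S" by (rule Fil_S[OF z])
  have lowN: "low v \<in> Fil (int N)" for v using low_Fil Fil_mono[of 5 "int N"] N by auto
  have lS: "low v \<in> S" for v by (rule Fil_S[OF low_Fil])
  have e: "cls c (cst (v $ 0) + cst (v $ 1) * XX + cst (v $ 2) * YY) = el (low v)" for v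
    by (simp only: cls_el low_def ev.hom_add ev.hom_mult ev_cst ev_XX ev_YY)
  have m: "el z \<ominus>\<^bsub>R\<^esub> el (low v) \<in> WD c N D \<longleftrightarrow> z - low v \<in> ID (coef D)" for v
    using WD_iff[OF g, of "z - low v" N] zS lS Fil_lincomb(3)[OF z lowN] by (simp add: el_minus)
  obtain j where j: "j \<in> ID (coef D)" "z - j \<in> Fil 5" using rep3_cover[OF r zS] by blast
  obtain v where v: "v \<in> carrier_vec 3" "z - j = low v" using Fil_5_low[OF j(2)] by blast
  then have vj: "z - low v = j" by (simp add: algebra_simps)
  let ?P = "\<lambda>v. v \<in> carrier_vec 3 \<and> z - low v \<in> ID (coef D)"
  have Pv: "?P v" using v(1) vj j(1) by simp
  have "w = v" if "?P w" for w
  proof -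
    have "(z - low v) - (z - low w) \<in> ID (coef D)" using Pv that I(7) by blast
    then have "low w - low v \<in> ID (coef D)" by simp
    then have "low w - low v = 0" using rep3_zero[OF r Fil_lincomb(3)[OF low_Fil low_Fil]] by blast
    then have "low w = low v" by simp
    with conjunct1[OF that] v(1) show ?thesis by (rule low_eq_0)
  qed
  with Pv have "(THE v. ?P v) = v" by (rule the_equality)
  moreover have "image_mod_D c N D (el z) = (THE v. ?P v)" unfolding image_mod_D_def e m ..
  ultimately show ?thesis using Pv by simp
qed

text \<open>If \<open>U \<noteq> 0\<close>, the combination of the first three columns can be chosen to be the coordinate vector of the
  function 1.\<close>

lemma image_cols:
  assumes r: "rep3 D a b e d e' f" and zs: "length zs = 5" "set zs \<subseteq> Fil (int N)" and N: "5 \<le> N"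
  defines "M \<equiv> mat_of_cols 3 (map (image_mod_D c N D) (map el zs))"
  shows "v \<in> mat_kernel M \<Longrightarrow> (\<Sum>j<5. K (v $ j) * zs ! j) \<in> ID (coef D)"
    and "U_det M \<noteq> 0 \<Longrightarrow> \<exists>v. (\<Sum>j<3. K (v $ j) * zs ! j) - 1 \<in> ID (coef D)"
proof -
  define ws where "ws = map (image_mod_D c N D) (map el zs)"
  have w: "ws ! j \<in> carrier_vec 3 \<and> zs ! j - low (ws ! j) \<in> ID (coef D)" if "j < 5" for j
    using image_mod_D[OF r _ N, of "zs ! j"] that zs unfolding ws_def by (simp add: subset_iff)
  have ws: "length ws = 5" "set ws \<subseteq> carrier_vec 3"
    using zs(1) w unfolding ws_def by (auto simp: in_set_conv_nth)
  have M: "M = mat_of_cols 3 ws" by (simp add: M_def ws_def)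
  have mem: "(\<Sum>j\<in>A. K (u j) * zs ! j) - (\<Sum>j\<in>A. K (u j) * low (ws ! j)) \<in> ID (coef D)" if "A \<subseteq> {..<5}" for A u
  proof -
    have "(\<Sum>j\<in>A. K (u j) * zs ! j) - (\<Sum>j\<in>A. K (u j) * low (ws ! j)) = (\<Sum>j\<in>A. K (u j) * (zs ! j - low (ws ! j)))"
      by (simp add: sum_subtractf right_diff_distrib)
    also have "\<dots> \<in> ID (coef D)"
      using w that by (intro V.subspace_sum V.subspace_scale S_ideal_subspace[OF ID_S_ideal]) auto
    finally show ?thesis .
  qed
  show "(\<Sum>j<5. K (v $ j) * zs ! j) \<in> ID (coef D)" if v: "v \<in> mat_kernel M"
  proof -
    have "\<forall>i<3. (\<Sum>j<5. v $ j * (ws ! j) $ i) = 0" using v mat_kernel_of_cols[OF ws] unfolding M by blast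
    then have "(\<Sum>j<5. K (v $ j) * low (ws ! j)) = 0" unfolding low_sum by simp
    then show ?thesis using mem[of "{..<5}" "\<lambda>j. v $ j"] by simp
  qed
  show "\<exists>v. (\<Sum>j<3. K (v $ j) * zs ! j) - 1 \<in> ID (coef D)" if U: "U_det M \<noteq> 0"
  proof -
    let ?A = "mat_of_cols 3 (take 3 ws)"
    have A: "?A \<in> carrier_mat 3 3" using ws(1) by auto
    have "det ?A \<noteq> 0" using U unfolding U_det_def M cols_mat_of_cols[OF ws(2)] .
    from det_solve[OF A this unit_vec_carrier] obtain v where v: "v \<in> carrier_vec 3" "?A *\<^sub>v v = unit_vec 3 0" by blast
    have idx: "(\<Sum>j<3. v $ j * (ws ! j) $ i) = unit_vec 3 0 $ i" if "i < 3" for i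
    proof -
      have "(?A *\<^sub>v v) $ i = (\<Sum>j<3. v $ j * (ws ! j) $ i)"
        using that v(1) A ws(1)
        by (auto simp: scalar_prod_def mat_of_cols_index atLeast0LessThan mult.commute intro!: sum.cong)
      then show ?thesis using v(2) by simp
    qed
    have "(\<Sum>j<3. v $ j * (ws ! j) $ 0) = 1" "(\<Sum>j<3. v $ j * (ws ! j) $ 1) = 0" "(\<Sum>j<3. v $ j * (ws ! j) $ 2) = 0"
      using idx[of 0] idx[of 1] idx[of 2] by simp_all
    then have "(\<Sum>j<3. K (v $ j) * low (ws ! j)) = 1" unfolding low_sum by simp
    then show ?thesis using mem[of "{..<3}" "\<lambda>j. v $ j"] by (intro exI[of _ v]) simp
  qed
qed

subsection \<open>Coordinates in the quotient of the third step\<close>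

definition VQ :: "'k fls \<Rightarrow> 'k fls set" where
  "VQ s = {s * h + w | h w. h \<in> Fil 8 \<and> w \<in> Fil 8}"

definition mid :: "'k vec \<Rightarrow> 'k fls" where
  "mid v = K (v $ 0) * (X\<^sup>2 * Y) + K (v $ 1) * (X * Y\<^sup>2) + K (v $ 2) * (X\<^sup>2 * Y\<^sup>2)"

lemma K_lincomb3:
  fixes m0 m1 m2 :: "'k fls"
  shows "K k * (K a * m0 + K b * m1 + K d * m2) = K (k * a) * m0 + K (k * b) * m1 + K (k * d) * m2"
    "(K a * m0 + K b * m1 + K d * m2) + (K a' * m0 + K b' * m1 + K d' * m2) =
      K (a + a') * m0 + K (b + b') * m1 + K (d + d') * m2"
    "(K a * m0 + K b * m1 + K d * m2) - (K a' * m0 + K b' * m1 + K d' * m2) =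
      K (a - a') * m0 + K (b - b') * m1 + K (d - d') * m2"
  by (simp_all add: algebra_simps flip: fls_plus_const fls_minus_const fls_const_mult_const)

lemma mid_sum:
  "(\<Sum>j\<in>A. K (a j) * mid (w j)) = K (\<Sum>j\<in>A. a j * w j $ 0) * (X\<^sup>2 * Y) +
   K (\<Sum>j\<in>A. a j * w j $ 1) * (X * Y\<^sup>2) + K (\<Sum>j\<in>A. a j * w j $ 2) * (X\<^sup>2 * Y\<^sup>2)"
proof (induction A rule: infinite_finite_induct)
  case (insert x A)
  show ?case unfolding sum.insert[OF insert.hyps] insert.IH unfolding mid_def K_lincomb3 ..
qed simp_all

lemma VQ_subspace: "V.subspace (VQ s)"
  unfolding V.subspace_def
proof (intro conjI ballI allI)
  show "0 \<in> VQ s" unfolding VQ_def by (auto intro!: exI[of _ 0])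
  fix x assume "x \<in> VQ s"
  then obtain h w where x: "x = s * h + w" "h \<in> Fil 8" "w \<in> Fil 8" unfolding VQ_def by blast
  show "K k * x \<in> VQ s" for k
  proof -
    have "K k * x = s * (K k * h) + K k * w" unfolding x(1) by (simp add: algebra_simps)
    then show ?thesis using x Fil_lincomb(5) unfolding VQ_def by blast
  qed
  fix y assume "y \<in> VQ s"
  then obtain h' w' where y: "y = s * h' + w'" "h' \<in> Fil 8" "w' \<in> Fil 8" unfolding VQ_def by blast
  have "x + y = s * (h + h') + (w + w')" unfolding x(1) y(1) by (simp add: algebra_simps)
  then show "x + y \<in> VQ s" using x y Fil_lincomb(2) unfolding VQ_def by blast
qed

lemma VQ_S: "s \<in> S \<Longrightarrow> VQ s \<subseteq> S"
  unfolding VQ_def using Fil_S by blast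

lemma Fil_8_VQ: "w \<in> Fil 8 \<Longrightarrow> w \<in> VQ s"
proof -
  assume w: "w \<in> Fil 8"
  then have "s * 0 + w \<in> VQ s" unfolding VQ_def using Fil_lincomb(1) by blast
  then show ?thesis by simp
qed

text \<open>The pole orders in \<open>s W^8\<close> are those of \<open>W^8\<close> raised by 9.\<close>

lemma VQ_lead:
  assumes s: "s - X ^ 3 \<in> Fil 8" and z: "z \<in> VQ s" "has_lead n z"
  shows "n \<notin> {10, 11, 14}"
proof -
  obtain h w where hw: "z = s * h + w" "h \<in> Fil 8" "w \<in> Fil 8" using z(1) unfolding VQ_def by blast
  note lz = has_lead_subdegree[OF z(2)]
  show ?thesis
  proof (cases "h = 0")
    case True
    then have "z \<in> Fil 8" using hw by simp
    then have "- 8 \<le> fls_subdegree z" using lz has_degree_le_subdegree[of z 8] by (simp add: Fil_def)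
    then show ?thesis using lz by auto
  next
    case False
    define m where "m = - fls_subdegree h"
    have m: "m \<in> pole_orders" "has_lead m h" using S_subdegree subdegree_has_lead Fil_S[OF hw(2)] False by (auto simp: m_def)
    have "w \<in> Fil (9 + m - 1)" using hw(3) Fil_mono[of 8 "9 + m - 1"] m(1) by (auto simp: pole_orders_def)
    from has_lead_add[OF has_lead_mult[OF lead_s[OF s] m(2)] this] have "has_lead (9 + m) z" unfolding hw(1) .
    then have "n = 9 + m" using has_lead_subdegree[of "9 + m" z] lz by simp
    then show ?thesis using m(1) by (auto simp: pole_orders_def)
  qed
qed

lemma mid_leads: "has_lead 10 (X\<^sup>2 * Y)" "has_lead 11 (X * Y\<^sup>2)" "has_lead 14 (X\<^sup>2 * Y\<^sup>2)"
  using has_lead_XY[of 2 1] has_lead_XY[of 1 2] has_lead_XY[of 2 2] by simp_all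

lemma mid_in_VQ:
  assumes s: "s - X ^ 3 \<in> Fil 8" and z: "K a * (X\<^sup>2 * Y) + K b * (X * Y\<^sup>2) + K e * (X\<^sup>2 * Y\<^sup>2) + w \<in> VQ s" and w: "w \<in> Fil 8"
  shows "a = 0 \<and> b = 0 \<and> e = 0"
proof -
  have F: "X\<^sup>2 * Y \<in> Fil 10" "X * Y\<^sup>2 \<in> Fil 11" "X\<^sup>2 * Y \<in> Fil 13" "X * Y\<^sup>2 \<in> Fil 13" "w \<in> Fil 13" "w \<in> Fil 10" "w \<in> Fil 9"
    using has_lead_Fil[OF mid_leads(1), of 10] has_lead_Fil[OF mid_leads(2), of 11] has_lead_Fil[OF mid_leads(1), of 13]
      has_lead_Fil[OF mid_leads(2), of 13] subsetD[OF Fil_mono[of 8 13] w] subsetD[OF Fil_mono[of 8 10] w]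
      subsetD[OF Fil_mono[of 8 9] w] by simp_all
  have e: "e = 0"
  proof (rule ccontr)
    assume "e \<noteq> 0"
    have "K a * (X\<^sup>2 * Y) + K b * (X * Y\<^sup>2) + w \<in> Fil (14 - 1)" using F by auto
    from has_lead_add[OF has_lead_scale[OF mid_leads(3) \<open>e \<noteq> 0\<close>] this] VQ_lead[OF s z, of 14] show False by (simp add: add_ac)
  qed
  have b: "b = 0"
  proof (rule ccontr)
    assume "b \<noteq> 0"
    have "K a * (X\<^sup>2 * Y) + w \<in> Fil (11 - 1)" using F by auto
    from has_lead_add[OF has_lead_scale[OF mid_leads(2) \<open>b \<noteq> 0\<close>] this] VQ_lead[OF s z, of 11] e show False by (simp add: add_ac)
  qed
  have "a = 0"
  proof (rule ccontr)
    assume "a \<noteq> 0"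
    have "w \<in> Fil (10 - 1)" using F by auto
    from has_lead_add[OF has_lead_scale[OF mid_leads(1) \<open>a \<noteq> 0\<close>] this] VQ_lead[OF s z, of 10] b e show False by simp
  qed
  then show ?thesis using b e by simp
qed

text \<open>Of the pole orders up to 17, only 10, 11 and 14 are missing in \<open>s W^8 + W^8\<close>.\<close>

lemma mid_cover:
  assumes s: "s - X ^ 3 \<in> Fil 8" and z: "z \<in> Fil 17"
  shows "\<exists>v\<in>carrier_vec 3. z - mid v \<in> VQ s"
proof -
  let ?T = "{q + mid v | q v. q \<in> VQ s \<and> v \<in> carrier_vec 3}"
  have T: "V.subspace ?T"
    unfolding V.subspace_def
  proof (intro conjI ballI allI)
    have "mid (0\<^sub>v 3) = 0" by (simp add: mid_def)
    moreover have "0 + mid (0\<^sub>v 3) \<in> ?T" using V.subspace_0[OF VQ_subspace[of s]] zero_carrier_vec[of 3] by blast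
    ultimately show "0 \<in> ?T" by simp
    fix x assume "x \<in> ?T"
    then obtain q v where x: "x = q + mid v" "q \<in> VQ s" "v \<in> carrier_vec 3" by blast
    show "K k * x \<in> ?T" for k
    proof -
      have "K k * mid v = mid (k \<cdot>\<^sub>v v)" using x(3) unfolding mid_def K_lincomb3 by simp
      then have "K k * x = K k * q + mid (k \<cdot>\<^sub>v v)" unfolding x(1) by (simp add: distrib_left)
      moreover have "k \<cdot>\<^sub>v v \<in> carrier_vec 3" using x(3) by simp
      ultimately show ?thesis using V.subspace_scale[OF VQ_subspace x(2)] by blast
    qed
    fix y assume "y \<in> ?T"
    then obtain q' v' where y: "y = q' + mid v'" "q' \<in> VQ s" "v' \<in> carrier_vec 3" by blast
    have "mid v + mid v' = mid (v + v')" using x(3) y(3) unfolding mid_def K_lincomb3 by simp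
    then have "x + y = (q + q') + mid (v + v')" unfolding x(1) y(1) by (simp add: algebra_simps)
    moreover have "v + v' \<in> carrier_vec 3" using x(3) y(3) by simp
    ultimately show "x + y \<in> ?T" using V.subspace_add[OF VQ_subspace x(2) y(2)] by blast
  qed
  have VT: "q \<in> ?T" if "q \<in> VQ s" for q
  proof -
    have "q = q + mid (0\<^sub>v 3)" by (simp add: mid_def)
    then show ?thesis using that zero_carrier_vec[of 3] by blast
  qed
  have MT: "mid v \<in> ?T" if "v \<in> carrier_vec 3" for v
  proof -
    have "mid v = 0 + mid v" by simp
    then show ?thesis using that V.subspace_0[OF VQ_subspace] by blast
  qed
  have "\<exists>t\<in>?T. z - t \<in> Fil (- 1)"
  proof (rule Fil_descend[OF T, where n = 18])
    show "z \<in> Fil (- 1 + int 18)" using z by simp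
    fix i assume i: "i \<le> - 1 + int 18" "i \<in> pole_orders"
    have "\<exists>e\<in>?T. has_lead i e"
    proof (cases "i - 9 \<in> pole_orders")
      case True
      from has_lead_mult[OF lead_s[OF s] has_lead_mon[OF True]] have l: "has_lead i (s * mon (i - 9))" by simp
      have "mon (i - 9) \<in> Fil 8" using has_lead_Fil[OF has_lead_mon[OF True]] i(1) by simp
      then have "s * mon (i - 9) + 0 \<in> VQ s" unfolding VQ_def using Fil_lincomb(1) by blast
      then have "s * mon (i - 9) \<in> VQ s" by simp
      from VT[OF this] l show ?thesis by blast
    next
      case False
      then have "i \<le> 8 \<or> i = 10 \<or> i = 11 \<or> i = 14" using i by (auto simp: pole_orders_def)
      moreover have "\<exists>e\<in>?T. has_lead i e" if "i \<le> 8"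
        using VT[OF Fil_8_VQ[OF has_lead_Fil[OF has_lead_mon[OF i(2)] that]]] has_lead_mon[OF i(2)] by blast
      moreover have "mid (unit_vec 3 0) = X\<^sup>2 * Y" "mid (unit_vec 3 1) = X * Y\<^sup>2" "mid (unit_vec 3 2) = X\<^sup>2 * Y\<^sup>2"
        by (simp_all add: mid_def)
      then have "X\<^sup>2 * Y \<in> ?T" "X * Y\<^sup>2 \<in> ?T" "X\<^sup>2 * Y\<^sup>2 \<in> ?T"
        using MT[OF unit_vec_carrier[of 3 0]] MT[OF unit_vec_carrier[of 3 1]] MT[OF unit_vec_carrier[of 3 2]] by simp_all
      ultimately show ?thesis using mid_leads by blast
    qed
    then show "\<exists>e\<in>?T \<inter> Fil i. fls_nth e (- i) \<noteq> 0" unfolding has_lead_def by blast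
  qed
  then obtain q v where "v \<in> carrier_vec 3" "q \<in> VQ s" "z = q + mid v" unfolding Fil_neg by auto
  then show ?thesis by (intro bexI[of _ v]) auto
qed

lemma mid_unique:
  assumes s: "s - X ^ 3 \<in> Fil 8" and v: "v \<in> carrier_vec 3" "z - mid v \<in> VQ s" and w: "w \<in> carrier_vec 3" "z - mid w \<in> VQ s"
  shows "v = w"
proof -
  have "(z - mid w) - (z - mid v) \<in> VQ s" by (rule V.subspace_diff[OF VQ_subspace w(2) v(2)])
  moreover have "(z - mid w) - (z - mid v) = mid v - mid w" by simp
  ultimately have "mid v - mid w \<in> VQ s" by simp
  then have "K (v $ 0 - w $ 0) * (X\<^sup>2 * Y) + K (v $ 1 - w $ 1) * (X * Y\<^sup>2) + K (v $ 2 - w $ 2) * (X\<^sup>2 * Y\<^sup>2) + 0 \<in> VQ s"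
    unfolding mid_def K_lincomb3 by simp
  from mid_in_VQ[OF s this] have c: "v $ 0 = w $ 0" "v $ 1 = w $ 1" "v $ 2 = w $ 2" by auto
  show "v = w"
  proof (rule eq_vecI)
    fix i assume "i < dim_vec w"
    then have "i = 0 \<or> i = 1 \<or> i = 2" using w(1) by auto
    then show "v $ i = w $ i" using c by auto
  qed (use v w in auto)
qed

lemma mid_S: "mid v \<in> S" unfolding mid_def by auto

lemma image_in_V:
  assumes s: "s - X ^ 3 \<in> Fil 8" and z: "z \<in> Fil 17"
  shows "image_in_V c (el s) (el z) \<in> carrier_vec 3" "z - mid (image_in_V c (el s) (el z)) \<in> VQ s"
    "v \<in> carrier_vec 3 \<Longrightarrow> z - mid v \<in> VQ s \<Longrightarrow> image_in_V c (el s) (el z) = v"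
proof -
  have sS: "s \<in> S" using lead_s[OF s] Fil_S by (auto simp: has_lead_def)
  have zS: "z \<in> S" by (rule Fil_S[OF z])
  have W8: "Fil 8 \<subseteq> S" "(*) s ` Fil 8 \<subseteq> S" using sS by (auto simp: Fil_def)
  have "(el s <#\<^bsub>R\<^esub> W c 8) <+>\<^bsub>R\<^esub> W c 8 = el ` {a + b | a b. a \<in> (*) s ` Fil 8 \<and> b \<in> Fil 8}"
    unfolding W_eq using el_set_mult[OF sS W8(1)] el_set_add[OF W8(2,1)] by simp
  also have "{a + b | a b. a \<in> (*) s ` Fil 8 \<and> b \<in> Fil 8} = VQ s" unfolding VQ_def by blast
  finally have V: "(el s <#\<^bsub>R\<^esub> W c 8) <+>\<^bsub>R\<^esub> W c 8 = el ` VQ s" .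
  have e: "cls c (cst (v $ 0) * XX ^ 2 * YY + cst (v $ 1) * XX * YY ^ 2 + cst (v $ 2) * XX ^ 2 * YY ^ 2) = el (mid v)" for v
    by (simp only: cls_el mid_def ev.hom_add ev.hom_mult ev.hom_power ev_cst ev_XX ev_YY mult.assoc)
  have m: "el z \<ominus>\<^bsub>R\<^esub> el (mid v) \<in> el ` VQ s \<longleftrightarrow> z - mid v \<in> VQ s" for v
  proof -
    have zm: "z - mid v \<in> S" using zS mid_S by simp
    have "el (z - mid v) \<in> el ` VQ s \<longleftrightarrow> z - mid v \<in> VQ s"
    proof
      assume "el (z - mid v) \<in> el ` VQ s"
      then obtain q where "q \<in> VQ s" "el (z - mid v) = el q" by blast
      then show "z - mid v \<in> VQ s" using el_eq_iff[OF zm] VQ_S[OF sS] by auto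
    qed blast
    then show ?thesis using zS mid_S by (simp add: el_minus)
  qed
  obtain v where v: "v \<in> carrier_vec 3" "z - mid v \<in> VQ s" using mid_cover[OF s z] by blast
  have "image_in_V c (el s) (el z) = (THE v. v \<in> carrier_vec 3 \<and> z - mid v \<in> VQ s)"
    unfolding image_in_V_def Let_def e V m ..
  also have "\<dots> = v" by (rule the_equality) (use v mid_unique[OF s] in blast)+
  finally have i: "image_in_V c (el s) (el z) = v" .
  show "image_in_V c (el s) (el z) \<in> carrier_vec 3" "z - mid (image_in_V c (el s) (el z)) \<in> VQ s"
    unfolding i using v by auto
  show "image_in_V c (el s) (el z) = v'" if "v' \<in> carrier_vec 3" "z - mid v' \<in> VQ s" for v'
    unfolding i by (rule mid_unique[OF s v that])
qed

end

section \<open>The second inversion and the returned divisor\<close>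

context c34
begin

lemma monic_el: "monic_F c a b e = el (Fp a b e)" "monic_G c a b e = el (Gp a b e)"
  by (simp_all only: monic_F_def monic_G_def cls_el Fp_def Gp_def ev.hom_add ev.hom_mult ev.hom_power ev_cst ev_XX ev_YY)

lemma F_of_el: "F_of c r = el (Fp (ra r) (rb r) (rc r))"
  and G_of_el: "G_of c r = el (Gp (rd r) (re r) (rf r))"
  by (simp_all add: F_of_def G_of_def monic_el)

definition cof :: "'k fls list" where "cof = [1, X, Y, X\<^sup>2, X * Y]"

definition colV :: "'k fls \<Rightarrow> 'k fls \<Rightarrow> nat \<Rightarrow> 'k vec" where
  "colV s t j = image_in_V c (el s) (el (cof ! j * t))"

lemma M2_matrix_el:
  assumes "t \<in> S"
  shows "M2_matrix c (el s) (el t) = mat_of_cols 3 (map (colV s t) [0..<5])"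
proof -
  have "ev [:0, [:0, 1:]:] = X * Y" by (simp add: ev_pCons ev_x_pCons mult.commute)
  then show ?thesis using assms
    by (simp add: M2_matrix_def colV_def cof_def upt_rec cls_el el_mult ev.hom_mult ev.hom_power ev_XX ev_YY)
qed

lemma cof_Fil:
  assumes t: "has_lead 10 t"
  shows "j < 5 \<Longrightarrow> cof ! j * t \<in> Fil 17"
    "has_lead 13 (X * t)" "has_lead 14 (Y * t)"
proof -
  show "has_lead 13 (X * t)" "has_lead 14 (Y * t)"
    using has_lead_mult[OF has_lead_base(2) t] has_lead_mult[OF has_lead_base(3) t] by simp_all
  assume "j < 5"
  then have j: "j = 0 \<or> j = 1 \<or> j = 2 \<or> j = 3 \<or> j = 4" by linarith
  have "cof ! j \<in> Fil 7"
    using j has_lead_Fil[OF has_lead_base(1), of 7] has_lead_Fil[OF has_lead_base(2), of 7] has_lead_Fil[OF has_lead_base(3), of 7]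
      has_lead_Fil[OF has_lead_base(4), of 7] has_lead_Fil[OF has_lead_base(5), of 7]
    by (auto simp: cof_def)
  moreover have "t \<in> Fil 10" using t by (simp add: has_lead_def)
  ultimately have "cof ! j * t \<in> Fil (7 + 10)" by (rule Fil_mult)
  then show "cof ! j * t \<in> Fil 17" by simp
qed

text \<open>The first three columns of \<open>M''\<close> form an upper triangular matrix with the diagonal \<open>1, beta2, 1\<close>: \<open>x t\<close> and \<open>y t\<close>
  have pole orders 13 and 14, and 14 is not a pole order of \<open>s W^8 + W^8\<close>.\<close>

lemma colV:
  assumes s: "s - X ^ 3 \<in> Fil 8" and t: "t - X\<^sup>2 * Y \<in> Fil 8"
  shows "j < 5 \<Longrightarrow> colV s t j \<in> carrier_vec 3" "j < 5 \<Longrightarrow> cof ! j * t - mid (colV s t j) \<in> VQ s"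
    "colV s t 0 $ 0 = 1" "colV s t 0 $ 1 = 0" "colV s t 0 $ 2 = 0" "colV s t 1 $ 2 = 0" "colV s t 2 $ 2 = 1"
proof -
  note lt = lead_t[OF t]
  show car: "colV s t j \<in> carrier_vec 3" and mem: "cof ! j * t - mid (colV s t j) \<in> VQ s" if "j < 5" for j
    using image_in_V(1,2)[OF s cof_Fil(1)[OF lt that]] by (simp_all add: colV_def)
  have "mid (unit_vec 3 0) = X\<^sup>2 * Y" by (simp add: mid_def)
  then have "cof ! 0 * t - mid (unit_vec 3 0) \<in> VQ s" using Fil_8_VQ[OF t] by (simp add: cof_def)
  then have "colV s t 0 = unit_vec 3 0"
    unfolding colV_def by (intro image_in_V(3)[OF s cof_Fil(1)[OF lt]]) auto
  then show "colV s t 0 $ 0 = 1" "colV s t 0 $ 1 = 0" "colV s t 0 $ 2 = 0" by simp_all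
  have F: "X\<^sup>2 * Y \<in> Fil 13" "X * Y\<^sup>2 \<in> Fil 13"
    using has_lead_Fil[OF mid_leads(1), of 13] has_lead_Fil[OF mid_leads(2), of 13] by simp_all
  show "colV s t 1 $ 2 = 0"
  proof (rule ccontr)
    let ?v = "colV s t 1"
    assume "?v $ 2 \<noteq> 0"
    then have l: "has_lead 14 (K (- (?v $ 2)) * (X\<^sup>2 * Y\<^sup>2))" by (intro has_lead_scale mid_leads) simp
    have "X * t - K (?v $ 0) * (X\<^sup>2 * Y) - K (?v $ 1) * (X * Y\<^sup>2) \<in> Fil (14 - 1)"
      using has_lead_Fil[OF cof_Fil(2)[OF lt], of 13] F by auto
    from has_lead_add[OF l this] have "has_lead 14 (X * t - mid ?v)" by (simp add: mid_def algebra_simps)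
    moreover have "X * t - mid ?v \<in> VQ s" using mem[of 1] by (simp add: cof_def)
    ultimately show False using VQ_lead[OF s, of _ 14] by blast
  qed
  show "colV s t 2 $ 2 = 1"
  proof (rule ccontr)
    let ?v = "colV s t 2"
    assume "?v $ 2 \<noteq> 1"
    then have l: "has_lead 14 (K (1 - ?v $ 2) * (X\<^sup>2 * Y\<^sup>2))" by (intro has_lead_scale mid_leads) simp
    have "Y * (t - X\<^sup>2 * Y) \<in> Fil (4 + 8)" using Fil_mult[OF _ t, of Y 4] has_lead_base(3) by (simp add: has_lead_def)
    then have "Y * (t - X\<^sup>2 * Y) \<in> Fil 13" using Fil_mono[of 12 13] by auto
    then have "Y * (t - X\<^sup>2 * Y) - K (?v $ 0) * (X\<^sup>2 * Y) - K (?v $ 1) * (X * Y\<^sup>2) \<in> Fil (14 - 1)"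
      using F by auto
    from has_lead_add[OF l this] have "has_lead 14 (Y * t - mid ?v)"
      by (simp add: mid_def algebra_simps power2_eq_square flip: fls_minus_const)
    moreover have "Y * t - mid ?v \<in> VQ s" using mem[of 2] by (simp add: cof_def)
    ultimately show False using VQ_lead[OF s, of _ 14] by blast
  qed
qed

lemma M2_kernel:
  assumes s: "s - X ^ 3 \<in> Fil 8" and t: "t - X\<^sup>2 * Y \<in> Fil 8"
  defines "M \<equiv> M2_matrix c (el s) (el t)"
  shows "v \<in> mat_kernel M \<longleftrightarrow> v \<in> carrier_vec 5 \<and> (\<forall>i<3. (\<Sum>j<5. v $ j * colV s t j $ i) = 0)"
    "beta2 M = colV s t 1 $ 1" "gamma4 M = colV s t 3 $ 2"
proof -
  have tS: "t \<in> S" using lead_t[OF t] Fil_S by (auto simp: has_lead_def)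
  note M = M2_matrix_el[OF tS, of s, folded M_def]
  have ws: "length (map (colV s t) [0..<5]) = 5" "set (map (colV s t) [0..<5]) \<subseteq> carrier_vec 3"
    using colV(1)[OF s t] by auto
  have "(\<Sum>j<5. v $ j * (map (colV s t) [0..<5] ! j) $ i) = (\<Sum>j<5. v $ j * colV s t j $ i)" for i
    by (intro sum.cong) auto
  then show "v \<in> mat_kernel M \<longleftrightarrow> v \<in> carrier_vec 5 \<and> (\<forall>i<3. (\<Sum>j<5. v $ j * colV s t j $ i) = 0)"
    unfolding M mat_kernel_of_cols[OF ws] by simp
  show "beta2 M = colV s t 1 $ 1" "gamma4 M = colV s t 3 $ 2"
    unfolding beta2_def gamma4_def M by (simp_all add: mat_of_cols_index)
qed

lemma M2_kernel_VQ:
  assumes s: "s - X ^ 3 \<in> Fil 8" and t: "t - X\<^sup>2 * Y \<in> Fil 8"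
    and v: "v \<in> mat_kernel (M2_matrix c (el s) (el t))"
  shows "(\<Sum>j<5. K (v $ j) * (cof ! j * t)) \<in> VQ s"
proof -
  have "\<forall>i<3. (\<Sum>j<5. v $ j * colV s t j $ i) = 0" using v M2_kernel(1)[OF s t] by blast
  then have "(\<Sum>j<5. K (v $ j) * mid (colV s t j)) = 0" unfolding mid_sum by simp
  then have "(\<Sum>j<5. K (v $ j) * (cof ! j * t)) = (\<Sum>j<5. K (v $ j) * (cof ! j * t - mid (colV s t j)))"
    by (simp add: right_diff_distrib sum_subtractf)
  also have "\<dots> \<in> VQ s" using colV(2)[OF s t] by (intro V.subspace_sum V.subspace_scale VQ_subspace) auto
  finally show ?thesis .
qed

text \<open>In the last row of \<open>M''\<close> the first three entries are \<open>0, 0, 1\<close>, so the last coordinate of the kernel equation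
  is \<open>a'' + gamma4 = 0\<close>.\<close>

lemma step3_facts:
  assumes s: "s - X ^ 3 \<in> Fil 8" and t: "t - X\<^sup>2 * Y \<in> Fil 8" and r: "step3 (M2_matrix c (el s) (el t)) r"
  shows "ra r \<noteq> 0" "r_ainv r = inverse (ra r)"
    "Fp (ra r) (rb r) (rc r) * t \<in> VQ s" "Gp (rd r) (re r) (rf r) * t \<in> VQ s"
proof -
  let ?M = "M2_matrix c (el s) (el t)"
  let ?v = "vec_of_list [rc r, rb r, ra r, 1, 0]" and ?w = "vec_of_list [rf r, re r, rd r, 0, 1]"
  have r': "beta2 ?M * gamma4 ?M \<noteq> 0" "?v \<in> mat_kernel ?M" "?w \<in> mat_kernel ?M"
    "r_ainv r = - beta2 ?M * inverse (beta2 ?M * gamma4 ?M)"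
    using r by (simp_all add: step3_def del: vec_of_list_Cons)
  have "(\<Sum>j<5. ?v $ j * colV s t j $ 2) = 0" using r'(2) M2_kernel(1)[OF s t] by auto
  then have "ra r + gamma4 ?M = 0"
    unfolding sum_lessThan_5 vec_of_list_5 M2_kernel(3)[OF s t] by (simp add: colV(5,6,7)[OF s t, simplified])
  then have g: "ra r = - gamma4 ?M" by (simp add: eq_neg_iff_add_eq_0)
  then show "ra r \<noteq> 0" using r'(1) by auto
  show "r_ainv r = inverse (ra r)" unfolding r'(4) g using r'(1) by (simp add: field_simps)
  have "(\<Sum>j<5. K (?v $ j) * (cof ! j * t)) = Fp (ra r) (rb r) (rc r) * t"
    unfolding sum_lessThan_5 vec_of_list_5 by (simp add: cof_def Fp_def algebra_simps)
  then show "Fp (ra r) (rb r) (rc r) * t \<in> VQ s" using M2_kernel_VQ[OF s t r'(2)] by simp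
  have "(\<Sum>j<5. K (?w $ j) * (cof ! j * t)) = Gp (rd r) (re r) (rf r) * t"
    unfolding sum_lessThan_5 vec_of_list_5 by (simp add: cof_def Gp_def algebra_simps)
  then show "Gp (rd r) (re r) (rf r) * t \<in> VQ s" using M2_kernel_VQ[OF s t r'(3)] by simp
qed

lemma all_less_3: "(\<forall>i<3. P i) \<longleftrightarrow> P 0 \<and> P 1 \<and> P (2::nat)"
proof -
  have "i < 3 \<longleftrightarrow> i = 0 \<or> i = 1 \<or> i = 2" for i :: nat by auto
  then show ?thesis by auto
qed

text \<open>Back substitution in the triangular system of \<open>colV\<close>, with arbitrary values in the last two places.\<close>

lemma step3_exists:
  assumes s: "s - X ^ 3 \<in> Fil 8" and t: "t - X\<^sup>2 * Y \<in> Fil 8"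
  defines "M \<equiv> M2_matrix c (el s) (el t)"
  assumes nz: "beta2 M * gamma4 M \<noteq> 0"
  shows "\<exists>r. step3 M r"
proof -
  have b: "colV s t 1 $ 1 \<noteq> 0" using nz M2_kernel(2)[OF s t] by (auto simp: M_def)
  note col = colV(3-7)[OF s t]
  have ex: "\<exists>a b e. vec_of_list [e, b, a, k, l] \<in> mat_kernel M" for k l
  proof -
    define C where "C = (\<lambda>i. k * colV s t 3 $ i + l * colV s t 4 $ i)"
    define a where "a = - C 2"
    define b' where "b' = - (a * colV s t 2 $ 1 + C 1) / colV s t 1 $ 1"
    define e where "e = - (b' * colV s t 1 $ 0 + a * colV s t 2 $ 0 + C 0)"
    have 1: "b' * colV s t 1 $ 1 = - (a * colV s t 2 $ 1 + C 1)" using b by (simp add: b'_def)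
    have "vec_of_list [e, b', a, k, l] \<in> mat_kernel M"
      unfolding M_def M2_kernel(1)[OF s t] all_less_3 sum_lessThan_5 vec_of_list_5 col
      using vec_of_list_5(1)[of e b' a k l] 1
      by (simp add: a_def e_def C_def algebra_simps del: vec_of_list_Cons)
    then show ?thesis by blast
  qed
  obtain a b' e where 1: "vec_of_list [e, b', a, 1, 0] \<in> mat_kernel M" using ex by blast
  obtain d e' f where 2: "vec_of_list [f, e', d, 0, 1] \<in> mat_kernel M" using ex by blast
  have "step3 M (Rep a b' e d e' f (- beta2 M * inverse (beta2 M * gamma4 M)))"
    unfolding step3_def using 1 2 nz by (simp del: vec_of_list_Cons)
  then show ?thesis by blast
qed

lemma step4_iff:
  "step4 c r out \<longleftrightarrow> ra out = ra r \<and> rb out = rb r \<and> rc out = rc r \<and> r_ainv out = r_ainv r \<and>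
     (\<exists>H\<in>Fil 8. Gp (rd out) (re out) (rf out) * Gp (rd r) (re r) (rf r) + Fp (ra r) (rb r) (rc r) * H \<in> Fil 5)"
proof -
  have "(\<exists>H\<in>W c 8. G_of c out \<otimes>\<^bsub>R\<^esub> G_of c r \<oplus>\<^bsub>R\<^esub> F_of c r \<otimes>\<^bsub>R\<^esub> H \<in> W c 5) \<longleftrightarrow>
     (\<exists>H\<in>Fil 8. Gp (rd out) (re out) (rf out) * Gp (rd r) (re r) (rf r) + Fp (ra r) (rb r) (rc r) * H \<in> Fil 5)"
  proof -
    have e: "G_of c out \<otimes>\<^bsub>R\<^esub> G_of c r \<oplus>\<^bsub>R\<^esub> F_of c r \<otimes>\<^bsub>R\<^esub> el H =
        el (Gp (rd out) (re out) (rf out) * Gp (rd r) (re r) (rf r) + Fp (ra r) (rb r) (rc r) * H)" if "H \<in> Fil 8" for H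
      using Fil_S[OF that] by (simp add: F_of_el G_of_el el_mult el_add)
    have w: "el (Gp (rd out) (re out) (rf out) * Gp (rd r) (re r) (rf r) + Fp (ra r) (rb r) (rc r) * H) \<in> W c 5 \<longleftrightarrow>
        Gp (rd out) (re out) (rf out) * Gp (rd r) (re r) (rf r) + Fp (ra r) (rb r) (rc r) * H \<in> Fil 5" if "H \<in> Fil 8" for H
      using W_iff[of _ 5] Fil_S[OF that] by simp
    show ?thesis unfolding W_eq[of 8] bex_simps using e w by (simp add: image_iff) 
  qed
  then show ?thesis unfolding step4_def Let_def by simp
qed

text \<open>The space required for typicality is obtained by elimination with \<open>F\<close> and \<open>G\<close> from pole order 12 down to 5.\<close>

lemma typical_FG:
  assumes g: "good c D" "divdeg c D = 3" and a: "a \<noteq> 0" and F: "Fp a b e \<in> ID (coef D)" and G: "Gp d e' f \<in> ID (coef D)"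
  shows "typical c D"
proof -
  let ?F = "Fp a b e" and ?G = "Gp d e' f"
  have FW: "el ?F \<in> WD c 6 D" "el ?G \<in> WD c 7 D"
    using WD_iff[OF g(1)] F G has_lead_Fil[OF lead_Fp, of 6] has_lead_Fil[OF lead_Gp, of 7] by simp_all
  have sub: "Fil n \<subseteq> S" for n by (auto simp: Fil_def)
  have sm: "(*) z ` Fil n \<subseteq> S" if "z \<in> S" for z n using that by (auto simp: Fil_def)
  let ?A = "{x + y | x y. x \<in> (*) ?F ` Fil 6 \<and> y \<in> (*) ?G ` Fil 5}"
  have A: "?A \<subseteq> S" using sm[OF Fp_S] sm[OF Gp_S] by blast
  have "((el ?F <#\<^bsub>R\<^esub> W c 6) <+>\<^bsub>R\<^esub> (el ?G <#\<^bsub>R\<^esub> W c 5)) <+>\<^bsub>R\<^esub> W c 5 = el ` {x + y | x y. x \<in> ?A \<and> y \<in> Fil 5}"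
    unfolding W_eq using el_set_mult[OF Fp_S sub] el_set_mult[OF Gp_S sub] el_set_add[OF sm[OF Fp_S] sm[OF Gp_S]]
      el_set_add[OF A sub] by simp
  also have "{x + y | x y. x \<in> ?A \<and> y \<in> Fil 5} = Fil 12"
  proof (intro equalityI subsetI)
    fix z assume "z \<in> {x + y | x y. x \<in> ?A \<and> y \<in> Fil 5}"
    then obtain u v w where z: "z = ?F * u + ?G * v + w" "u \<in> Fil 6" "v \<in> Fil 5" "w \<in> Fil 5" by blast
    have "?F * u \<in> Fil 12" "?G * v \<in> Fil 12"
      using z lead_Fp[of a b e] lead_Gp[of d e' f] Fil_mult[of ?F 6 u 6] Fil_mult[of ?G 7 v 5] by (simp_all add: has_lead_def)
    moreover have "w \<in> Fil 12" using z(4) Fil_mono[of 5 12] by auto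
    ultimately show "z \<in> Fil 12" unfolding z(1) by auto
  next
    fix z assume "z \<in> Fil 12"
    then have "z \<in> Fil (5 + int 7)" by simp
    from FG_span[OF a _ _ _ this, where m = 6 and l = 5 and b = b and e = e and d = d and e' = e' and f = f]
    obtain u v where uv: "u \<in> Fil 6" "v \<in> Fil 5" "z - (?F * u + ?G * v) \<in> Fil 5" by auto
    have "z = (?F * u + ?G * v) + (z - (?F * u + ?G * v))" by simp
    then show "z \<in> {x + y | x y. x \<in> ?A \<and> y \<in> Fil 5}" using uv by blast
  qed
  finally have e: "((el ?F <#\<^bsub>R\<^esub> W c 6) <+>\<^bsub>R\<^esub> (el ?G <#\<^bsub>R\<^esub> W c 5)) <+>\<^bsub>R\<^esub> W c 5 = W c 12"
    unfolding W_eq by simp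
  have n: "nat (divdeg c D) = 3" "int genus \<le> divdeg c D" using g(2) by simp_all
  have num: "(3::nat) + 3 = 6" "(6::nat) + 1 = 7" "2 * 3 = (6::nat)" "(6::nat) - 1 = 5" "3 * 3 = (9::nat)" "(3::nat) + 9 = 12"
    by simp_all
  have "\<exists>s\<in>WD c 6 D. \<exists>t\<in>WD c 7 D. ((s <#\<^bsub>R\<^esub> W c 6) <+>\<^bsub>R\<^esub> (t <#\<^bsub>R\<^esub> W c 5)) <+>\<^bsub>R\<^esub> W c 5 = W c 12"
    by (rule bexI[OF _ FW(1)], rule bexI[OF _ FW(2)], rule e)
  then show ?thesis unfolding typical_def Let_def n(1) num using g(1) n(2) by (intro conjI)
qed

text \<open>\<open>output_divisor\<close> applies with the divisor \<open>D + D'\<close>. Apart from the point at infinity, the divisor of \<open>F''/s\<close> is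
  the difference between the result and \<open>D + D'\<close>.\<close>

lemma steps_correct:
  assumes D: "good c D" "good c D'" and deg: "divdeg c D = 3" "divdeg c D' = 3"
    and s: "s - X ^ 3 \<in> Fil 8" "s \<in> ID (\<lambda>P. coef D P + coef D' P)"
    and t: "t - X\<^sup>2 * Y \<in> Fil 8" "t \<in> ID (\<lambda>P. coef D P + coef D' P)"
    and r: "step3 (M2_matrix c (el s) (el t)) r" and out: "step4 c r out"
  shows "\<exists>D'''. good c D''' \<and> divdeg c D''' = 3 \<and> represents c out D''' \<and>
    jac_class c D''' = jac_class c D \<otimes>\<^bsub>Pic0 c\<^esub> jac_class c D' \<and> typical c D'''"
proof -
  let ?\<delta> = "\<lambda>P. coef D P + coef D' P"
  let ?F = "Fp (ra r) (rb r) (rc r)" and ?G = "Gp (rd r) (re r) (rf r)" and ?G1 = "Gp (rd out) (re out) (rf out)"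
  let ?M = "M2_matrix c (el s) (el t)"
  note ls = has_lead_subdegree[OF lead_s[OF s(1)]] and lF = has_lead_subdegree[OF lead_Fp[of "ra r" "rb r" "rc r"]]
  have sS: "s \<in> S" and tS: "t \<in> S" using s(2) t(2) by (simp_all add: ID_def)
  have fin: "finite (supp ?\<delta>)" "edeg ?\<delta> = 6"
    using edeg_add[OF finite_supp_coef[OF D(1)] finite_supp_coef[OF D(2)]] deg divdeg_good[OF D(1)] divdeg_good[OF D(2)]
    by simp_all
  note r3 = step3_facts[OF s(1) t(1) r]
  obtain h w where F: "?F * t = s * h + w" "h \<in> Fil 8" "w \<in> Fil 8" using r3(3) unfolding VQ_def by blast
  obtain h' w' where G: "?G * t = s * h' + w'" "h' \<in> Fil 8" "w' \<in> Fil 8" using r3(4) unfolding VQ_def by blast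
  obtain H where H: "H \<in> Fil 8" "?G1 * ?G + ?F * H \<in> Fil 5" using out unfolding step4_iff by blast
  \<comment> \<open>By the second column of \<open>M''\<close>, \<open>beta2 x y^2\<close> is a combination of \<open>s\<close> and \<open>t\<close> up to \<open>W^8\<close>.\<close>
  let ?v = "colV s t 1"
  have b: "?v $ 1 \<noteq> 0" using r M2_kernel(2)[OF s(1) t(1)] by (auto simp: step3_def)
  have "X * t - mid ?v \<in> VQ s" using colV(2)[OF s(1) t(1), of 1] by (simp add: cof_def)
  then obtain y z where yz: "X * t - mid ?v = s * y + z" "y \<in> Fil 8" "z \<in> Fil 8" unfolding VQ_def by blast
  have "X * t - K (?v $ 0) * (X\<^sup>2 * Y) - K (?v $ 1) * (X * Y\<^sup>2) = s * y + z"
    using yz(1) colV(6)[OF s(1) t(1)] by (simp add: mid_def diff_diff_add)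
  then have "s * (- y) + t * (X - K (?v $ 0)) = K (?v $ 1) * (X * Y\<^sup>2) + (z - K (?v $ 0) * (t - X\<^sup>2 * Y))"
    by (simp add: algebra_simps)
  moreover have "z - K (?v $ 0) * (t - X\<^sup>2 * Y) \<in> Fil 8"
    by (rule Fil_lincomb(3)[OF yz(3) Fil_lincomb(5)[OF t(1)]])
  then have "z - K (?v $ 0) * (t - X\<^sup>2 * Y) \<in> Fil (11 - 1)" using Fil_mono[of 8 10] by auto
  ultimately have l11: "has_lead 11 (s * (- y) + t * (X - K (?v $ 0)))"
    using has_lead_add[OF has_lead_scale[OF mid_leads(2) b]] by simp
  have pq: "- y \<in> S" "X - K (?v $ 0) \<in> S" using Fil_S[OF yz(2)] by auto
  have Fd: "?F * t - s * h \<in> Fil 8" "?G * t - s * h' \<in> Fil 8" using F G by simp_all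
  note o = output_divisor[OF s t pq l11 fin r3(1) Fil_S[OF F(2)] Fd(1) Fil_S[OF G(2)] Fd(2) Fil_S[OF H(1)] Gp_S H(2)]
  define \<epsilon> where "\<epsilon> = (\<lambda>P. vord P ?F - (vord P s - ?\<delta> P))"
  define E where "E = affine_div c (el ?F) - affine_div c (el s) + D + D'"
  have F0: "?F \<noteq> 0" and s0: "s \<noteq> 0" using lF ls by simp_all
  have lk: "Poly_Mapping.lookup E q = (case q of None \<Rightarrow> 0 | Some P \<Rightarrow> if P \<in> pts then int (\<epsilon> P) else 0)" for q
  proof (cases q)
    case (Some P)
    have "int (vord P ?F) - int (vord P s) + int (coef D P) + int (coef D' P) = int (\<epsilon> P)" if "P \<in> pts"
      using o(1)[OF that] o(2)[OF that] unfolding \<epsilon>_def by linarith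
    then show ?thesis
      unfolding E_def lookup_add lookup_minus lookup_affine_div[OF Fp_S F0] lookup_affine_div[OF sS s0]
      lookup_good[OF D(1)] lookup_good[OF D(2)]
      by (simp add: Some)
  next
    case None
    then show ?thesis
      unfolding E_def lookup_add lookup_minus lookup_affine_div[OF Fp_S F0] lookup_affine_div[OF sS s0]
      lookup_good[OF D(1)] lookup_good[OF D(2)]
      by simp
  qed
  note E = goodI[OF lk]
  have IDE: "ID (coef E) = ID \<epsilon>" using E(2) by (simp add: ID_def)
  have "edeg (coef E) = edeg \<epsilon>" by (rule edeg_cong[OF E(2)])
  then have dE: "divdeg c E = 3" using divdeg_good[OF E(1)] o(3) by (simp add: \<epsilon>_def)
  have mem: "?F \<in> ID (coef E)" "?G1 \<in> ID (coef E)" unfolding IDE \<epsilon>_def using o(4,5) by simp_all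
  have out': "ra out = ra r" "rb out = rb r" "rc out = rc r" "r_ainv out = r_ainv r" using out unfolding step4_iff by auto
  have rep: "represents c out E"
    unfolding represents_def F_of_el G_of_el out'
    using r3(1,2) mem has_lead_Fil[OF lead_Fp, of 6] has_lead_Fil[OF lead_Gp, of 7] by (simp add: WD_iff[OF E(1)])
  have typical: "typical c E" by (rule typical_FG[OF E(1) dE r3(1) mem])
  have "jac_class c E = jac_class c D \<otimes>\<^bsub>Pic0 c\<^esub> jac_class c D'"
  proof (rule jac_class_sum)
    have fd: "int (fdeg c (el ?F)) = 6" "int (fdeg c (el s)) = 9" using fdeg_el[OF Fp_S F0] fdeg_el[OF sS s0] ls lF by simp_all
    show "E = D + D' - frag_cmul 3 (frag_of None) + (full_div c (el ?F) - full_div c (el s))"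
      unfolding E_def full_div_def fd by (rule poly_mapping_int_eqI) (simp add: lookup_add lookup_minus)
    show "full_div c (el ?F) - full_div c (el s) \<in> principal_divisors c"
      unfolding principal_divisors_iff using sS s0 F0 by (intro bexI[of _ ?F] bexI[of _ s]) auto
  qed
  then show ?thesis using E(1) dE rep typical by blast
qed

lemma steps_exist:
  assumes s: "s - X ^ 3 \<in> Fil 8" and t: "t - X\<^sup>2 * Y \<in> Fil 8"
    and nz: "beta2 (M2_matrix c (el s) (el t)) * gamma4 (M2_matrix c (el s) (el t)) \<noteq> 0"
  shows "\<exists>r out. step3 (M2_matrix c (el s) (el t)) r \<and> step4 c r out"
proof -
  obtain r where r: "step3 (M2_matrix c (el s) (el t)) r" using step3_exists[OF s t nz] by blast
  note r3 = step3_facts[OF s t r]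
  obtain d e f H where "H \<in> Fil 8" "Gp d e f * Gp (rd r) (re r) (rf r) + Fp (ra r) (rb r) (rc r) * H \<in> Fil 5"
    using complement_exists[OF r3(1)] by blast
  then have "step4 c r (Rep (ra r) (rb r) (rc r) d e f (r_ainv r))" unfolding step4_iff by auto
  then show ?thesis using r by blast
qed

text \<open>Without the two inversions nothing is returned. The assumption isolates what the addition and the doubling have
  to show about the second step.\<close>

lemma sum_returned_iff:
  assumes D: "good c D" "good c D'" and deg: "divdeg c D = 3" "divdeg c D' = 3"
    and step2: "\<And>s t. step2 c M B s t \<Longrightarrow> \<exists>\<sigma> \<tau>. s = el \<sigma> \<and> t = el \<tau> \<and> \<sigma> - X ^ 3 \<in> Fil 8 \<and> \<tau> - X\<^sup>2 * Y \<in> Fil 8 \<and>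
      \<sigma> \<in> ID (\<lambda>P. coef D P + coef D' P) \<and> \<tau> \<in> ID (\<lambda>P. coef D P + coef D' P)"
  shows "typical_sum_returned c D D' M B \<longleftrightarrow> inversions_possible c M B"
proof
  assume "typical_sum_returned c D D' M B"
  then obtain out s t r where st: "step2 c M B s t" "step3 (M2_matrix c s t) r"
    unfolding typical_sum_returned_def steps_return_def by blast
  then show "inversions_possible c M B" unfolding inversions_possible_def step2_def step3_def by blast
next
  assume "inversions_possible c M B"
  then obtain s t where st: "step2 c M B s t" "beta2 (M2_matrix c s t) * gamma4 (M2_matrix c s t) \<noteq> 0"
    unfolding inversions_possible_def by blast
  obtain \<sigma> \<tau> where el: "s = el \<sigma>" "t = el \<tau>" "\<sigma> - X ^ 3 \<in> Fil 8" "\<tau> - X\<^sup>2 * Y \<in> Fil 8" using step2[OF st(1)] by blast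
  have "\<exists>out. steps_return c M B out"
    using steps_exist[OF el(3,4)] st unfolding steps_return_def el(1,2) by blast
  moreover have "\<exists>D'''. good c D''' \<and> divdeg c D''' = 3 \<and> represents c out D''' \<and>
      jac_class c D''' = jac_class c D \<otimes>\<^bsub>Pic0 c\<^esub> jac_class c D' \<and> typical c D'''" if o: "steps_return c M B out" for out
  proof -
    obtain s t r where q: "step2 c M B s t" "step3 (M2_matrix c s t) r" "step4 c r out" using o unfolding steps_return_def by blast
    obtain \<sigma> \<tau> where e: "s = el \<sigma>" "t = el \<tau>" "\<sigma> - X ^ 3 \<in> Fil 8" "\<tau> - X\<^sup>2 * Y \<in> Fil 8"
      "\<sigma> \<in> ID (\<lambda>P. coef D P + coef D' P)" "\<tau> \<in> ID (\<lambda>P. coef D P + coef D' P)" using step2[OF q(1)] by blast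
    show ?thesis by (rule steps_correct[OF D deg e(3,5,4,6) q(2)[unfolded e(1,2)] q(3)])
  qed
  ultimately show "typical_sum_returned c D D' M B" unfolding typical_sum_returned_def by blast
qed

end

section \<open>Addition and doubling\<close>

context c34
begin

lemma represents_rep3:
  assumes "good c D" "divdeg c D = 3" "represents c r D"
  shows "rep3 D (ra r) (rb r) (rc r) (rd r) (re r) (rf r)"
  using assms unfolding represents_def rep3_def F_of_el G_of_el by (simp add: WD_iff)

lemma ID_subset_idl:
  assumes P: "P \<in> pts" and "\<delta> P \<noteq> 0" "z \<in> ID \<delta>"
  shows "z \<in> idl P"
proof -
  have z: "z \<in> S" "vge P (\<delta> P) z" using assms by (simp_all add: ID_def)
  then have "vge P 1 z" using vge_mono[OF P z(2), of 1] assms(2) by simp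
  then show ?thesis using vge_1_iff[OF P z(1)] by simp
qed

lemma FG_combination_lead:
  fixes a b e d e' f :: 'k
  assumes "a \<noteq> 0"
  defines "F \<equiv> Fp a b e" and "G \<equiv> Gp d e' f"
  shows "K u * F + K v * G + K w * (K k * (Y * F - X * G)) + X * F - X ^ 3 \<in> Fil 8"
    "K u * F + K v * G + K w * (K k * (Y * F - X * G)) + X * G - X\<^sup>2 * Y \<in> Fil 8"
proof -
  have FG: "F \<in> Fil 8" "G \<in> Fil 8" "Y * F - X * G \<in> Fil 8"
    using has_lead_Fil[OF lead_Fp, of 8 a b e] has_lead_Fil[OF lead_Gp, of 8 d e' f] has_lead_Fil[OF lead_H[OF assms(1)], of 8 b e d e' f]
    by (simp_all add: F_def G_def)
  have X3: "X \<in> Fil 3" using has_lead_base(2) by (simp add: has_lead_def)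
  have "F - X\<^sup>2 \<in> Fil 4" "G - X * Y \<in> Fil 4"
    using Fil_4_I[of a b e] Fil_4_I[of d e' f] by (simp_all add: F_def G_def Fp_def Gp_def add.assoc)
  then have "X * (F - X\<^sup>2) \<in> Fil 8" "X * (G - X * Y) \<in> Fil 8"
    using Fil_mult[OF X3, of _ 4] Fil_mono[of 7 8] by auto
  then have "K u * F + K v * G + K w * (K k * (Y * F - X * G)) + X * (F - X\<^sup>2) \<in> Fil 8"
    "K u * F + K v * G + K w * (K k * (Y * F - X * G)) + X * (G - X * Y) \<in> Fil 8"
    using Fil_lincomb(2)[OF Fil_lincomb(2)[OF Fil_lincomb(2)[OF Fil_lincomb(5)[OF FG(1)] Fil_lincomb(5)[OF FG(2)]]
      Fil_lincomb(5)[OF Fil_lincomb(5)[OF FG(3)]]]] by blast+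
  then show "K u * F + K v * G + K w * (K k * (Y * F - X * G)) + X * F - X ^ 3 \<in> Fil 8"
    "K u * F + K v * G + K w * (K k * (Y * F - X * G)) + X * G - X\<^sup>2 * Y \<in> Fil 8"
    by (simp_all add: algebra_simps power2_eq_square power3_eq_cube)
qed

text \<open>The lists of functions used by both algorithms differ in the scalar \<open>k\<close> only, which is \<open>a\<^sup>-\<^sup>1\<close> for addition and
  1 for doubling.\<close>

definition gens :: "'k \<Rightarrow> 'k rep \<Rightarrow> 'k fls list" where
  "gens k r = (let F = Fp (ra r) (rb r) (rc r); G = Gp (rd r) (re r) (rf r) in [F, G, K k * (Y * F - X * G), X * F, X * G])"

lemma gens:
  "length (gens k r) = 5" "set (gens k r) \<subseteq> S"
  by (auto simp: gens_def Let_def)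

lemma yF_xG_el: "yF_xG c r = el (Y * Fp (ra r) (rb r) (rc r) - X * Gp (rd r) (re r) (rf r))"
  unfolding yF_xG_def F_of_el G_of_el by (simp add: cls_el ev_XX ev_YY el_mult el_minus)

lemma add_basis_el: "add_basis c r = map el (gens (r_ainv r) r)"
  unfolding add_basis_def gens_def Let_def H_of_def yF_xG_el F_of_el G_of_el
  by (simp add: cls_el ev_XX ev_cst el_mult)

lemma dbl_basis_el: "dbl_basis c r = map el (gens 1 r)"
  unfolding dbl_basis_def gens_def Let_def yF_xG_el F_of_el G_of_el
  by (simp add: cls_el ev_XX el_mult)

lemma gens_ideal:
  assumes J: "S_ideal J" and "Fp (ra r) (rb r) (rc r) \<in> J" "Gp (rd r) (re r) (rf r) \<in> J"
  shows "set (gens k r) \<subseteq> J"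
proof -
  note I = S_idealD[OF J]
  have "X * Fp (ra r) (rb r) (rc r) \<in> J" "Y * Fp (ra r) (rb r) (rc r) \<in> J" "X * Gp (rd r) (re r) (rf r) \<in> J"
    using I(4) assms(2,3) by blast+
  moreover from this have "K k * (Y * Fp (ra r) (rb r) (rc r) - X * Gp (rd r) (re r) (rf r)) \<in> J"
    using I(4,7) by blast
  ultimately show ?thesis using assms by (simp add: gens_def Let_def)
qed

lemma gens_Fil:
  assumes "ra r \<noteq> 0"
  shows "set (gens k r) \<subseteq> Fil 10"
proof -
  let ?F = "Fp (ra r) (rb r) (rc r)" and ?G = "Gp (rd r) (re r) (rf r)"
  have "?F \<in> Fil 10" "?G \<in> Fil 10" "Y * ?F - X * ?G \<in> Fil 10" "X * ?F \<in> Fil 10" "X * ?G \<in> Fil 10"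
    using has_lead_Fil[OF lead_Fp, of 10] has_lead_Fil[OF lead_Gp, of 10] has_lead_Fil[OF lead_H[OF assms], of 10]
      has_lead_Fil[OF has_lead_mult[OF has_lead_base(2) lead_Fp], of 10] has_lead_Fil[OF has_lead_mult[OF has_lead_base(2) lead_Gp], of 10]
    by simp_all
  then show ?thesis by (auto simp: gens_def Let_def)
qed

text \<open>The prescribed coefficients of \<open>x F\<close> and \<open>x G\<close> fix the leading monomials \<open>x^3\<close> and \<open>x^2 y\<close>, since the other three
  functions have pole orders at most 8.\<close>

lemma step2_combinations:
  assumes st: "step2 c M (map el (gens k r)) s t" and a: "ra r \<noteq> 0"
  shows "\<exists>v w. v \<in> mat_kernel M \<and> w \<in> mat_kernel M \<and>
    s = el (\<Sum>j<5. K (v $ j) * gens k r ! j) \<and> t = el (\<Sum>j<5. K (w $ j) * gens k r ! j) \<and>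
    (\<Sum>j<5. K (v $ j) * gens k r ! j) - X ^ 3 \<in> Fil 8 \<and> (\<Sum>j<5. K (w $ j) * gens k r ! j) - X\<^sup>2 * Y \<in> Fil 8"
proof -
  obtain v where v: "v \<in> mat_kernel M" "v $ 3 = 1" "v $ 4 = 0" "s = lin_comb c v (map el (gens k r))"
    using st unfolding step2_def by blast
  obtain w where w: "w \<in> mat_kernel M" "w $ 3 = 0" "w $ 4 = 1" "t = lin_comb c w (map el (gens k r))"
    using st unfolding step2_def by blast
  have "(\<Sum>j<5. K (v $ j) * gens k r ! j) - X ^ 3 \<in> Fil 8"
    using FG_combination_lead(1)[OF a] v(2,3) unfolding sum_lessThan_5 by (simp add: gens_def Let_def)
  moreover have "(\<Sum>j<5. K (w $ j) * gens k r ! j) - X\<^sup>2 * Y \<in> Fil 8"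
    using FG_combination_lead(2)[OF a] w(2,3) unfolding sum_lessThan_5 by (simp add: gens_def Let_def)
  ultimately show ?thesis using v(1,4) w(1,4) unfolding lin_comb_el[OF gens] by blast
qed

lemma combination_in_ideal:
  assumes J: "S_ideal J" and "set zs \<subseteq> J" "n \<le> length zs"
  shows "(\<Sum>j<n. K (v j) * zs ! j) \<in> J"
  using assms(2,3) by (intro V.subspace_sum[OF S_ideal_subspace[OF J]] V.subspace_scale[OF S_ideal_subspace[OF J]]) auto

text \<open>If \<open>U \<noteq> 0\<close>, a function that vanishes on \<open>D'\<close> is congruent to 1 modulo the ideal of \<open>D\<close>. So the divisors are disjoint,
  and a function that vanishes on each of them vanishes on \<open>D + D'\<close>.\<close>

lemma addition_correct:
  assumes D: "good c D" "divdeg c D = 3" "represents c r D" and D': "good c D'" "divdeg c D' = 3" "represents c r' D'"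
  shows "typical_sum_returned c D D' (add_matrix c D r') (add_basis c r') \<longleftrightarrow>
    inversions_possible c (add_matrix c D r') (add_basis c r')"
proof (rule sum_returned_iff[OF D(1) D'(1) D(2) D'(2)])
  note rep = represents_rep3[OF D] and rep' = represents_rep3[OF D']
  let ?zs = "gens (r_ainv r') r'"
  have a: "ra r' \<noteq> 0" using rep' by (simp add: rep3_def)
  have zs: "set ?zs \<subseteq> Fil (int 10)" using gens_Fil[OF a] by simp
  have zJ: "set ?zs \<subseteq> ID (coef D')" using gens_ideal[OF ID_S_ideal] rep' by (simp add: rep3_def)
  fix s t assume "step2 c (add_matrix c D r') (add_basis c r') s t"
  then have st: "step2 c (mat_of_cols 3 (map (image_mod_D c 10 D) (map el ?zs))) (map el ?zs) s t"
    unfolding add_matrix_def add_basis_el .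
  have N: "(5::nat) \<le> 10" by simp
  note cols = image_cols[OF rep gens(1) zs N]
  obtain u :: "'k vec" where u: "(\<Sum>j<3. K (u $ j) * ?zs ! j) - 1 \<in> ID (coef D)"
    using cols(2) st unfolding step2_def by blast
  have disj: "coef D P = 0 \<or> coef D' P = 0" if P: "P \<in> pts" for P
  proof (rule ccontr)
    assume "\<not> (coef D P = 0 \<or> coef D' P = 0)"
    then have "(\<Sum>j<3. K (u $ j) * ?zs ! j) - 1 \<in> idl P" "(\<Sum>j<3. K (u $ j) * ?zs ! j) \<in> idl P"
      using ID_subset_idl[OF P] u combination_in_ideal[OF ID_S_ideal zJ, of 3] gens(1) by auto
    from S_idealD(7)[OF idl_S_ideal[OF P] this(2,1)] show False using idl_proper[OF P] by simp
  qed
  have both: "z \<in> ID (\<lambda>P. coef D P + coef D' P)" if "z \<in> ID (coef D)" "z \<in> ID (coef D')" for z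
    unfolding ID_def
  proof (intro CollectI conjI ballI)
    show "z \<in> S" using that by (simp add: ID_def)
    fix P assume P: "P \<in> pts"
    show "vge P (coef D P + coef D' P) z" using disj[OF P] that P by (auto simp: ID_def)
  qed
  obtain v w where vw: "v \<in> mat_kernel (mat_of_cols 3 (map (image_mod_D c 10 D) (map el ?zs)))"
    "w \<in> mat_kernel (mat_of_cols 3 (map (image_mod_D c 10 D) (map el ?zs)))"
    "s = el (\<Sum>j<5. K (v $ j) * ?zs ! j)" "t = el (\<Sum>j<5. K (w $ j) * ?zs ! j)"
    "(\<Sum>j<5. K (v $ j) * ?zs ! j) - X ^ 3 \<in> Fil 8" "(\<Sum>j<5. K (w $ j) * ?zs ! j) - X\<^sup>2 * Y \<in> Fil 8"
    using step2_combinations[OF st a] by blast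
  have mem: "(\<Sum>j<5. K (x $ j) * ?zs ! j) \<in> ID (\<lambda>P. coef D P + coef D' P)"
    if "x \<in> mat_kernel (mat_of_cols 3 (map (image_mod_D c 10 D) (map el ?zs)))" for x
    by (rule both[OF cols(1)[OF that]], rule combination_in_ideal[OF ID_S_ideal zJ]) (simp add: gens(1))
  show "\<exists>\<sigma> \<tau>. s = el \<sigma> \<and> t = el \<tau> \<and> \<sigma> - X ^ 3 \<in> Fil 8 \<and> \<tau> - X\<^sup>2 * Y \<in> Fil 8 \<and>
      \<sigma> \<in> ID (\<lambda>P. coef D P + coef D' P) \<and> \<tau> \<in> ID (\<lambda>P. coef D P + coef D' P)"
    using vw mem[OF vw(1)] mem[OF vw(2)] by blast
qed

lemma complementary_divisor:
  assumes D: "good c D" and z: "z \<in> S" "z \<noteq> 0" "z \<in> ID (coef D)"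
  shows "good c (affine_div c (el z) - D)" "P \<in> pts \<Longrightarrow> coef (affine_div c (el z) - D) P = vord P z - coef D P"
proof -
  have "Poly_Mapping.lookup (affine_div c (el z) - D) q =
      (case q of None \<Rightarrow> 0 | Some P \<Rightarrow> if P \<in> pts then int (vord P z - coef D P) else 0)" for q
    unfolding lookup_minus lookup_affine_div[OF z(1,2)] lookup_good[OF D]
    using z(3) unfolding ID_iff_vord[OF z(1,2)] by (auto split: option.splits simp: of_nat_diff)
  note g = goodI[OF this]
  show "good c (affine_div c (el z) - D)" "P \<in> pts \<Longrightarrow> coef (affine_div c (el z) - D) P = vord P z - coef D P"
    using g by auto
qed

lemma dbl_aux_iff:
  assumes D: "good c D" "divdeg c D = 3" "represents c r D"
  defines "F \<equiv> Fp (ra r) (rb r) (rc r)" and "G \<equiv> Gp (rd r) (re r) (rf r)"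
  shows "dbl_aux c D r G1 H1 \<longleftrightarrow> (\<exists>g h. G1 = el g \<and> H1 = el h \<and> has_lead 7 g \<and> h \<in> Fil 8 \<and>
    g \<in> ID (\<lambda>P. vord P F - coef D P) \<and> G * g + F * h = 0)"
proof -
  have rep: "F \<in> ID (coef D)" using represents_rep3[OF D] by (simp add: rep3_def F_def)
  have F: "F \<in> S" "F \<noteq> 0" "G \<in> S" using has_lead_subdegree[OF lead_Fp] by (auto simp: F_def G_def)
  let ?A = "affine_div c (el F) - D"
  note A = complementary_divisor[OF D(1) F(1,2) rep]
  have IDA: "ID (coef ?A) = ID (\<lambda>P. vord P F - coef D P)" unfolding ID_def using A(2) by simp
  have G1: "el g \<in> WD c 7 ?A \<and> el g \<noteq> \<zero>\<^bsub>R\<^esub> \<and> fdeg c (el g) = 7 \<longleftrightarrow> has_lead 7 g \<and> g \<in> ID (\<lambda>P. vord P F - coef D P)"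
    if g: "g \<in> S" for g
  proof -
    have "el g \<noteq> \<zero>\<^bsub>R\<^esub> \<and> fdeg c (el g) = 7 \<longleftrightarrow> has_lead 7 g"
    proof
      assume h: "el g \<noteq> \<zero>\<^bsub>R\<^esub> \<and> fdeg c (el g) = 7"
      then have "g \<noteq> 0" using el_zero by auto
      then show "has_lead 7 g" using subdegree_has_lead[OF g] fdeg_el[OF g] h by simp
    next
      assume "has_lead 7 g"
      from has_lead_subdegree[OF this] show "el g \<noteq> \<zero>\<^bsub>R\<^esub> \<and> fdeg c (el g) = 7"
        using fdeg_el[OF g] g by (simp add: el_zero)
    qed
    then show ?thesis using WD_iff[OF A(1) g, of 7] IDA by (auto simp: has_lead_def)
  qed
  have eq: "el G \<otimes>\<^bsub>R\<^esub> el g \<oplus>\<^bsub>R\<^esub> el F \<otimes>\<^bsub>R\<^esub> el h = \<zero>\<^bsub>R\<^esub> \<longleftrightarrow> G * g + F * h = 0" if "g \<in> S" "h \<in> S" for g h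
    using that F by (simp add: el_mult el_add el_zero)
  show ?thesis
    unfolding dbl_aux_def F_of_el G_of_el F_def[symmetric] G_def[symmetric]
  proof
    assume l: "G1 \<in> WD c 7 ?A \<and> G1 \<noteq> \<zero>\<^bsub>R\<^esub> \<and> fdeg c G1 = 7 \<and> H1 \<in> W c 8 \<and>
      el G \<otimes>\<^bsub>R\<^esub> G1 \<oplus>\<^bsub>R\<^esub> el F \<otimes>\<^bsub>R\<^esub> H1 = \<zero>\<^bsub>R\<^esub>"
    obtain g where g: "g \<in> S" "G1 = el g" using WD_E[OF conjunct1[OF l]] by blast
    obtain h where h: "h \<in> Fil 8" "H1 = el h" using l unfolding W_eq by auto
    show "\<exists>g h. G1 = el g \<and> H1 = el h \<and> has_lead 7 g \<and> h \<in> Fil 8 \<and>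
        g \<in> ID (\<lambda>P. vord P F - coef D P) \<and> G * g + F * h = 0"
      using l g(2) h G1[OF g(1)] eq[OF g(1) Fil_S[OF h(1)]] by blast
  next
    assume "\<exists>g h. G1 = el g \<and> H1 = el h \<and> has_lead 7 g \<and> h \<in> Fil 8 \<and>
        g \<in> ID (\<lambda>P. vord P F - coef D P) \<and> G * g + F * h = 0"
    then obtain g h where gh: "G1 = el g" "H1 = el h" "has_lead 7 g" "h \<in> Fil 8"
        "g \<in> ID (\<lambda>P. vord P F - coef D P)" "G * g + F * h = 0" by blast
    have gS: "g \<in> S" using gh(3) Fil_S by (auto simp: has_lead_def)
    have "H1 \<in> W c 8" using gh(2,4) unfolding W_eq by auto
    then show "G1 \<in> WD c 7 ?A \<and> G1 \<noteq> \<zero>\<^bsub>R\<^esub> \<and> fdeg c G1 = 7 \<and> H1 \<in> W c 8 \<and>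
      el G \<otimes>\<^bsub>R\<^esub> G1 \<oplus>\<^bsub>R\<^esub> el F \<otimes>\<^bsub>R\<^esub> H1 = \<zero>\<^bsub>R\<^esub>"
      using G1[OF gS] eq[OF gS Fil_S[OF gh(4)]] gh by blast
  qed
qed

text \<open>The complementary generator of \<open>complement_exists\<close> is a possible \<open>G\<^sub>1\<close>.\<close>

lemma dbl_aux_exists:
  assumes D: "good c D" "divdeg c D = 3" "represents c r D"
  shows "\<exists>G1 H1. dbl_aux c D r G1 H1"
proof -
  let ?F = "Fp (ra r) (rb r) (rc r)" and ?G = "Gp (rd r) (re r) (rf r)"
  note rep = represents_rep3[OF D]
  then have a: "ra r \<noteq> 0" and J: "?F \<in> ID (coef D)" "?G \<in> ID (coef D)" by (simp_all add: rep3_def)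
  note ed = rep3_edeg[OF rep]
  obtain d e f H where H: "H \<in> Fil 8" "Gp d e f * ?G + ?F * H \<in> Fil 5" using complement_exists[OF a] by blast
  note m = complement_member[OF a J conjunct2[OF ed] conjunct1[OF ed] Fil_S[OF H(1)] Gp_S H(2)]
  have "?G * Gp d e f + ?F * H = 0" using m(1) by (simp add: mult.commute)
  then show ?thesis unfolding dbl_aux_iff[OF D] using H(1) m(2) lead_Gp by blast
qed

text \<open>If \<open>g\<close> had an additional zero at a point of \<open>\<delta>\<close>, all \<open>g zs / F\<close> would vanish there, and none of their
  combinations could be congruent to 1. So the order of \<open>g\<close> there is that of \<open>F\<close> minus \<open>\<delta>\<close>, and an order of at least
  \<open>\<delta>\<close> of \<open>y g / F\<close> means an order of at least \<open>2 \<delta>\<close> of \<open>y\<close>.\<close>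

lemma doubled_divisor_member:
  assumes F: "F \<in> S" "F \<noteq> 0" "F \<in> ID \<delta>" and g: "g \<in> S" "g \<noteq> 0" "g \<in> ID (\<lambda>P. vord P F - \<delta> P)"
    and zs: "\<And>j. j \<in> A \<Longrightarrow> zs j \<in> ID \<delta> \<and> zs' j \<in> S \<and> F * zs' j = g * zs j"
    and one: "(\<Sum>j\<in>A. K (u j) * zs' j) - 1 \<in> ID \<delta>"
    and y: "y \<in> S" "y \<noteq> 0" "y' \<in> ID \<delta>" "F * y' = g * y"
  shows "y \<in> ID (\<lambda>P. \<delta> P + \<delta> P)"
  unfolding ID_iff_vord[OF y(1,2)]
proof
  fix P assume P: "P \<in> pts"
  show "\<delta> P + \<delta> P \<le> vord P y"
  proof (cases "\<delta> P = 0")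
    case False
    note I = idl_S_ideal[OF P]
    have le: "vord P F - \<delta> P \<le> vord P g" "\<delta> P \<le> vord P F"
      using g(3) F(3) P unfolding ID_iff_vord[OF g(1,2)] ID_iff_vord[OF F(1,2)] by blast+
    have "vord P g = vord P F - \<delta> P"
    proof (rule ccontr)
      assume "vord P g \<noteq> vord P F - \<delta> P"
      then have gt: "vord P F < vord P g + \<delta> P" using le by simp
      have "zs' j \<in> idl P" if j: "j \<in> A" for j
      proof (cases "zs' j = 0")
        case True
        then show ?thesis using S_idealD(2)[OF I] by simp
      next
        case nz: False
        have z: "zs j \<in> ID \<delta>" "zs' j \<in> S" "F * zs' j = g * zs j" using zs[OF j] by auto
        then have z0: "zs j \<noteq> 0" "zs j \<in> S" using nz F(2) by (auto simp: ID_def)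
        have "vord P F + vord P (zs' j) = vord P g + vord P (zs j)"
          using vord_mult[OF P F(1,2) z(2) nz] vord_mult[OF P g(1,2) z0(2,1)] z(3) by simp
        moreover have "\<delta> P \<le> vord P (zs j)" using z(1) P unfolding ID_iff_vord[OF z0(2,1)] by blast
        ultimately have "1 \<le> vord P (zs' j)" using gt by simp
        then show ?thesis using vge_iff_vord[OF P z(2) nz] vge_1_iff[OF P z(2)] by simp
      qed
      then have "(\<Sum>j\<in>A. K (u j) * zs' j) \<in> idl P"
        by (intro V.subspace_sum[OF S_ideal_subspace[OF I]] V.subspace_scale[OF S_ideal_subspace[OF I]])
      moreover have "(\<Sum>j\<in>A. K (u j) * zs' j) - 1 \<in> idl P" by (rule ID_subset_idl[where \<delta> = \<delta>, OF P False one])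
      ultimately have "(\<Sum>j\<in>A. K (u j) * zs' j) - ((\<Sum>j\<in>A. K (u j) * zs' j) - 1) \<in> idl P" by (rule S_idealD(7)[OF I])
      then show False using idl_proper[OF P] by simp
    qed
    moreover have y': "y' \<noteq> 0" "y' \<in> S" using y g(2) by (auto simp: ID_def)
    have "vord P F + vord P y' = vord P g + vord P y"
      using vord_mult[OF P F(1,2) y'(2,1)] vord_mult[OF P g(1,2) y(1,2)] y(4) by simp
    moreover have "\<delta> P \<le> vord P y'" using y(3) P unfolding ID_iff_vord[OF y'(2,1)] by blast
    ultimately show ?thesis using le by simp
  qed simp
qed

lemma doubling_correct:
  assumes D: "good c D" "divdeg c D = 3" "represents c r D" and aux: "dbl_aux c D r G1 H1"
  shows "typical_sum_returned c D D (dbl_matrix c D G1 H1) (dbl_basis c r) \<longleftrightarrow>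
    inversions_possible c (dbl_matrix c D G1 H1) (dbl_basis c r)"
proof (rule sum_returned_iff[OF D(1) D(1) D(2) D(2)])
  let ?F = "Fp (ra r) (rb r) (rc r)" and ?G = "Gp (rd r) (re r) (rf r)"
  note rep = represents_rep3[OF D]
  then have a: "ra r \<noteq> 0" and J: "?F \<in> ID (coef D)" "?G \<in> ID (coef D)" by (simp_all add: rep3_def)
  have F0: "?F \<noteq> 0" using has_lead_subdegree[OF lead_Fp] by blast
  obtain g h where gh: "G1 = el g" "H1 = el h" "has_lead 7 g" "h \<in> Fil 8"
    "g \<in> ID (\<lambda>P. vord P ?F - coef D P)" "?G * g + ?F * h = 0" using aux unfolding dbl_aux_iff[OF D] by blast
  have gS: "g \<in> S" "g \<noteq> 0" using gh(3) Fil_S has_lead_subdegree[OF gh(3)] by (auto simp: has_lead_def)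
  have hS: "h \<in> S" by (rule Fil_S[OF gh(4)])
  \<comment> \<open>\<open>?zs'\<close> is \<open>g / F\<close> times \<open>?zs\<close>, as the relation \<open>G g + F h = 0\<close> shows.\<close>
  let ?zs = "gens 1 r" and ?zs' = "[g, - h, Y * g + X * h, X * g, - (X * h)]"
  have l': "length ?zs' = 5" by simp
  have Fil11: "set ?zs' \<subseteq> Fil (int 11)"
  proof -
    have F: "g \<in> Fil 7" "X \<in> Fil 3" "Y \<in> Fil 4" using gh(3) has_lead_base by (simp_all add: has_lead_def)
    have "Y * g \<in> Fil 11" "X * h \<in> Fil 11" "X * g \<in> Fil 11" "g \<in> Fil 11" "h \<in> Fil 11"
      using Fil_mult[OF F(3,1)] Fil_mult[OF F(2) gh(4)] Fil_mult[OF F(2,1)] F(1) gh(4)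
        Fil_mono[of 10 11] Fil_mono[of 7 11] Fil_mono[of 8 11] by auto
    then show ?thesis by (auto intro!: Fil_lincomb)
  qed
  have rel: "?F * ?zs' ! j = g * ?zs ! j" if "j < 5" for j
  proof -
    have "j = 0 \<or> j = 1 \<or> j = 2 \<or> j = 3 \<or> j = 4" using that by linarith
    moreover have h: "?F * h = - (?G * g)" using gh(6) by (simp add: eq_neg_iff_add_eq_0 add.commute)
    have "?F * (- h) = g * ?G" using h by (simp add: mult.commute)
    moreover have "?F * (Y * g + X * h) = g * (Y * ?F - X * ?G)"
    proof -
      have "?F * (Y * g + X * h) = Y * ?F * g + X * (?F * h)" by (simp add: algebra_simps)
      then show ?thesis unfolding h by (simp add: algebra_simps)
    qed
    moreover have "?F * (- (X * h)) = g * (X * ?G)"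
    proof -
      have "?F * (- (X * h)) = - (X * (?F * h))" by (simp add: algebra_simps)
      then show ?thesis unfolding h by (simp add: algebra_simps)
    qed
    ultimately show ?thesis by (auto simp: gens_def Let_def)
  qed
  have zJ: "set ?zs \<subseteq> ID (coef D)" by (rule gens_ideal[OF ID_S_ideal J])
  fix s t assume st': "step2 c (dbl_matrix c D G1 H1) (dbl_basis c r) s t"
  let ?M = "mat_of_cols 3 (map (image_mod_D c 11 D) (map el ?zs'))"
  have M: "dbl_matrix c D G1 H1 = ?M"
    unfolding dbl_matrix_def Let_def gh(1,2) using gS hS
    by (simp add: cls_el ev_XX ev_YY el_mult el_add el_uminus)
  have st: "step2 c ?M (map el ?zs) s t" using st' unfolding M dbl_basis_el .
  have N: "(5::nat) \<le> 11" by simp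
  note cols = image_cols[OF rep l' Fil11 N]
  obtain u :: "'k vec" where u: "(\<Sum>j<3. K (u $ j) * ?zs' ! j) - 1 \<in> ID (coef D)"
    using cols(2) st unfolding step2_def by blast
  have mem: "(\<Sum>j<5. K (x $ j) * ?zs ! j) \<in> ID (\<lambda>P. coef D P + coef D P)"
    if x: "x \<in> mat_kernel ?M" and l: "has_lead n (\<Sum>j<5. K (x $ j) * ?zs ! j)" for x n
  proof (rule doubled_divisor_member[where A = "{..<3}" and zs = "\<lambda>j. ?zs ! j", OF Fp_S F0 J(1) gS gh(5) _ u])
    show "?zs ! j \<in> ID (coef D) \<and> ?zs' ! j \<in> S \<and> ?F * ?zs' ! j = g * ?zs ! j" if "j \<in> {..<3}" for j
    proof -
      have j: "j < 5" using that by simp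
      have "?zs ! j \<in> ID (coef D)" by (rule subsetD[OF zJ nth_mem]) (use j gens(1) in simp)
      moreover have "?zs' ! j \<in> Fil (int 11)" by (rule subsetD[OF Fil11 nth_mem]) (use j l' in simp)
      then have "?zs' ! j \<in> S" by (rule Fil_S)
      ultimately show ?thesis using rel[OF j] by blast
    qed
    show "(\<Sum>j<5. K (x $ j) * ?zs ! j) \<in> S" using l Fil_S by (auto simp: has_lead_def)
    show "(\<Sum>j<5. K (x $ j) * ?zs ! j) \<noteq> 0" using has_lead_subdegree[OF l] by blast
    show "(\<Sum>j<5. K (x $ j) * ?zs' ! j) \<in> ID (coef D)" by (rule cols(1)[OF x])
    have "?F * (\<Sum>j<5. K (x $ j) * ?zs' ! j) = (\<Sum>j<5. K (x $ j) * (?F * ?zs' ! j))"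
      unfolding sum_distrib_left by (simp only: ac_simps)
    also have "\<dots> = (\<Sum>j<5. K (x $ j) * (g * ?zs ! j))" by (intro sum.cong refl) (use rel in simp)
    also have "\<dots> = g * (\<Sum>j<5. K (x $ j) * ?zs ! j)" unfolding sum_distrib_left by (simp only: ac_simps)
    finally show "?F * (\<Sum>j<5. K (x $ j) * ?zs' ! j) = g * (\<Sum>j<5. K (x $ j) * ?zs ! j)" .
  qed
  obtain v w where vw: "v \<in> mat_kernel ?M" "w \<in> mat_kernel ?M"
    "s = el (\<Sum>j<5. K (v $ j) * ?zs ! j)" "t = el (\<Sum>j<5. K (w $ j) * ?zs ! j)"
    "(\<Sum>j<5. K (v $ j) * ?zs ! j) - X ^ 3 \<in> Fil 8" "(\<Sum>j<5. K (w $ j) * ?zs ! j) - X\<^sup>2 * Y \<in> Fil 8"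
    using step2_combinations[OF st a] by blast
  show "\<exists>\<sigma> \<tau>. s = el \<sigma> \<and> t = el \<tau> \<and> \<sigma> - X ^ 3 \<in> Fil 8 \<and> \<tau> - X\<^sup>2 * Y \<in> Fil 8 \<and>
      \<sigma> \<in> ID (\<lambda>P. coef D P + coef D P) \<and> \<tau> \<in> ID (\<lambda>P. coef D P + coef D P)"
    using vw mem[OF vw(1) lead_s[OF vw(5)]] mem[OF vw(2) lead_t[OF vw(6)]] by blast
qed

end

theorem theorem4p1:
  fixes c :: "nat \<Rightarrow> nat \<Rightarrow> 'k::field"
    and D D' :: "'k divisor"
    and r r' :: "'k rep"
  assumes "C34_curve c"
    and "typical c D" and "divdeg c D = 3" and "represents c r D"
    and "typical c D'" and "divdeg c D' = 3" and "represents c r' D'"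
  shows "(D \<noteq> D' \<longrightarrow>
           (typical_sum_returned c D D' (add_matrix c D r') (add_basis c r') \<longleftrightarrow>
            inversions_possible c (add_matrix c D r') (add_basis c r'))) \<and>
         (D' = D \<longrightarrow>
           (\<exists>G1 H1. dbl_aux c D r G1 H1) \<and>
           (\<forall>G1 H1. dbl_aux c D r G1 H1 \<longrightarrow>
             (typical_sum_returned c D D' (dbl_matrix c D G1 H1) (dbl_basis c r) \<longleftrightarrow>
              inversions_possible c (dbl_matrix c D G1 H1) (dbl_basis c r))))"
proof -
  interpret c34 c by unfold_locales (fact assms(1))
  have good: "good c D" "good c D'" using assms(2,5) by (simp_all add: typical_def)
  note D = good(1) assms(3,4) and D' = good(2) assms(6,7)
  show ?thesis
    using addition_correct[OF D D'] dbl_aux_exists[OF D] doubling_correct[OF D] by blast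
qed

end
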